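(* Let $G$ be a subcubic planar graph (i.e. a planar graph of maximum degree at most $3$) that contains no cycle of length $k$ for any $k$ with $4\le k\le 8$. Then $AT(G^2)\le 6$, where $G^2$ is the square of $G$ and $AT$ denotes the Alon--Tarsi number.
   Context: Graphs are finite and simple. A graph is subcubic if its maximum degree is at most $3$. "Contains no $k$-cycle" means that $G$ has no subgraph (not necessarily induced) that is a cycle of length $k$. The square $G^2$ of a graph $G$ is the graph with the same vertex set $V(G)$ in which two distinct vertices are adjacent if and only if their distance in $G$ is at most $2$. For a graph $H$, fix an arbitrary linear ordering $<$ of its vertices. The graph polynomial of $H$ is $$P_H(\bm{x})=\prod_{u\sim v,\; u<v}(x_u-x_v),$$ a polynomial with integer coefficients in the variables $\bm{x}=(x_v)_{v\in V(H)}$, where the product is over all edges $uv$ of $H$ ($u\sim v$ means that $u$ and $v$ are adjacent). Changing the ordering changes $P_H$ only by a sign. For a positive integer $k$, the graph $H$ is Alon--Tarsi $k$-choosable if $P_H(\bm{x})$, when expanded, contains a monomial $\prod_{v\in V(H)}x_v^{t_v}$ with nonzero coefficient such that $t_v\le k-1$ for every $v\in V(H)$. The Alon--Tarsi number of $H$ is $$AT(H)=\min\{k : H \text{ is Alon--Tarsi } k\text{-choosable}\}.$$ *)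

theory Defs
  imports
    "HOL-Analysis.Analysis"
    "HOL-Library.Poly_Mapping"
    "Graph_Theory.Graph_Theory"
begin

text \<open>
  A finite simple graph is a \<^locale>\<open>pair_graph\<close>: a finite loop-free symmetric digraph in which the
  edge \<open>{u, v}\<close> is represented by the two arcs \<open>(u, v)\<close> and \<open>(v, u)\<close>. Hence the degree of a vertex
  is its \<^const>\<open>out_degree\<close>, and, for \<open>k \<ge> 3\<close>, the subgraphs that are cycles of length \<open>k\<close> are
  traversed by the \<^const>\<open>pre_digraph.cycle\<close>s of length \<open>k\<close>.
\<close>

text \<open>
  Drawings in the plane \<^typ>\<open>complex\<close>: \<open>pos\<close> places the vertices, and the simple arc \<open>\<gamma> (u, v)\<close>
  draws the edge \<open>{u, v}\<close>, traversed from \<open>u\<close> to \<open>v\<close>. A drawn edge contains no vertex apart from its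
  own ends, and two distinct edges meet at most in common ends.
\<close>

definition plane_drawing ::
    "'a pair_pre_digraph \<Rightarrow> ('a \<Rightarrow> complex) \<Rightarrow> ('a \<times> 'a \<Rightarrow> real \<Rightarrow> complex) \<Rightarrow> bool" where
  "plane_drawing G pos \<gamma> \<longleftrightarrow>
     inj_on pos (pverts G) \<and>
     (\<forall>(u, v) \<in> parcs G.
        Path_Connected.arc (\<gamma> (u, v)) \<and>
        pathstart (\<gamma> (u, v)) = pos u \<and> pathfinish (\<gamma> (u, v)) = pos v \<and>
        \<gamma> (v, u) = reversepath (\<gamma> (u, v)) \<and>
        path_image (\<gamma> (u, v)) \<inter> pos ` pverts G = {pos u, pos v}) \<and>
     (\<forall>(u, v) \<in> parcs G. \<forall>(x, y) \<in> parcs G. {u, v} \<noteq> {x, y} \<longrightarrow>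
        path_image (\<gamma> (u, v)) \<inter> path_image (\<gamma> (x, y)) \<subseteq> pos ` ({u, v} \<inter> {x, y}))"

definition planar :: "'a pair_pre_digraph \<Rightarrow> bool" where
  "planar G \<longleftrightarrow> (\<exists>pos \<gamma>. plane_drawing G pos \<gamma>)"

definition subcubic :: "'a pair_pre_digraph \<Rightarrow> bool" where
  "subcubic G \<longleftrightarrow> (\<forall>v \<in> pverts G. out_degree (with_proj G) v \<le> 3)"

definition has_cycle_of_length :: "'a pair_pre_digraph \<Rightarrow> nat \<Rightarrow> bool" where
  "has_cycle_of_length G k \<longleftrightarrow> (\<exists>p. pre_digraph.cycle (with_proj G) p \<and> length p = k)"

text \<open>With unit weights, \<^const>\<open>wf_digraph.\<mu>\<close> is the graph distance (\<open>\<infinity>\<close> between components).\<close>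

definition graph_dist :: "'a pair_pre_digraph \<Rightarrow> 'a \<Rightarrow> 'a \<Rightarrow> ereal" where
  "graph_dist G u v = wf_digraph.\<mu> (with_proj G) (\<lambda>_. 1) u v"

definition square :: "'a pair_pre_digraph \<Rightarrow> 'a pair_pre_digraph" where
  "square G =
     \<lparr> pverts = pverts G,
       parcs = {(u, v). u \<in> pverts G \<and> v \<in> pverts G \<and> u \<noteq> v \<and> graph_dist G u v \<le> 2} \<rparr>"

text \<open>
  Integer polynomials in variables indexed by \<^typ>\<open>'a\<close>: a finitely supported map from monomials
  (finitely supported exponent vectors) to coefficients, with convolution as multiplication.
\<close>

type_synonym 'a int_mpoly = "('a \<Rightarrow>\<^sub>0 nat) \<Rightarrow>\<^sub>0 int"

definition Var :: "'a \<Rightarrow> 'a int_mpoly" where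
  "Var v = Poly_Mapping.single (Poly_Mapping.single v 1) 1"

text \<open>
  The relation \<open>r\<close> is the strict linear order \<open><\<close> on the vertices; it selects one of the two arcs
  of every edge.
\<close>

definition graph_poly :: "'a rel \<Rightarrow> 'a pair_pre_digraph \<Rightarrow> 'a int_mpoly" where
  "graph_poly r H = (\<Prod>(u, v) \<in> {(u, v). (u, v) \<in> parcs H \<and> (u, v) \<in> r}. Var u - Var v)"

definition Alon_Tarsi_choosable :: "'a rel \<Rightarrow> nat \<Rightarrow> 'a pair_pre_digraph \<Rightarrow> bool" where
  "Alon_Tarsi_choosable r k H \<longleftrightarrow>
     (\<exists>t. Poly_Mapping.lookup (graph_poly r H) t \<noteq> 0 \<and>
          (\<forall>v \<in> pverts H. Poly_Mapping.lookup t v \<le> k - 1))"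

text \<open>
  The minimum is over positive \<open>k\<close>. The order \<open>r\<close> affects \<^const>\<open>graph_poly\<close> only by a sign, so
  the value does not depend on it.
\<close>

definition AT :: "'a rel \<Rightarrow> 'a pair_pre_digraph \<Rightarrow> nat" where
  "AT r H = (LEAST k. k \<ge> 1 \<and> Alon_Tarsi_choosable r k H)"

end

theory Submission
  imports Defs
begin

text \<open>
  The proof is by induction on the number of vertices. Let \<open>S\<close> be a nonempty set of vertices, each of
  which has at most one neighbour outside \<open>S\<close>. Then deleting \<open>S\<close> commutes with taking the square.
  Suppose that the polynomial of the square induced on \<open>S\<close> has a monomial with nonzero coefficient in
  which the exponent of each \<open>w \<in> S\<close> plus the number of neighbours of \<open>w\<close> in the square outside \<open>S\<close> is at
  most 5. Then a good monomial of the rest extends to the whole graph: of every factor between the two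
  parts take the variable in \<open>S\<close> (\<open>AT_extend\<close>). Such an \<open>S\<close> makes the graph \<open>reducible\<close>, and it remains to find one
  in every nonempty graph of the class.

  Suppose there is none. Single vertices, edges and triangles taken as \<open>S\<close> show that all degrees are 2 or
  3, that vertices of degree 2 are not adjacent, and that they avoid triangles; triangles are disjoint
  because there is no 4-cycle. Call \<^emph>\<open>items\<close> the triangles and the vertices of degree 3 outside
  triangles. Contracting the triangles and suppressing the vertices of degree 2 turns the graph into a
  cubic plane graph on the items, and by Euler's formula such a graph has a face with at most five
  vertices. Hence some cycle \<open>C\<close> that is not a triangle meets at most five items
  (\<open>no_face_boundaries\<close> is the counting). A shortest such \<open>C\<close> passes each triangle along one edge. So its
  length is the number of its items, plus the number of its triangles, plus the number of its vertices of
  degree 2, of which there is at most one between consecutive items. The length is at least 9, so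
  the ring formed by \<open>C\<close> is dense in triangles and vertices of degree 2. Up to rotation and reflection it
  contains one of six short chains or is one of seven rings, and each of these thirteen is a possible
  \<open>S\<close>, by an explicit monomial (\<open>cycles_meet_six_items\<close>). This contradiction ends the proof.

  Planarity enters only through \<open>face_boundaries\<close>: a plane drawing with \<open>n\<close> vertices and \<open>k\<close> edges yields
  at least \<open>k - n + 2\<close> edge sets with even degrees, nonempty if there are two or more, such that no edge
  lies in more than two of them. They are the boundaries of the faces. The proof adds the edges one by one
  and needs only the Jordan curve theorem and Janiszewski's theorem: an edge that closes a cycle \<open>C\<close>
  splits one face, into the parts inside and outside \<open>C\<close>, and every other edge leaves the faces as they
  are.
\<close>

section \<open>Paths and cycles as vertex lists\<close>

definition uedges :: "('a \<times> 'a) set \<Rightarrow> 'a set set" where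
  "uedges E = {{u, v} | u v. (u, v) \<in> E}"

fun pedges :: "'a list \<Rightarrow> 'a set set" where
  "pedges (x # y # xs) = insert {x, y} (pedges (y # xs))"
| "pedges xs = {}"

definition cedges :: "'a list \<Rightarrow> 'a set set" where
  "cedges cs = insert {last cs, hd cs} (pedges cs)"

lemma pedges_append: "pedges (xs @ y # ys) = pedges (xs @ [y]) \<union> pedges (y # ys)"
proof (induction xs rule: pedges.induct)
  case (1 x y' xs) then show ?case by auto
next
  case "2_1" then show ?case by simp
next
  case ("2_2" v) then show ?case by (cases ys) auto
qed

lemma pedges_append2: "xs \<noteq> [] \<Longrightarrow> pedges (xs @ y # ys) = pedges xs \<union> insert {last xs, y} (pedges (y # ys))"
  by (induction xs rule: pedges.induct) auto

lemma pedges_sub: "g \<in> pedges xs \<Longrightarrow> g \<subseteq> set xs"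
  by (induction xs rule: pedges.induct) auto

lemma finite_pedges[simp]: "finite (pedges xs)"
  by (induction xs rule: pedges.induct) auto

lemma pedges_closing: "distinct cs \<Longrightarrow> length cs \<ge> 3 \<Longrightarrow> {last cs, hd cs} \<notin> pedges cs"
proof (cases cs rule: pedges.cases)
  case (1 x y xs)
  assume d: "distinct cs" and l: "length cs \<ge> 3"
  from 1 l have xs: "xs \<noteq> []" by auto
  then have "last xs \<in> set xs" by auto
  then have "{last cs, hd cs} \<noteq> {x, y}" using 1 d xs by (auto simp: doubleton_eq_iff)
  moreover have "{last cs, hd cs} \<notin> pedges (y # xs)" using pedges_sub 1 d by fastforce
  ultimately show ?thesis using 1 by auto
qed auto

lemma cedges_rotate: "cedges (ys @ xs) = cedges (xs @ ys)"
proof (cases "xs = [] \<or> ys = []")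
  case True then show ?thesis by auto
next
  case False
  then obtain x xs' y ys' where e: "xs = x # xs'" "ys = y # ys'" by (meson neq_Nil_conv)
  have "pedges (xs @ ys) = pedges xs \<union> insert {last xs, y} (pedges ys)"
    using pedges_append2[of xs y ys'] False e by simp
  moreover have "pedges (ys @ xs) = pedges ys \<union> insert {last ys, x} (pedges xs)"
    using pedges_append2[of ys x xs'] False e by simp
  ultimately show ?thesis using False e unfolding cedges_def by auto
qed

lemma in_pedges_split: "g \<in> pedges xs \<Longrightarrow> \<exists>us a b vs. xs = us @ a # b # vs \<and> g = {a, b}"
proof (induction xs rule: pedges.induct)
  case (1 x y xs)
  show ?case
  proof (cases "g = {x,y}")
    case True then show ?thesis by (metis append_Nil)
  next
    case False
    then obtain us a b vs where "y # xs = us @ a # b # vs" "g = {a,b}" using 1 by auto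
    then show ?thesis by (metis append_Cons)
  qed
qed auto

text \<open>
  A cycle can be read as a path closed by any prescribed one of its edges.
\<close>

lemma cycle_cut:
  assumes "distinct cs" "length cs \<ge> 3" "g \<in> cedges cs"
  obtains xs where "distinct xs" "length xs = length cs" "set xs = set cs" "cedges xs = cedges cs"
    "pedges xs = cedges cs - {g}" "g = {last xs, hd xs}"
proof -
  have "\<exists>us vs. cs = us @ vs \<and> g = {last (vs @ us), hd (vs @ us)}"
  proof (cases "g \<in> pedges cs")
    case True
    then obtain us a b vs where "cs = us @ a # b # vs" "g = {a, b}" using in_pedges_split by metis
    then have "cs = (us @ [a]) @ (b # vs) \<and> g = {last ((b # vs) @ (us @ [a])), hd ((b # vs) @ (us @ [a]))}"
      by (auto)
    then show ?thesis by blast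
  next
    case False
    then have "cs = [] @ cs \<and> g = {last (cs @ []), hd (cs @ [])}" using assms(3) unfolding cedges_def by auto
    then show ?thesis by blast
  qed
  then obtain us vs where s: "cs = us @ vs" "g = {last (vs @ us), hd (vs @ us)}" by blast
  let ?xs = "vs @ us"
  have 1: "distinct ?xs" "length ?xs = length cs" "set ?xs = set cs" "cedges ?xs = cedges cs" 
    using assms(1) s(1) cedges_rotate[of vs us] by auto
  moreover have "cedges ?xs = insert g (pedges ?xs)" "g \<notin> pedges ?xs"
    using pedges_closing[OF 1(1)] 1(2) assms(2) s(2) unfolding cedges_def by auto
  then have "pedges ?xs = cedges cs - {g}" using 1(4) by auto
  ultimately show ?thesis using that s(2) by blast
qed

lemma pedges_parity:
  "distinct xs \<Longrightarrow> xs \<noteq> [] \<Longrightarrow> odd (card {g \<in> pedges xs. w \<in> g}) \<longleftrightarrow> ((w = hd xs) \<noteq> (w = last xs))"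
proof (induction xs rule: pedges.induct)
  case (1 x y xs)
  have n: "{x,y} \<notin> pedges (y # xs)" using pedges_sub 1(2) by fastforce
  have "{g \<in> pedges (x # y # xs). w \<in> g} =
     (if w = x \<or> w = y then insert {x,y} {g \<in> pedges (y # xs). w \<in> g} else {g \<in> pedges (y # xs). w \<in> g})"
    by auto
  moreover have "card (insert {x,y} {g \<in> pedges (y # xs). w \<in> g}) = Suc (card {g \<in> pedges (y # xs). w \<in> g})"
    using n by (subst card_insert_disjoint) auto
  ultimately have "odd (card {g \<in> pedges (x # y # xs). w \<in> g}) \<longleftrightarrow>
     ((w = x \<or> w = y) \<noteq> odd (card {g \<in> pedges (y # xs). w \<in> g}))" by auto
  also have "odd (card {g \<in> pedges (y # xs). w \<in> g}) \<longleftrightarrow> ((w = y) \<noteq> (w = last (y#xs)))"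
    using 1 by auto
  finally show ?case using 1(2) by (auto split: if_splits)
qed auto

lemma cedges_even:
  assumes "distinct cs" "length cs \<ge> 3"
  shows "even (card {g \<in> cedges cs. w \<in> g})"
proof -
  have ne: "cs \<noteq> []" using assms(2) by auto
  have n: "{last cs, hd cs} \<notin> pedges cs" using pedges_closing[OF assms] .
  have hl: "hd cs \<noteq> last cs" using assms by (cases cs rule: pedges.cases) auto
  have "{g \<in> cedges cs. w \<in> g} =
     (if w = hd cs \<or> w = last cs then insert {last cs, hd cs} {g \<in> pedges cs. w \<in> g} else {g \<in> pedges cs. w \<in> g})"
    unfolding cedges_def by auto
  moreover have "card (insert {last cs, hd cs} {g \<in> pedges cs. w \<in> g}) = Suc (card {g \<in> pedges cs. w \<in> g})"
    using n by (subst card_insert_disjoint) auto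
  ultimately show ?thesis using pedges_parity[OF assms(1) ne, of w] hl by auto
qed

definition step :: "'a set set \<Rightarrow> ('a \<times> 'a) set" where
  "step K = {(x, y). {x, y} \<in> K}"

lemma reach_path:
  assumes "(u, v) \<in> (step K)\<^sup>*"
  shows "\<exists>xs. xs \<noteq> [] \<and> hd xs = u \<and> last xs = v \<and> distinct xs \<and> pedges xs \<subseteq> K"
  using assms
proof (induction rule: rtrancl_induct)
  case base
  then show ?case by (intro exI[of _ "[u]"]) auto
next
  case (step y z)
  then obtain xs where xs: "xs \<noteq> []" "hd xs = u" "last xs = y" "distinct xs" "pedges xs \<subseteq> K" by blast
  have yz: "{y, z} \<in> K" using step by (auto simp: step_def)
  show ?case
  proof (cases "z \<in> set xs")
    case True
    then obtain us vs where s: "xs = us @ z # vs" by (meson split_list)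
    have "pedges (us @ [z]) \<subseteq> K" using xs(5) s pedges_append by fastforce
    moreover have "hd (us @ [z]) = u" using xs(2) s by (cases us) auto
    ultimately show ?thesis using s xs by (intro exI[of _ "us @ [z]"]) auto
  next
    case False
    have "pedges (xs @ [z]) \<subseteq> K" using pedges_append2[OF xs(1), of z "[]"] xs yz by auto
    then show ?thesis using xs False by (intro exI[of _ "xs @ [z]"]) auto
  qed
qed

section \<open>Faces of a plane drawing\<close>

text \<open>
  The arcs of a plane drawing. Since they meet only in common ends, different vertices of positive degree
  are drawn at different points.
\<close>

locale drawing =
  fixes E :: "('a \<times> 'a) set" and pos :: "'a \<Rightarrow> complex" and \<gamma> :: "'a \<times> 'a \<Rightarrow> real \<Rightarrow> complex"
  assumes finE: "finite E"
    and symE: "(u, v) \<in> E \<Longrightarrow> (v, u) \<in> E"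
    and arc_\<gamma>: "(u, v) \<in> E \<Longrightarrow> Path_Connected.arc (\<gamma> (u, v))"
    and start_\<gamma>: "(u, v) \<in> E \<Longrightarrow> pathstart (\<gamma> (u, v)) = pos u"
    and finish_\<gamma>: "(u, v) \<in> E \<Longrightarrow> pathfinish (\<gamma> (u, v)) = pos v"
    and rev_\<gamma>: "(u, v) \<in> E \<Longrightarrow> \<gamma> (v, u) = reversepath (\<gamma> (u, v))"
    and meet_\<gamma>: "(u, v) \<in> E \<Longrightarrow> (x, y) \<in> E \<Longrightarrow> {u, v} \<noteq> {x, y} \<Longrightarrow>
        path_image (\<gamma> (u, v)) \<inter> path_image (\<gamma> (x, y)) \<subseteq> pos ` ({u, v} \<inter> {x, y})"
begin

abbreviation edges :: "'a set set" where
  "edges \<equiv> uedges E"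

definition img :: "'a set \<Rightarrow> complex set" where
  "img e = \<Union>{path_image (\<gamma> p) | p. p \<in> E \<and> {fst p, snd p} = e}"

definition draw :: "'a set set \<Rightarrow> complex set" where
  "draw K = \<Union>(img ` K)"

definition is_cycle :: "'a list \<Rightarrow> bool" where
  "is_cycle cs \<longleftrightarrow> distinct cs \<and> length cs \<ge> 3 \<and> cedges cs \<subseteq> edges"

abbreviation side :: "'a list \<Rightarrow> complex set" where
  "side cs \<equiv> inside (draw (cedges cs))"

lemma edge_iff: "{u, v} \<in> edges \<longleftrightarrow> (u, v) \<in> E"
  unfolding uedges_def using symE by (auto simp: doubleton_eq_iff)

lemma edges_cases: 
  assumes "e \<in> edges" obtains u v where "(u, v) \<in> E" "e = {u, v}"
  using assms unfolding uedges_def by auto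

lemma finite_edges: "finite edges"
proof -
  have "edges = (\<lambda>(u, v). {u, v}) ` E" unfolding uedges_def by auto
  then show ?thesis using finE by simp
qed

lemma img_edge: assumes "(u, v) \<in> E" shows "img {u, v} = path_image (\<gamma> (u, v))"
proof -
  have "path_image (\<gamma> p) = path_image (\<gamma> (u, v))" if "p \<in> E" "{fst p, snd p} = {u, v}" for p
  proof -
    have "p = (u, v) \<or> p = (v, u)" using that by (cases p) (auto simp: doubleton_eq_iff)
    moreover have "path_image (\<gamma> (v, u)) = path_image (\<gamma> (u, v))" 
      by (simp only: rev_\<gamma>[OF assms] path_image_reversepath)
    ultimately show ?thesis by (elim disjE) simp_all
  qed
  then have "img {u, v} \<subseteq> path_image (\<gamma> (u, v))" unfolding img_def by blast
  moreover have "path_image (\<gamma> (u, v)) \<subseteq> img {u, v}" unfolding img_def using assms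
    by (intro Union_upper) (auto intro!: exI[of _ "(u, v)"])
  ultimately show ?thesis by blast
qed

lemma img_meet: "e \<in> edges \<Longrightarrow> g \<in> edges \<Longrightarrow> e \<noteq> g \<Longrightarrow> img e \<inter> img g \<subseteq> pos ` (e \<inter> g)"
proof -
  assume a: "e \<in> edges" "g \<in> edges" "e \<noteq> g"
  obtain u v where uv: "(u, v) \<in> E" "e = {u, v}" using a(1) edges_cases by metis
  obtain x y where xy: "(x, y) \<in> E" "g = {x, y}" using a(2) edges_cases by metis
  show ?thesis using meet_\<gamma>[OF uv(1) xy(1)] a(3) uv xy img_edge by simp
qed

lemma img_simple:
  assumes "e \<in> edges" shows "\<exists>c. simple_path c \<and> path_image c = img e"
proof -
  obtain x y where xy: "(x, y) \<in> E" "e = {x, y}" using assms(1) edges_cases by metis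
  then show ?thesis using img_edge[OF xy(1)] arc_imp_simple_path[OF arc_\<gamma>[OF xy(1)]] by auto
qed

lemma compact_img: "e \<in> edges \<Longrightarrow> compact (img e)"
  using img_simple compact_simple_path_image by force

lemma compact_draw: "K \<subseteq> edges \<Longrightarrow> compact (draw K)"
  unfolding draw_def using compact_img finite_edges
  by (intro compact_UN) (auto intro: finite_subset)

lemma closed_draw: "K \<subseteq> edges \<Longrightarrow> closed (draw K)"
  by (simp add: compact_draw compact_imp_closed)

lemma draw_mono: "K \<subseteq> K' \<Longrightarrow> draw K \<subseteq> draw K'"
  unfolding draw_def by auto

lemma draw_Un: "draw (K \<union> K') = draw K \<union> draw K'"
  unfolding draw_def by auto

lemma draw_insert: "draw (insert e K) = img e \<union> draw K"
  unfolding draw_def by auto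

lemma draw_empty[simp]: "draw {} = {}"
  unfolding draw_def by auto

lemma path_drawn_as_arc:
  "pedges xs \<subseteq> edges \<Longrightarrow> distinct xs \<Longrightarrow> length xs \<ge> 2 \<Longrightarrow>
   \<exists>c. Path_Connected.arc c \<and> pathstart c = pos (hd xs) \<and> pathfinish c = pos (last xs) \<and> path_image c = draw (pedges xs)"
proof (induction xs rule: pedges.induct)
  case (1 x y xs)
  have xy: "(x, y) \<in> E" using 1(2) edge_iff by auto
  show ?case
  proof (cases "xs = []")
    case True
    then show ?thesis using xy arc_\<gamma> start_\<gamma> finish_\<gamma> img_edge
      by (intro exI[of _ "\<gamma> (x, y)"]) (auto simp: draw_insert)
  next
    case False
    then have "length (y # xs) \<ge> 2" by (cases xs) auto
    then obtain c where c: "Path_Connected.arc c" "pathstart c = pos y" "pathfinish c = pos (last (y # xs))"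
        "path_image c = draw (pedges (y # xs))" using 1 by auto
    have "path_image (\<gamma> (x, y)) \<inter> path_image c \<subseteq> {pathstart c}"
    proof
      fix z assume "z \<in> path_image (\<gamma> (x, y)) \<inter> path_image c"
      then obtain g where g: "g \<in> pedges (y # xs)" "z \<in> img g" and z: "z \<in> img {x, y}"
        using c(4) img_edge[OF xy] unfolding draw_def by auto
      have gx: "x \<notin> g" using pedges_sub[OF g(1)] 1(3) by auto
      then have "z \<in> pos ` ({x, y} \<inter> g)"
        using img_meet[of "{x,y}" g] g z 1(2) by (auto)
      then show "z \<in> {pathstart c}" using gx c(2) by auto
    qed
    then have "Path_Connected.arc (\<gamma> (x, y) +++ c)" using arc_join[OF arc_\<gamma>[OF xy] c(1)] finish_\<gamma>[OF xy] c(2) by auto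
    then show ?thesis using c xy start_\<gamma> finish_\<gamma> img_edge False
      by (intro exI[of _ "\<gamma> (x, y) +++ c"]) (auto simp: draw_insert path_image_join)
  qed
qed auto

lemma draw_path_connected: "pedges xs \<subseteq> edges \<Longrightarrow> distinct xs \<Longrightarrow> Topological_Spaces.connected (draw (pedges xs))"
proof (cases "length xs \<ge> 2")
  case True
  assume "pedges xs \<subseteq> edges" "distinct xs"
  then show ?thesis using path_drawn_as_arc[OF _ _ True] by (metis arc_imp_simple_path connected_simple_path_image)
next
  case False
  then have "pedges xs = {}" by (cases xs rule: pedges.cases) auto
  then show ?thesis by simp
qed

lemma path_ends_drawn: 
  assumes "pedges xs \<subseteq> edges" "distinct xs" "length xs \<ge> 2"
  shows "pos (hd xs) \<in> draw (pedges xs)" "pos (last xs) \<in> draw (pedges xs)"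
  using path_drawn_as_arc[OF assms] by (metis pathstart_in_path_image pathfinish_in_path_image)+

lemma cycle_is_Jordan_curve:
  assumes "is_cycle cs"
  obtains c where "simple_path c" "pathfinish c = pathstart c" "path_image c = draw (cedges cs)"
proof -
  have cs: "distinct cs" "length cs \<ge> 3" "pedges cs \<subseteq> edges" "(last cs, hd cs) \<in> E"
    using assms edge_iff by (auto simp: is_cycle_def cedges_def)
  obtain c where c: "Path_Connected.arc c" "pathstart c = pos (hd cs)" "pathfinish c = pos (last cs)" 
      "path_image c = draw (pedges cs)"
    using path_drawn_as_arc[OF cs(3,1)] cs(2) by auto
  have n: "{last cs, hd cs} \<notin> pedges cs" using pedges_closing[OF cs(1,2)] .
  have "path_image c \<inter> path_image (\<gamma> (last cs, hd cs)) \<subseteq> {pathstart c, pathstart (\<gamma> (last cs, hd cs))}"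
  proof
    fix z assume "z \<in> path_image c \<inter> path_image (\<gamma> (last cs, hd cs))"
    then obtain g where g: "g \<in> pedges cs" "z \<in> img g" and z: "z \<in> img {last cs, hd cs}"
        using c(4) img_edge[OF cs(4)] unfolding draw_def by auto
    then have "z \<in> pos ` ({last cs, hd cs} \<inter> g)" using img_meet[of "{last cs, hd cs}" g] n cs edge_iff by auto
    then show "z \<in> {pathstart c, pathstart (\<gamma> (last cs, hd cs))}" using c(2) start_\<gamma>[OF cs(4)] by auto
  qed
  then have "simple_path (c +++ \<gamma> (last cs, hd cs))"
    using simple_path_join_loop[OF c(1) arc_\<gamma>[OF cs(4)]] c start_\<gamma>[OF cs(4)] finish_\<gamma>[OF cs(4)] by auto
  moreover have "path_image (c +++ \<gamma> (last cs, hd cs)) = draw (cedges cs)"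
    using c start_\<gamma>[OF cs(4)] img_edge[OF cs(4)] by (simp add: path_image_join cedges_def draw_insert Un_commute)
  ultimately show ?thesis using that c finish_\<gamma>[OF cs(4)] by (metis pathfinish_join pathstart_join)
qed

lemma cycle_same_side:
  assumes cs: "is_cycle cs" and z: "z \<notin> draw (cedges cs)" "z' \<notin> draw (cedges cs)"
  shows "connected_component (- draw (cedges cs)) z z' \<longleftrightarrow> (z \<in> side cs \<longleftrightarrow> z' \<in> side cs)"
proof -
  obtain c where c: "simple_path c" "pathfinish c = pathstart c" and pc: "path_image c = draw (cedges cs)"
    using cycle_is_Jordan_curve[OF cs] .
  note J = Jordan_inside_outside[OF c, unfolded pc]
  have Ji: "Topological_Spaces.connected (side cs)" "side cs \<subseteq> - draw (cedges cs)" using J inside_no_overlap by blast+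
  have Jo: "Topological_Spaces.connected (outside (draw (cedges cs)))" "outside (draw (cedges cs)) \<subseteq> - draw (cedges cs)"
    "- draw (cedges cs) \<subseteq> side cs \<union> outside (draw (cedges cs))" using J outside_no_overlap by blast+
  have "connected_component (- draw (cedges cs)) z z'" if "z \<in> side cs" "z' \<in> side cs"
    using that Ji unfolding connected_component_def by blast
  moreover have "connected_component (- draw (cedges cs)) z z'" if "z \<notin> side cs" "z' \<notin> side cs"
    using that Jo z unfolding connected_component_def by blast
  moreover have "z' \<in> side cs" if "connected_component (- draw (cedges cs)) z z'" "z \<in> side cs"
    using that by (rule inside_same_component)
  moreover have "z \<in> side cs" if "connected_component (- draw (cedges cs)) z z'" "z' \<in> side cs"
    using that by (meson connected_component_sym inside_same_component)
  ultimately show ?thesis by blast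
qed

lemma edge_meets_rest:
  assumes "K \<subseteq> edges" "e \<in> edges" "e \<notin> K"
  shows "img e \<inter> draw K \<subseteq> pos ` (e \<inter> \<Union>K)"
proof
  fix z assume "z \<in> img e \<inter> draw K"
  then obtain h where "h \<in> K" "z \<in> img h" "z \<in> img e" by (auto simp: draw_def)
  then have "z \<in> pos ` (e \<inter> h)" using img_meet[of e h] assms by auto
  then show "z \<in> pos ` (e \<inter> \<Union>K)" using \<open>h \<in> K\<close> by auto
qed

lemma cc_mono: "connected_component (- draw K) z z' \<Longrightarrow> K' \<subseteq> K \<Longrightarrow> connected_component (- draw K') z z'"
  using connected_component_of_subset[of "- draw K" z z' "- draw K'"] draw_mono by blast

text \<open>
  Why closing a cycle cuts a face into at most two pieces: the cycle and the old drawing intersect in the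
  old part of the cycle, which is an arc and hence connected. By Janiszewski's theorem two points
  separated by neither of them are not separated by their union.
\<close>

lemma split_by_cycle:
  assumes K: "K \<subseteq> edges" and e: "e \<in> edges" "e \<notin> K" and cs: "is_cycle cs" "e \<in> cedges cs" "cedges cs - {e} \<subseteq> K"
    and z: "z \<notin> draw (insert e K)" "z' \<notin> draw (insert e K)"
  shows "connected_component (- draw (insert e K)) z z' \<longleftrightarrow>
    connected_component (- draw K) z z' \<and> (z \<in> side cs \<longleftrightarrow> z' \<in> side cs)"
proof -
  have cK: "cedges cs \<subseteq> insert e K" using cs by auto
  have zc: "z \<notin> draw (cedges cs)" "z' \<notin> draw (cedges cs)" using z draw_mono[OF cK] by auto
  note side = cycle_same_side[OF cs(1) zc]
  have d: "distinct cs" "length cs \<ge> 3" "cedges cs \<subseteq> edges" using cs(1) by (auto simp: is_cycle_def)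
  obtain xs where xs: "distinct xs" "length xs = length cs" "pedges xs = cedges cs - {e}" "e = {last xs, hd xs}"
    using cycle_cut[OF d(1,2) cs(2)] by metis
  have ends: "pos ` e \<subseteq> draw (pedges xs)" using path_ends_drawn[of xs] xs d by auto
  have "draw (cedges cs) \<inter> draw K = draw (pedges xs)"
  proof -
    have "draw (cedges cs) = img e \<union> draw (pedges xs)" 
      using xs(3) cs(2) by (metis draw_insert insert_Diff)
    moreover have "img e \<inter> draw K \<subseteq> pos ` e" using edge_meets_rest[OF K e] by auto
    moreover have "draw (pedges xs) \<subseteq> draw K" using cs(3) xs(3) draw_mono by auto
    ultimately show ?thesis using ends by auto
  qed
  moreover have "Topological_Spaces.connected (draw (pedges xs))" using draw_path_connected[of xs] xs d by auto
  ultimately have con: "Topological_Spaces.connected (draw (cedges cs) \<inter> draw K)" by simp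
  have un: "draw (cedges cs) \<union> draw K = draw (insert e K)"
  proof -
    have "cedges cs \<union> K = insert e K" using cs by auto
    then show ?thesis by (metis draw_Un)
  qed
  have "connected_component (- draw (insert e K)) z z'" 
    if "connected_component (- draw K) z z'" "connected_component (- draw (cedges cs)) z z'"
    using Janiszewski[OF compact_draw[OF d(3)] closed_draw[OF K] con that(2,1)] un by simp
  then show ?thesis using side cc_mono[OF _ cK] cc_mono[of "insert e K" z z' K] by blast
qed

text \<open>
  If the new edge joins different components, then the old drawing splits into the component of one end
  and the rest. Janiszewski's theorem applies twice, because both times the two sets meet in
  at most one point.
\<close>

lemma pendant_no_split:
  assumes K: "K \<subseteq> edges" and e: "e \<in> edges" "e \<notin> K" and uv: "e = {u, v}" "(u, v) \<notin> (step K)\<^sup>*"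
    and z: "z \<notin> draw (insert e K)" "z' \<notin> draw (insert e K)"
  shows "connected_component (- draw (insert e K)) z z' \<longleftrightarrow> connected_component (- draw K) z z'"
proof
  assume "connected_component (- draw (insert e K)) z z'"
  then show "connected_component (- draw K) z z'" by (rule cc_mono) auto
next
  assume cc: "connected_component (- draw K) z z'"
  define Ku where "Ku = {g \<in> K. \<exists>x\<in>g. (u, x) \<in> (step K)\<^sup>*}"
  have all: "(u, x) \<in> (step K)\<^sup>*" if "g \<in> Ku" "x \<in> g" for g x
  proof -
    obtain y where y: "y \<in> g" "(u, y) \<in> (step K)\<^sup>*" "g \<in> K" using \<open>g \<in> Ku\<close> by (auto simp: Ku_def)
    obtain a b where "g = {a, b}" using y(3) K by (auto simp: uedges_def)
    then have "y = x \<or> g = {y, x}" using y(1) that(2) by auto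
    then have "y = x \<or> (y, x) \<in> step K" using y(3) by (auto simp: step_def)
    then show ?thesis using y(2) by auto
  qed
  have KuK: "Ku \<subseteq> K" by (auto simp: Ku_def)
  have v: "v \<notin> \<Union>Ku" using all uv(2) by auto
  have u: "u \<notin> \<Union>(K - Ku)" by (auto simp: Ku_def)
  obtain a b where ab: "(a, b) \<in> E" "e = {a, b}" using e(1) edges_cases by metis
  have sub1: "Topological_Spaces.connected S" if "S \<subseteq> {p}" for S :: "complex set" and p
    using that by (metis connected_empty connected_sing subset_singletonD)
  have "img e \<inter> draw Ku \<subseteq> pos ` (e \<inter> \<Union>Ku)" using edge_meets_rest[of Ku e] K e KuK by auto
  then have 1: "Topological_Spaces.connected (img e \<inter> draw Ku)" using v uv(1) by (intro sub1[of _ "pos u"]) auto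
  have "Topological_Spaces.connected (- img e)"
    using connected_arc_complement[OF arc_\<gamma>[OF ab(1)]] img_edge[OF ab(1)] ab(2) by simp
  then have 2: "connected_component (- img e) z z'" 
    using z by (auto simp: connected_component_def draw_insert)
  have 3: "connected_component (- (img e \<union> draw Ku)) z z'"
    using Janiszewski[OF compact_img[OF e(1)] closed_draw 1 2 cc_mono[OF cc KuK]] K KuK by auto
  have "img e \<inter> draw (K - Ku) \<subseteq> pos ` (e \<inter> \<Union>(K - Ku))" using edge_meets_rest[of "K - Ku" e] K e by auto
  moreover have "draw Ku \<inter> draw (K - Ku) = {}"
  proof (rule ccontr)
    assume "draw Ku \<inter> draw (K - Ku) \<noteq> {}"
    then obtain w g h where w: "w \<in> img g" "w \<in> img h" "g \<in> Ku" "h \<in> K - Ku" by (auto simp: draw_def)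
    then have "w \<in> pos ` (g \<inter> h)" using img_meet[of g h] K KuK by auto
    then obtain x where "x \<in> g" "x \<in> h" by auto
    then show False using all[OF w(3)] w(4) by (auto simp: Ku_def)
  qed
  ultimately have "Topological_Spaces.connected ((img e \<union> draw Ku) \<inter> draw (K - Ku))" using u uv(1) by (intro sub1[of _ "pos v"]) auto
  moreover have "compact (img e \<union> draw Ku)" using compact_img[OF e(1)] compact_draw[of Ku] K KuK by auto
  moreover have "closed (draw (K - Ku))" using closed_draw[of "K - Ku"] K by auto
  ultimately have "connected_component (- ((img e \<union> draw Ku) \<union> draw (K - Ku))) z z'"
    using Janiszewski[OF _ _ _ 3 cc_mono[OF cc, of "K - Ku"]] by auto
  moreover have "(img e \<union> draw Ku) \<union> draw (K - Ku) = draw (insert e K)"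
    using KuK by (metis Un_Diff_cancel Un_absorb1 Un_assoc draw_Un draw_insert)
  ultimately show "connected_component (- draw (insert e K)) z z'" by simp
qed

text \<open>
  Two marker points for each edge, one on either side, which every later step uses in place of the
  local structure of the drawing. For an edge on some cycle they are taken close to an interior point of
  the edge, inside and outside that cycle. They then lie on different sides of every other cycle
  through the edge too: otherwise, by \<open>split_by_cycle\<close>, the whole drawing would not separate them.
  For an edge on no cycle, one arbitrary point off the drawing serves as both markers.
\<close>

lemma edge_sides:
  assumes g: "g \<in> edges"
  shows "\<exists>l r. l \<notin> draw edges \<and> r \<notin> draw edges \<and> connected_component (- draw (edges - {g})) l r \<and>
    (\<forall>cs. is_cycle cs \<longrightarrow> ((l \<in> side cs) \<noteq> (r \<in> side cs) \<longleftrightarrow> g \<in> cedges cs)) \<and>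
    ((\<exists>cs. is_cycle cs \<and> g \<in> cedges cs) \<longrightarrow>
       (\<forall>x \<in> img g - pos ` g. connected_component (- draw (edges - {g})) x l))"
proof (cases "\<exists>cs. is_cycle cs \<and> g \<in> cedges cs")
  case False
  have "\<not> bounded (- draw edges)" using compact_draw[of edges] 
    by (simp add: cobounded_imp_unbounded compact_imp_bounded)
  then obtain l where l: "l \<notin> draw edges" by (metis ComplD all_not_in_conv bounded_empty)
  moreover from l have "l \<notin> draw (edges - {g})" using draw_mono[of "edges - {g}" edges] by auto
  ultimately show ?thesis using False by (intro exI[of _ l]) auto
next
  case True
  then obtain cs where cs: "is_cycle cs" "g \<in> cedges cs" by auto
  obtain u v where uv: "(u, v) \<in> E" "g = {u, v}" using g edges_cases by metis
  have en: "img g - pos ` g = path_image (\<gamma> (u, v)) - {pathstart (\<gamma> (u, v)), pathfinish (\<gamma> (u, v))}"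
    using uv img_edge start_\<gamma> finish_\<gamma> by auto
  have sp: "simple_path (\<gamma> (u, v))" using arc_\<gamma>[OF uv(1)] arc_imp_simple_path by auto
  have con: "Topological_Spaces.connected (img g - pos ` g)" using en connected_simple_path_endless[OF sp] by simp
  have ne: "img g - pos ` g \<noteq> {}" using en nonempty_simple_path_endless[OF sp] by simp
  then obtain q where q: "q \<in> img g" "q \<notin> pos ` g" by auto
  let ?R = "draw (edges - {g})"
  have "img g \<inter> ?R \<subseteq> pos ` g" using edge_meets_rest[of "edges - {g}" g] g by auto
  then have disj: "(img g - pos ` g) \<inter> ?R = {}" by auto
  have "open (- ?R)" using closed_draw[of "edges - {g}"] by auto
  moreover have "q \<in> - ?R" using disj q by auto
  ultimately obtain d where d: "d > 0" "ball q d \<subseteq> - ?R" by (meson open_contains_ball)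
  obtain c where c: "simple_path c" "pathfinish c = pathstart c" and pc: "path_image c = draw (cedges cs)"
    using cycle_is_Jordan_curve[OF cs(1)] .
  note J = Jordan_inside_outside[OF c, unfolded pc]
  have gC: "img g \<subseteq> draw (cedges cs)" using cs(2) by (auto simp: draw_def)
  then have "q \<in> closure (side cs)" "q \<in> closure (outside (draw (cedges cs)))"
    using q(1) J by (auto simp: frontier_def)
  then obtain l r where l: "l \<in> side cs" "l \<in> ball q d" and r: "r \<in> outside (draw (cedges cs))" "r \<in> ball q d"
    using d(1) unfolding closure_approachable by (metis dist_commute mem_ball)
  have out: "x \<notin> draw edges" if "x \<notin> draw (cedges cs)" "x \<in> ball q d" for x
  proof -
    have "draw edges = img g \<union> ?R" using g by (metis draw_insert insert_Diff)
    then show ?thesis using that d gC by auto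
  qed
  have lC: "l \<notin> draw (cedges cs)" "r \<notin> draw (cedges cs)" "r \<notin> side cs"
    using l(1) r(1) inside_no_overlap outside_no_overlap inside_Int_outside by blast+
  have lr: "connected_component (- ?R) q l" "connected_component (- ?R) q r"
    using d l r unfolding connected_component_def by (auto intro!: exI[of _ "ball q d"])
  have near: "connected_component (- ?R) x l" if x: "x \<in> img g - pos ` g" for x
  proof -
    have "connected_component (- ?R) x q" unfolding connected_component_def
      using con x q disj by (intro exI[of _ "img g - pos ` g"]) auto
    then show ?thesis using lr(1) by (rule connected_component_trans)
  qed
  have lr2: "connected_component (- ?R) l r" using lr by (meson connected_component_sym connected_component_trans)
  have lro: "l \<notin> draw edges" "r \<notin> draw edges" using out l r lC by auto
  have "(l \<in> side cs') \<noteq> (r \<in> side cs') \<longleftrightarrow> g \<in> cedges cs'" if cs': "is_cycle cs'" for cs'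
  proof -
    have sub: "cedges cs' \<subseteq> edges" using cs' by (auto simp: is_cycle_def)
    have nl: "l \<notin> draw (cedges cs')" "r \<notin> draw (cedges cs')" using lro draw_mono[OF sub] by auto
    show ?thesis
    proof (cases "g \<in> cedges cs'")
      case False
      then have "connected_component (- draw (cedges cs')) l r" using sub by (intro cc_mono[OF lr2]) auto
      then show ?thesis using cycle_same_side[OF cs' nl] False by simp
    next
      case True
      \<comment> \<open>on the same side, \<open>l\<close> and \<open>r\<close> would be separated by neither \<open>cs'\<close> nor the other edges\<close>
      have "(l \<in> side cs') \<noteq> (r \<in> side cs')"
      proof
        assume same: "(l \<in> side cs') = (r \<in> side cs')"
        have ie: "insert g (edges - {g}) = edges" using g by auto
        have "connected_component (- draw (insert g (edges - {g}))) l r"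
          using split_by_cycle[of "edges - {g}" g cs' l r] g cs' True sub lr2 same lro ie by auto
        then have "connected_component (- draw edges) l r" using ie by simp
        then have "connected_component (- draw (cedges cs)) l r" 
          using cs(1) cc_mono[of edges l r "cedges cs"] by (auto simp: is_cycle_def)
        then show False using cycle_same_side[OF cs(1) lC(1,2)] l(1) lC(3) by simp
      qed
      then show ?thesis using True by simp
    qed
  qed
  then show ?thesis using lro lr2 near by blast
qed

end

lemma step_rtrancl_sym: "(x, y) \<in> (step K)\<^sup>* \<Longrightarrow> (y, x) \<in> (step K)\<^sup>*"
  by (rule symD[OF sym_rtrancl]) (auto simp: sym_def step_def insert_commute)

context drawing
begin

lemma path_closes_to_cycle:
  assumes K: "K \<subseteq> edges" and e: "e \<in> edges" "e \<notin> K" "e = {u, v}" and r: "(u, v) \<in> (step K)\<^sup>*"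
  obtains cs where "is_cycle cs" "e \<in> cedges cs" "cedges cs - {e} \<subseteq> K"
proof -
  obtain xs where xs: "xs \<noteq> []" "hd xs = u" "last xs = v" "distinct xs" "pedges xs \<subseteq> K" using reach_path[OF r] by blast
  have uv: "(u, v) \<in> E" using e edge_iff by auto
  have "u \<noteq> v" using arc_distinct_ends[OF arc_\<gamma>[OF uv]] start_\<gamma>[OF uv] finish_\<gamma>[OF uv] by auto
  then have "length xs \<ge> 3"
    using xs e by (cases xs rule: pedges.cases; cases "tl (tl xs)") auto
  then show ?thesis using that[of xs] xs e K by (auto simp: is_cycle_def cedges_def insert_commute)
qed

end

text \<open>
  Components are counted as the values of a labelling that is constant exactly on components: joining
  two components overwrites one label by the other.
\<close>

lemma merge_labels:
  fixes L :: "'a \<Rightarrow> 'b"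
  assumes L: "\<forall>x\<in>V. \<forall>y\<in>V. L x = L y \<longleftrightarrow> (x, y) \<in> (step K)\<^sup>*" and V: "finite V" "u \<in> V" "v \<in> V"
    and nr: "(u, v) \<notin> (step K)\<^sup>*"
  obtains L' :: "'a \<Rightarrow> 'b" where "\<forall>x\<in>V. \<forall>y\<in>V. L' x = L' y \<longleftrightarrow> (x, y) \<in> (step (insert {u, v} K))\<^sup>*"
    "card (L' ` V) + 1 \<le> card (L ` V)"
proof -
  define L' where "L' x = (if L x = L v then L u else L x)" for x
  have ne: "L u \<noteq> L v" using L V nr by blast
  have "L' ` V \<subseteq> L ` V - {L v}" using ne V by (auto simp: L'_def)
  then have "card (L' ` V) \<le> card (L ` V - {L v})" using V by (intro card_mono) auto
  also have "\<dots> < card (L ` V)" using V by (intro card_Diff1_less) auto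
  finally have c: "card (L' ` V) + 1 \<le> card (L ` V)" by simp
  let ?S = "step K" and ?T = "step (insert {u, v} K)"
  have ST: "?S \<subseteq> ?T" and T: "?T \<subseteq> insert (u, v) (insert (v, u) ?S)" "(u, v) \<in> ?T" "(v, u) \<in> ?T"
    by (auto simp: step_def doubleton_eq_iff)
  have mono: "(x, y) \<in> ?S\<^sup>* \<Longrightarrow> (x, y) \<in> ?T\<^sup>*" for x y using rtrancl_mono[OF ST] by auto
  have inS: "(x, y) \<in> ?S\<^sup>*" if "L x = L y" "x \<in> V" "y \<in> V" for x y using L that by blast
  have sym: "(x, y) \<in> ?S\<^sup>* \<Longrightarrow> (y, x) \<in> ?S\<^sup>*" for x y by (rule step_rtrancl_sym)
  have "(x, y) \<in> ?T\<^sup>*" if xy: "x \<in> V" "y \<in> V" "L' x = L' y" for x y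
  proof -
    have *: "(x, u) \<in> ?T\<^sup>*" if "x \<in> V" "L' x = L u" for x
    proof (cases "L x = L v")
      case True
      then have "(x, v) \<in> ?T\<^sup>*" using inS mono that V by blast
      then show ?thesis using T(3) by (rule rtrancl_into_rtrancl)
    next
      case False
      then show ?thesis using inS mono that V by (auto simp: L'_def)
    qed
    show ?thesis
    proof (cases "L' x = L u")
      case True
      then show ?thesis using * xy step_rtrancl_sym by (metis rtrancl_trans)
    next
      case False
      then have "L x = L y" using xy(3) by (auto simp: L'_def split: if_splits)
      then show ?thesis using inS mono xy by blast
    qed
  qed
  moreover have "L' x = L' y" if xy: "x \<in> V" "y \<in> V" "(x, y) \<in> ?T\<^sup>*" for x y
  proof -
    have r: "((a, b) \<in> ?S\<^sup>*) \<longrightarrow> L a = L b" if "a \<in> V" "b \<in> V" for a b using L that by blast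
    have "(x, b) \<in> ?S\<^sup>* \<or> (((x, u) \<in> ?S\<^sup>* \<or> (x, v) \<in> ?S\<^sup>*) \<and> ((u, b) \<in> ?S\<^sup>* \<or> (v, b) \<in> ?S\<^sup>*))" if "(x, b) \<in> ?T\<^sup>*" for b
      using that
    proof (induction rule: rtrancl_induct)
      case (step b c)
      have "(b, c) = (u, v) \<or> (b, c) = (v, u) \<or> (b, c) \<in> ?S" using step(2) T(1) by blast
      then show ?case
      proof (elim disjE)
        assume bc: "(b, c) \<in> ?S"
        have "(a, c) \<in> ?S\<^sup>*" if "(a, b) \<in> ?S\<^sup>*" for a using that bc by (rule rtrancl_into_rtrancl)
        then show ?thesis using step(3) by blast
      qed (use step(3) in auto)
    qed auto
    then have "(x, y) \<in> ?S\<^sup>* \<or> (((x, u) \<in> ?S\<^sup>* \<or> (x, v) \<in> ?S\<^sup>*) \<and> ((u, y) \<in> ?S\<^sup>* \<or> (v, y) \<in> ?S\<^sup>*))"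
      using xy by blast
    then have "L x = L y \<or> ((L x = L u \<or> L x = L v) \<and> (L u = L y \<or> L v = L y))" using r xy V by blast
    then show ?thesis by (auto simp: L'_def)
  qed
  ultimately show ?thesis using that[of L'] c by blast
qed

context drawing
begin

text \<open>
  The faces of a subgraph are represented by the classes of marker points that its drawing does not
  separate, and an edge bounds a class if exactly one of its two markers is in the class. Evenness of
  the boundaries is kept when an edge closes a cycle: modulo 2, the boundaries of all classes on one side
  of the cycle add up to the cycle, and all but one of them are old.
\<close>

theorem face_boundaries:
  assumes V: "finite V" "V \<noteq> {}" "E \<subseteq> V \<times> V" and K: "K \<subseteq> edges"
  obtains \<Phi> :: "complex set set" and B :: "complex set \<Rightarrow> 'a set set"
  where "finite \<Phi>" "card K + 2 \<le> card \<Phi> + card V"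
    "\<And>\<phi>. \<phi> \<in> \<Phi> \<Longrightarrow> B \<phi> \<subseteq> K"
    "\<And>\<phi> v. \<phi> \<in> \<Phi> \<Longrightarrow> even (card {g \<in> B \<phi>. v \<in> g})"
    "\<And>\<phi>. \<phi> \<in> \<Phi> \<Longrightarrow> card \<Phi> \<ge> 2 \<Longrightarrow> B \<phi> \<noteq> {}"
    "\<And>g. g \<in> K \<Longrightarrow> card {\<phi> \<in> \<Phi>. g \<in> B \<phi>} \<le> 2"
proof -
  define P where "P g l r \<longleftrightarrow> l \<notin> draw edges \<and> r \<notin> draw edges \<and> connected_component (- draw (edges - {g})) l r \<and>
    (\<forall>cs. is_cycle cs \<longrightarrow> ((l \<in> side cs) \<noteq> (r \<in> side cs) \<longleftrightarrow> g \<in> cedges cs)) \<and>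
    ((\<exists>cs. is_cycle cs \<and> g \<in> cedges cs) \<longrightarrow>
       (\<forall>x \<in> img g - pos ` g. connected_component (- draw (edges - {g})) x l))" for g l r
  have "\<forall>g. \<exists>l r. g \<in> edges \<longrightarrow> P g l r" using edge_sides unfolding P_def by blast
  then obtain l r where P: "\<And>g. g \<in> edges \<Longrightarrow> P g (l g) (r g)" by metis
  have lr: "l g \<notin> draw edges" "r g \<notin> draw edges" 
    and lr_cc: "connected_component (- draw (edges - {g})) (l g) (r g)"
    if "g \<in> edges" for g using P[OF that] unfolding P_def by blast+
  have lr_side: "(l g \<in> side cs) \<noteq> (r g \<in> side cs) \<longleftrightarrow> g \<in> cedges cs" if "g \<in> edges" "is_cycle cs" for g cs
    using P[OF that(1)] that(2) unfolding P_def by blast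
  have lr_near: "connected_component (- draw (edges - {g})) x (l g)" 
    if "g \<in> edges" "is_cycle cs" "g \<in> cedges cs" "x \<in> img g - pos ` g" for g cs x
    using P[OF that(1)] that(2-4) unfolding P_def by blast
  obtain p0 where p0: "p0 \<notin> draw edges"
    by (metis ComplD all_not_in_conv bounded_empty cobounded_imp_unbounded compact_draw compact_imp_bounded double_complement subset_refl)
  \<comment> \<open>the point \<open>p0\<close> provides the one face of the empty drawing even if there is no edge\<close>
  define Z where "Z = insert p0 (l ` edges \<union> r ` edges)"
  have finZ: "finite Z" using finite_edges by (simp add: Z_def)
  have Zoff: "z \<notin> draw K" if "z \<in> Z" "K \<subseteq> edges" for z K 
    using that lr p0 draw_mono[OF that(2)] by (auto simp: Z_def)
  define rel where "rel K = {(z, z'). z \<in> Z \<and> z' \<in> Z \<and> connected_component (- draw K) z z'}" for K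
  define F where "F K = Z // rel K" for K
  have eq: "equiv Z (rel K)" if "K \<subseteq> edges" for K
  proof (rule equivI)
    show "rel K \<subseteq> Z \<times> Z" by (auto simp: rel_def)
    show "refl_on Z (rel K)" using Zoff[OF _ that] by (auto simp: refl_on_def rel_def)
    show "sym (rel K)" by (auto simp: sym_def rel_def connected_component_sym)
    show "trans (rel K)" unfolding trans_def rel_def using connected_component_trans by fastforce
  qed
  define bd where "bd K \<phi> = {g \<in> K. (l g \<in> \<phi>) \<noteq> (r g \<in> \<phi>)}" for K \<phi>
  have finF: "finite (F K)" if "K \<subseteq> edges" for K
    unfolding F_def quotient_def using finZ by auto
  have main: "K \<subseteq> edges \<longrightarrow> (\<exists>L::'a\<Rightarrow>'a. (\<forall>x\<in>V. \<forall>y\<in>V. L x = L y \<longleftrightarrow> (x, y) \<in> (step K)\<^sup>*) \<and>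
        card K + card (L ` V) + 1 \<le> card (F K) + card V) \<and>
      (\<forall>\<phi> \<in> F K. \<forall>v. even (card {g \<in> bd K \<phi>. v \<in> g})) \<and>
      (card (F K) \<ge> 2 \<longrightarrow> (\<forall>\<phi> \<in> F K. bd K \<phi> \<noteq> {}))"
    if "finite K" for K
    using that
  proof (induction K rule: finite_induct)
    case empty
    have rZ: "rel {} = Z \<times> Z" by (auto simp: rel_def connected_component_def intro!: exI[of _ UNIV])
    have "F {} = {Z}" unfolding F_def rZ quotient_def by (auto simp: Z_def)
    moreover have "step {} = ({} :: ('a \<times> 'a) set)" by (auto simp: step_def)
    ultimately show ?case by (auto intro!: exI[of _ id] simp: bd_def)
  next
    case (insert e K)
    show ?case
    proof
      assume sub: "insert e K \<subseteq> edges"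
      then have KE: "K \<subseteq> edges" and e: "e \<in> edges" by auto
      obtain u v where uv: "(u, v) \<in> E" "e = {u, v}" using e edges_cases by metis
      have uvV: "u \<in> V" "v \<in> V" using uv V by auto
      have off: "z \<notin> draw (insert e K)" if "z \<in> Z" for z using Zoff[OF that sub] .
      have KR: "K \<subseteq> edges - {e}" using KE insert by auto
      have ccK: "connected_component (- draw K) (l e) (r e)" using cc_mono[OF lr_cc[OF e] KR] .
      have leZ: "l e \<in> Z" "r e \<in> Z" using e by (auto simp: Z_def)
      from insert KE obtain L :: "'a \<Rightarrow> 'a" where L: "\<forall>x\<in>V. \<forall>y\<in>V. L x = L y \<longleftrightarrow> (x, y) \<in> (step K)\<^sup>*"
          "card K + card (L ` V) + 1 \<le> card (F K) + card V"
        and ev: "\<And>\<phi> v. \<phi> \<in> F K \<Longrightarrow> even (card {g \<in> bd K \<phi>. v \<in> g})"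
        and ne: "\<And>\<phi>. card (F K) \<ge> 2 \<Longrightarrow> \<phi> \<in> F K \<Longrightarrow> bd K \<phi> \<noteq> {}" by blast
      show "(\<exists>L::'a\<Rightarrow>'a. (\<forall>x\<in>V. \<forall>y\<in>V. L x = L y \<longleftrightarrow> (x, y) \<in> (step (insert e K))\<^sup>*) \<and>
        card (insert e K) + card (L ` V) + 1 \<le> card (F (insert e K)) + card V) \<and>
        (\<forall>\<phi> \<in> F (insert e K). \<forall>v. even (card {g \<in> bd (insert e K) \<phi>. v \<in> g})) \<and>
        (card (F (insert e K)) \<ge> 2 \<longrightarrow> (\<forall>\<phi> \<in> F (insert e K). bd (insert e K) \<phi> \<noteq> {}))"
      proof (cases "(u, v) \<in> (step K)\<^sup>*")
        case False
        have "rel (insert e K) = rel K"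
          unfolding rel_def using pendant_no_split[OF KE e insert(2) uv(2) False] off by auto
        then have FF: "F (insert e K) = F K" by (simp add: F_def)
        obtain L' :: "'a \<Rightarrow> 'a" where L': "\<forall>x\<in>V. \<forall>y\<in>V. L' x = L' y \<longleftrightarrow> (x, y) \<in> (step (insert e K))\<^sup>*"
          "card (L' ` V) + 1 \<le> card (L ` V)" using merge_labels[OF L(1) V(1) uvV False, folded uv(2)] by blast
        have "(l e \<in> \<phi>) = (r e \<in> \<phi>)" if "\<phi> \<in> F K" for \<phi>
        proof -
          have "(l e, r e) \<in> rel K" using ccK leZ by (auto simp: rel_def)
          moreover have "(r e, l e) \<in> rel K" using ccK leZ by (auto simp: rel_def connected_component_sym)
          ultimately show ?thesis using that in_quotient_imp_closed[OF eq[OF KE]] unfolding F_def by blast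
        qed
        then have "bd (insert e K) \<phi> = bd K \<phi>" if "\<phi> \<in> F K" for \<phi> using that by (auto simp: bd_def)
        then show ?thesis using FF L' L(2) ev ne insert(1,2) by (auto intro!: exI[of _ L'])
      next
        case True
        obtain cs where cs: "is_cycle cs" "e \<in> cedges cs" "cedges cs - {e} \<subseteq> K"
          using path_closes_to_cycle[OF KE e insert(2) uv(2) True] by blast
        let ?I = "side cs"
        define \<phi>0 where "\<phi>0 = rel K `` {l e}"
        have cK: "cedges cs \<subseteq> insert e K" using cs by auto
        have relK: "rel (insert e K) = {(z, z') \<in> rel K. z \<in> ?I \<longleftrightarrow> z' \<in> ?I}"
          unfolding rel_def using split_by_cycle[OF KE e insert(2) cs] off by auto
        have lre: "l e \<in> \<phi>0" "r e \<in> \<phi>0" using ccK leZ Zoff[OF leZ(1) KE] by (auto simp: \<phi>0_def rel_def)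
        have lres: "(l e \<in> ?I) \<noteq> (r e \<in> ?I)" using lr_side[OF e cs(1)] cs(2) by simp
        have \<phi>0F: "\<phi>0 \<in> F K" using leZ by (auto simp: \<phi>0_def F_def quotient_def)
        \<comment> \<open>a component that does not contain the new edge does not meet the cycle at all\<close>
        have side_iff: "z \<in> ?I \<longleftrightarrow> z' \<in> ?I" if zz: "(z, z') \<in> rel K" "z \<notin> \<phi>0" for z z'
        proof -
          have z: "z \<in> Z" "z' \<in> Z" "connected_component (- draw K) z z'" using zz by (auto simp: rel_def)
          let ?C = "connected_component_set (- draw K) z"
          have "?C \<inter> draw (cedges cs) = {}"
          proof (rule ccontr)
            assume "?C \<inter> draw (cedges cs) \<noteq> {}"
            then obtain x where x: "connected_component (- draw K) z x" "x \<in> draw (cedges cs)" by auto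
            have xK: "x \<notin> draw K" using connected_component_in[OF x(1)] by auto
            have "draw (cedges cs) \<subseteq> img e \<union> draw K" using draw_mono[OF cK] by (simp add: draw_insert)
            then have xe: "x \<in> img e" using x(2) xK by auto
            obtain ys where ys: "distinct ys" "length ys = length cs" "pedges ys = cedges cs - {e}" "e = {last ys, hd ys}"
              using cycle_cut[of cs e] cs(1,2) unfolding is_cycle_def by metis
            have "pos ` e \<subseteq> draw (pedges ys)" using path_ends_drawn[of ys] ys cs KE by (auto simp: is_cycle_def)
            also have "\<dots> \<subseteq> draw K" using draw_mono ys(3) cs(3) by auto
            finally have "x \<in> img e - pos ` e" using xe xK by auto
            then have "connected_component (- draw K) x (l e)" using cc_mono[OF lr_near[OF e cs(1,2)] KR] by blast
            then have "connected_component (- draw K) (l e) z" using x(1) 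
              by (meson connected_component_sym connected_component_trans)
            then show False using zz(2) z(1) leZ by (auto simp: \<phi>0_def rel_def)
          qed
          then have "?C \<subseteq> - draw (cedges cs)" by auto
          moreover have "z \<in> ?C" "z' \<in> ?C" using z Zoff[OF z(1) KE] by auto
          ultimately have "connected_component (- draw (cedges cs)) z z'"
            unfolding connected_component_def[of "- draw (cedges cs)"] using connected_connected_component by blast
          moreover have "z \<notin> draw (cedges cs)" "z' \<notin> draw (cedges cs)" 
            using off[OF z(1)] off[OF z(2)] draw_mono[OF cK] by auto
          ultimately show ?thesis using cycle_same_side[OF cs(1)] by blast
        qed
        have cls: "rel (insert e K) `` {z} = (if z \<in> \<phi>0 then (if z \<in> ?I then \<phi>0 \<inter> ?I else \<phi>0 - ?I) else rel K `` {z})"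
          if "z \<in> Z" for z
        proof (cases "z \<in> \<phi>0")
          case True
          have "rel K `` {z} = \<phi>0" using True eq[OF KE] unfolding \<phi>0_def by (metis Image_singleton_iff equiv_class_eq)
          then show ?thesis using True unfolding relK by auto
        next
          case False
          then show ?thesis unfolding relK using side_iff[OF _ False] by auto
        qed
        have memF: "\<phi> \<in> F K' \<longleftrightarrow> (\<exists>z\<in>Z. \<phi> = rel K' `` {z})" for \<phi> K' unfolding F_def quotient_def by auto
        have cl0: "rel K `` {z} = \<phi>0 \<longleftrightarrow> z \<in> \<phi>0" if "z \<in> Z" for z
          using that eq[OF KE] unfolding \<phi>0_def
          by (metis Image_singleton_iff equiv_class_eq_iff equiv_class_self)
        have both: "\<exists>z\<in>\<phi>0. z \<in> ?I" "\<exists>z\<in>\<phi>0. z \<notin> ?I" using lre lres by blast+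
        have \<phi>0Z: "\<phi>0 \<subseteq> Z" by (auto simp: \<phi>0_def rel_def)
        have Fnew: "F (insert e K) = insert (\<phi>0 \<inter> ?I) (insert (\<phi>0 - ?I) (F K - {\<phi>0}))"
        proof (intro equalityI subsetI)
          fix \<phi> assume "\<phi> \<in> F (insert e K)"
          then obtain z where z: "z \<in> Z" "\<phi> = rel (insert e K) `` {z}" using memF by auto
          then show "\<phi> \<in> insert (\<phi>0 \<inter> ?I) (insert (\<phi>0 - ?I) (F K - {\<phi>0}))"
            using cls[OF z(1)] cl0[OF z(1)] memF[of \<phi> K] by auto
        next
          fix \<phi> assume "\<phi> \<in> insert (\<phi>0 \<inter> ?I) (insert (\<phi>0 - ?I) (F K - {\<phi>0}))"
          then consider "\<phi> = \<phi>0 \<inter> ?I" | "\<phi> = \<phi>0 - ?I" | "\<phi> \<in> F K" "\<phi> \<noteq> \<phi>0" by auto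
          then show "\<phi> \<in> F (insert e K)"
          proof cases
            case 1 then show ?thesis using both(1) \<phi>0Z cls memF by (metis subsetD)
          next
            case 2 then show ?thesis using both(2) \<phi>0Z cls memF by (metis subsetD)
          next
            case 3
            then obtain z where z: "z \<in> Z" "\<phi> = rel K `` {z}" using memF by auto
            then have "z \<notin> \<phi>0" using cl0 3 by auto
            then show ?thesis using z cls memF by metis
          qed
        qed
        have disj0: "\<phi> \<inter> \<phi>0 = {}" if "\<phi> \<in> F K - {\<phi>0}" for \<phi>
          using that \<phi>0F eq[OF KE] unfolding F_def by (metis DiffE insertI1 quotient_disj)
        have nin: "\<phi>0 \<inter> ?I \<notin> F K - {\<phi>0}" "\<phi>0 - ?I \<notin> F K - {\<phi>0}" "\<phi>0 \<inter> ?I \<noteq> \<phi>0 - ?I"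
          using disj0 both by blast+
        have cardF: "card (F (insert e K)) = card (F K) + 1"
        proof -
          have f: "finite (F K - {\<phi>0})" using finF[OF KE] by auto
          have "card (F K - {\<phi>0}) + 1 = card (F K)" using \<phi>0F finF[OF KE] by (metis Suc_eq_plus1 card_Suc_Diff1)
          then show ?thesis unfolding Fnew using nin f by (simp add: card_insert_if)
        qed
        have stepeq: "(step (insert e K))\<^sup>* = (step K)\<^sup>*"
        proof (rule rtrancl_subset)
          show "step K \<subseteq> step (insert e K)" by (auto simp: step_def)
          show "step (insert e K) \<subseteq> (step K)\<^sup>*"
          proof
            fix p assume "p \<in> step (insert e K)"
            then have "p = (u, v) \<or> p = (v, u) \<or> p \<in> step K" using uv(2) by (auto simp: step_def doubleton_eq_iff)
            then show "p \<in> (step K)\<^sup>*" using True step_rtrancl_sym[OF True] by auto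
          qed
        qed
        have old: "bd (insert e K) \<phi> = bd K \<phi>" if "\<phi> \<in> F K - {\<phi>0}" for \<phi>
          using disj0[OF that] lre by (auto simp: bd_def)
        have nonempty: "bd (insert e K) \<phi> \<noteq> {}" if "\<phi> \<in> F (insert e K)" for \<phi>
        proof (cases "\<phi> \<in> F K - {\<phi>0}")
          case True
          then have "card {\<phi>, \<phi>0} \<le> card (F K)" using \<phi>0F finF[OF KE] by (intro card_mono) auto
          then have "card (F K) \<ge> 2" using True by auto
          then show ?thesis using old[OF True] ne True by auto
        next
          case False
          then have "\<phi> = \<phi>0 \<inter> ?I \<or> \<phi> = \<phi>0 - ?I" using that Fnew by auto
          then have "e \<in> bd (insert e K) \<phi>" using lre lres by (auto simp: bd_def)
          then show ?thesis by auto
        qed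
        have half: "even (card {g \<in> bd (insert e K) (\<phi>0 \<inter> X). w \<in> g})" if X: "X = ?I \<or> X = - ?I" for X w
        proof -
          let ?K = "{g \<in> insert e K. w \<in> g}"
          have fK: "finite ?K" using insert(1) by auto
          \<comment> \<open>the degree of \<open>w\<close> in the boundary modulo 2, but additive in \<open>\<phi>\<close>\<close>
          define d where "d \<phi> = (\<Sum>g\<in>?K. of_bool (l g \<in> \<phi>) + of_bool (r g \<in> \<phi>) :: nat)" for \<phi>
          have d_even: "even (d \<phi>) \<longleftrightarrow> even (card {g \<in> ?K. (l g \<in> \<phi>) \<noteq> (r g \<in> \<phi>)})" for \<phi>
          proof -
            have "{g \<in> ?K. odd (of_bool (l g \<in> \<phi>) + of_bool (r g \<in> \<phi>) :: nat)} = {g \<in> ?K. (l g \<in> \<phi>) \<noteq> (r g \<in> \<phi>)}"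
              by auto
            then show ?thesis unfolding d_def even_sum_iff[OF fK] by metis
          qed
          have d_bd: "even (d \<phi>) \<longleftrightarrow> even (card {g \<in> bd (insert e K) \<phi>. w \<in> g})" for \<phi>
          proof -
            have "{g \<in> ?K. (l g \<in> \<phi>) \<noteq> (r g \<in> \<phi>)} = {g \<in> bd (insert e K) \<phi>. w \<in> g}" by (auto simp: bd_def)
            then show ?thesis unfolding d_even by simp
          qed
          define \<Psi> where "\<Psi> = {\<psi> \<in> F (insert e K). \<psi> \<subseteq> X}"
          have f\<Psi>: "finite \<Psi>" unfolding \<Psi>_def using finF[OF sub] by auto
          have cross: "rel (insert e K) `` {z} \<subseteq> X" if "z \<in> X" for z using that X unfolding relK by auto
          have count: "(\<Sum>\<psi>\<in>\<Psi>. of_bool (z \<in> \<psi>)) = (of_bool (z \<in> Z \<inter> X) :: nat)" if z: "z \<in> Z" for z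
          proof -
            define c where "c = rel (insert e K) `` {z}"
            have c1: "\<psi> = c" if \<psi>: "\<psi> \<in> F (insert e K)" "z \<in> \<psi>" for \<psi>
            proof -
              obtain z0 where z0: "\<psi> = rel (insert e K) `` {z0}" using memF[THEN iffD1, OF \<psi>(1)] by blast
              then show ?thesis using \<psi>(2) equiv_class_eq[OF eq[OF sub], of z0 z] unfolding c_def by auto
            qed
            have c2: "z \<in> c" unfolding c_def using eq[OF sub] z by (rule equiv_class_self)
            have c3: "c \<in> F (insert e K)" unfolding c_def using memF z by blast
            have c4: "c \<subseteq> X" if "z \<in> X" unfolding c_def using cross[OF that] .
            have "{\<psi> \<in> \<Psi>. z \<in> \<psi>} = (if z \<in> X then {c} else {})"
            proof (cases "z \<in> X")
              case True
              then have "{\<psi> \<in> \<Psi>. z \<in> \<psi>} = {c}" using c1 c2 c3 c4 unfolding \<Psi>_def by blast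
              then show ?thesis using True by simp
            next
              case False
              then have "{\<psi> \<in> \<Psi>. z \<in> \<psi>} = {}" unfolding \<Psi>_def by blast
              then show ?thesis using False by simp
            qed
            moreover have "(\<Sum>\<psi>\<in>\<Psi>. of_bool (z \<in> \<psi>)) = card {\<psi> \<in> \<Psi>. z \<in> \<psi>}"
              using f\<Psi> by (simp add: Int_def)
            ultimately show ?thesis using z by auto
          qed
          have "(\<Sum>\<psi>\<in>\<Psi>. d \<psi>) = d (Z \<inter> X)"
          proof -
            have "(\<Sum>\<psi>\<in>\<Psi>. d \<psi>) = (\<Sum>g\<in>?K. \<Sum>\<psi>\<in>\<Psi>. of_bool (l g \<in> \<psi>) + of_bool (r g \<in> \<psi>))"
              unfolding d_def by (rule sum.swap)
            also have "\<dots> = d (Z \<inter> X)" unfolding d_def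
            proof (rule sum.cong[OF refl])
              fix g assume "g \<in> ?K"
              then have "l g \<in> Z" "r g \<in> Z" using sub by (auto simp: Z_def)
              then show "(\<Sum>\<psi>\<in>\<Psi>. of_bool (l g \<in> \<psi>) + of_bool (r g \<in> \<psi>)) = of_bool (l g \<in> Z \<inter> X) + (of_bool (r g \<in> Z \<inter> X) :: nat)"
                using count[of "l g"] count[of "r g"] by (simp only: sum.distrib)
            qed
            finally show ?thesis .
          qed
          moreover have "even (d (Z \<inter> X))"
          proof -
            have "{g \<in> ?K. (l g \<in> Z \<inter> X) \<noteq> (r g \<in> Z \<inter> X)} = {g \<in> cedges cs. w \<in> g}"
            proof -
              have "(l g \<in> Z \<inter> X) \<noteq> (r g \<in> Z \<inter> X) \<longleftrightarrow> g \<in> cedges cs" if "g \<in> insert e K" for g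
                using lr_side[OF _ cs(1), of g] that sub X by (auto simp: Z_def)
              then show ?thesis using cK by auto
            qed
            then show ?thesis unfolding d_even using cedges_even[of cs w] cs(1) by (simp add: is_cycle_def)
          qed
          moreover have "\<phi>0 \<inter> X \<in> \<Psi>" using X unfolding \<Psi>_def Fnew by (auto simp: Diff_eq)
          moreover have "even (d \<psi>)" if "\<psi> \<in> \<Psi> - {\<phi>0 \<inter> X}" for \<psi>
          proof -
            have "\<psi> \<subseteq> X" "\<psi> \<noteq> \<phi>0 \<inter> X" "\<psi> \<in> F (insert e K)" using that by (auto simp: \<Psi>_def)
            moreover have "\<not> (\<phi>0 \<inter> ?I \<subseteq> - ?I)" "\<not> (\<phi>0 - ?I \<subseteq> ?I)" using both by auto
            ultimately have "\<psi> \<in> F K - {\<phi>0}" using X unfolding Fnew by (auto simp: Diff_eq)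
            then show ?thesis unfolding d_bd using old ev by auto
          qed
          ultimately have "even (d (\<phi>0 \<inter> X))"
            using f\<Psi> by (metis (no_types, lifting) dvd_sum even_add sum.remove)
          then show ?thesis unfolding d_bd .
        qed
        have "even (card {g \<in> bd (insert e K) \<phi>. w \<in> g})" if "\<phi> \<in> F (insert e K)" for \<phi> w
        proof -
          consider "\<phi> \<in> F K - {\<phi>0}" | "\<phi> = \<phi>0 \<inter> ?I" | "\<phi> = \<phi>0 \<inter> - ?I" using \<open>\<phi> \<in> F (insert e K)\<close> Fnew by (auto simp: Diff_eq)
          then show ?thesis using old ev half by cases auto
        qed
        then show ?thesis using nonempty L cardF insert(1,2) stepeq by (auto intro!: exI[of _ L])
      qed
    qed
  qed
  have finK: "finite K" using K finite_edges finite_subset by blast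
  from main[OF finK] K obtain L :: "'a \<Rightarrow> 'a" where L: "card K + card (L ` V) + 1 \<le> card (F K) + card V"
    and ev: "\<And>\<phi> v. \<phi> \<in> F K \<Longrightarrow> even (card {g \<in> bd K \<phi>. v \<in> g})"
    and ne: "\<And>\<phi>. card (F K) \<ge> 2 \<Longrightarrow> \<phi> \<in> F K \<Longrightarrow> bd K \<phi> \<noteq> {}" by blast
  have "card (L ` V) \<ge> 1" using V by (simp add: Suc_leI card_gt_0_iff)
  then have c: "card K + 2 \<le> card (F K) + card V" using L by linarith
  have two: "card {\<phi> \<in> F K. g \<in> bd K \<phi>} \<le> 2" for g
  proof -
    have "{\<phi> \<in> F K. g \<in> bd K \<phi>} \<subseteq> {rel K `` {l g}, rel K `` {r g}}"
    proof -
      have "\<phi> = rel K `` {z}" if "\<phi> \<in> F K" "z \<in> \<phi>" for \<phi> z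
      proof -
        obtain z0 where "z0 \<in> Z" "\<phi> = rel K `` {z0}" using \<open>\<phi> \<in> F K\<close> unfolding F_def quotient_def by auto
        then show ?thesis using that(2) equiv_class_eq[OF eq[OF K], of z0 z] by auto
      qed
      then show ?thesis by (auto simp: bd_def)
    qed
    then have "card {\<phi> \<in> F K. g \<in> bd K \<phi>} \<le> card {rel K `` {l g}, rel K `` {r g}}" by (rule card_mono[rotated]) auto
    also have "\<dots> \<le> 2" by (simp add: card_insert_if)
    finally show ?thesis .
  qed
  show ?thesis
  proof (rule that[of "F K" "bd K"])
    show "finite (F K)" by (rule finF[OF K])
    show "card K + 2 \<le> card (F K) + card V" by (rule c)
    show "bd K \<phi> \<subseteq> K" for \<phi> by (auto simp: bd_def)
    show "even (card {g \<in> bd K \<phi>. v \<in> g})" if "\<phi> \<in> F K" for \<phi> v by (rule ev[OF that])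
    show "bd K \<phi> \<noteq> {}" if "\<phi> \<in> F K" "card (F K) \<ge> 2" for \<phi> by (rule ne[OF that(2,1)])
    show "card {\<phi> \<in> F K. g \<in> bd K \<phi>} \<le> 2" for g by (rule two)
  qed
qed

end

section \<open>Coefficients of graph polynomials\<close>

text \<open>
  The coefficient of the monomial with exponents \<open>t\<close> in the product of the factors \<open>x\<^sub>u - x\<^sub>v\<close>, computed
  by choosing a variable from the first factor.
\<close>

fun coef :: "('v \<times> 'v) list \<Rightarrow> ('v \<Rightarrow> nat) \<Rightarrow> int" where
  "coef [] t = (if t = (\<lambda>_. 0) then 1 else 0)"
| "coef ((u, v) # es) t = (if t u > 0 then coef es (t(u := t u - 1)) else 0)
     - (if t v > 0 then coef es (t(v := t v - 1)) else 0)"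

lemma lookup_Var_mult:
  "Poly_Mapping.lookup (Var v * p) t = (if Poly_Mapping.lookup t v > 0 then Poly_Mapping.lookup p (t - Poly_Mapping.single v 1) else 0)"
proof -
  let ?s = "Poly_Mapping.single v (1::nat)"
  have "Poly_Mapping.lookup (Var v * p) t = (\<Sum>l. (1 when ?s = l) * (\<Sum>q. Poly_Mapping.lookup p q when t = l + q))"
    by (simp only: lookup_mult Var_def lookup_single)
  also have "\<dots> = (\<Sum>l. (\<Sum>q. Poly_Mapping.lookup p q when t = ?s + q) when l = ?s)"
    by (rule Sum_any.cong) (auto simp: when_def)
  also have "\<dots> = (\<Sum>q. Poly_Mapping.lookup p q when t = ?s + q)" by simp
  also have "\<dots> = (if Poly_Mapping.lookup t v > 0 then Poly_Mapping.lookup p (t - ?s) else 0)"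
  proof (cases "Poly_Mapping.lookup t v > 0")
    case True
    have "t = ?s + (t - ?s)"
    proof (rule poly_mapping_eqI)
      fix k show "Poly_Mapping.lookup t k = Poly_Mapping.lookup (?s + (t - ?s)) k"
        using True by (cases "k = v") (auto simp: lookup_add lookup_minus lookup_single when_def)
    qed
    then have "t = ?s + q \<longleftrightarrow> q = t - ?s" for q by (metis add_diff_cancel_left')
    then show ?thesis using True by simp
  next
    case False
    have "t \<noteq> ?s + q" for q
    proof
      assume "t = ?s + q"
      then have "Poly_Mapping.lookup t v = 1 + Poly_Mapping.lookup q v" by (simp add: lookup_add)
      then show False using False by simp
    qed
    then show ?thesis using False by simp
  qed
  finally show ?thesis .
qed

definition edge_poly :: "('a \<times> 'a) list \<Rightarrow> 'a int_mpoly" where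
  "edge_poly es = prod_list (map (\<lambda>(u, v). Var u - Var v) es)"

lemma lookup_edge_poly: "Poly_Mapping.lookup (edge_poly es) t = coef es (Poly_Mapping.lookup t)"
proof (induction es arbitrary: t)
  case Nil
  have "Poly_Mapping.lookup t = (\<lambda>_. 0) \<longleftrightarrow> t = 0" by (metis lookup_zero poly_mapping_eqI)
  then show ?case by (simp add: edge_poly_def lookup_one when_def)
next
  case (Cons e es)
  obtain u v where e: "e = (u, v)" by (cases e)
  have upd: "Poly_Mapping.lookup (t - Poly_Mapping.single w 1) = (Poly_Mapping.lookup t)(w := Poly_Mapping.lookup t w - 1)" for w
    by (rule ext) (auto simp: lookup_minus lookup_single when_def)
  have "edge_poly (e # es) = Var u * edge_poly es - Var v * edge_poly es"
    by (simp add: edge_poly_def e left_diff_distrib)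
  then show ?case
    by (simp only: e lookup_minus[of "Var u * edge_poly es"] lookup_Var_mult Cons upd coef.simps)
qed

lemma coef_support: "coef es t \<noteq> 0 \<Longrightarrow> t w \<noteq> 0 \<Longrightarrow> \<exists>(u, v)\<in>set es. w = u \<or> w = v"
proof (induction es t rule: coef.induct)
  case (1 t)
  then show ?case by (auto split: if_splits)
next
  case (2 u v es t)
  show ?case
  proof (cases "w = u \<or> w = v")
    case False
    from 2(3) consider "t u > 0" "coef es (t(u := t u - 1)) \<noteq> 0" | "t v > 0" "coef es (t(v := t v - 1)) \<noteq> 0"
      by (cases "t u > 0 \<and> coef es (t(u := t u - 1)) \<noteq> 0") (auto split: if_splits)
    then show ?thesis
    proof cases
      case 1 then show ?thesis using 2(1)[OF 1] 2(4) False by auto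
    next
      case c2: 2 then show ?thesis using 2(2)[OF c2] 2(4) False by auto
    qed
  qed auto
qed

lemma coef_nonzero_lookup:
  assumes "coef es t \<noteq> 0" obtains m where "Poly_Mapping.lookup m = t"
proof -
  have "{w. t w \<noteq> 0} \<subseteq> fst ` set es \<union> snd ` set es"
    using coef_support[OF assms] by force
  then have "finite {w. t w \<noteq> 0}" by (rule finite_subset) auto
  then have "Poly_Mapping.lookup (Abs_poly_mapping t) = t" by (rule lookup_Abs_poly_mapping)
  then show ?thesis using that by blast
qed

lemma coef_perm:
  assumes "mset es = mset es'" shows "coef es t = coef es' t"
proof -
  have "edge_poly es = edge_poly es'"
    unfolding edge_poly_def using assms by (simp flip: prod_mset_prod_list)
  then have eq: "coef es (Poly_Mapping.lookup m) = coef es' (Poly_Mapping.lookup m)" for m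
    by (metis lookup_edge_poly)
  show ?thesis
  proof (cases "coef es t = 0 \<and> coef es' t = 0")
    case False
    then obtain m where "Poly_Mapping.lookup m = t" using coef_nonzero_lookup by metis
    then show ?thesis using eq by metis
  qed auto
qed

text \<open>
  The sign does not depend on \<open>t\<close>, so the set of monomials that occur does not depend on orientations.
\<close>

lemma coef_flip:
  "\<exists>s::int. s \<noteq> 0 \<and> (\<forall>t. coef (map (\<lambda>p. if Q p then p else prod.swap p) es) t = s * coef es t)"
proof (induction es)
  case Nil
  then show ?case by (intro exI[of _ 1]) auto
next
  case (Cons e es)
  then obtain s :: int where s: "s \<noteq> 0" "\<And>t. coef (map (\<lambda>p. if Q p then p else prod.swap p) es) t = s * coef es t" by blast
  obtain u v where e: "e = (u, v)" by (cases e)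
  show ?case
    by (rule exI[of _ "if Q e then s else - s"]) (use s in \<open>auto simp: e algebra_simps\<close>)
qed

definition orients :: "('v \<times> 'v) list \<Rightarrow> ('v \<times> 'v) set \<Rightarrow> bool" where
  "orients es R \<longleftrightarrow> distinct es \<and> (\<forall>(u, v)\<in>set es. (u, v) \<in> R \<and> (v, u) \<notin> set es) \<and>
     (\<forall>(u, v)\<in>R. (u, v) \<in> set es \<or> (v, u) \<in> set es)"

lemma orients_coef:
  assumes "orients es R" "orients es' R" "sym R"
  obtains s :: int where "s \<noteq> 0" "\<And>t. coef es t = s * coef es' t"
proof -
  \<comment> \<open>turns the edges of \<open>es'\<close> to the direction that they have in \<open>es\<close>\<close>
  let ?f = "\<lambda>p. if p \<in> set es then p else prod.swap p"
  have 1: "?f p \<in> set es" if "p \<in> set es'" for p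
    using assms that unfolding orients_def by (cases p) fastforce
  have inj: "inj_on ?f (set es')"
  proof (rule inj_onI)
    fix p q assume pq: "p \<in> set es'" "q \<in> set es'" "?f p = ?f q"
    have "prod.swap p \<notin> set es'" "prod.swap q \<notin> set es'" using pq assms(2) unfolding orients_def by (auto simp: case_prod_beta)
    then show "p = q" using pq by (cases p; cases q) (auto split: if_splits)
  qed
  have sub: "set es \<subseteq> ?f ` set es'"
  proof
    fix p assume p: "p \<in> set es"
    obtain u v where uv: "p = (u, v)" by (cases p)
    have "(u, v) \<in> R" "(v, u) \<notin> set es" using p uv assms(1) unfolding orients_def by auto
    then have "(u, v) \<in> set es' \<or> (v, u) \<in> set es'" using assms(2) unfolding orients_def by auto
    then show "p \<in> ?f ` set es'"
    proof
      assume "(u, v) \<in> set es'" then show ?thesis using p uv by (force intro!: image_eqI[of _ _ "(u, v)"])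
    next
      assume "(v, u) \<in> set es'" then show ?thesis using \<open>(v, u) \<notin> set es\<close> uv by (force intro!: image_eqI[of _ _ "(v, u)"])
    qed
  qed
  have "distinct (map ?f es')" using inj assms(2) by (simp add: distinct_map orients_def)
  moreover have "set (map ?f es') = set es" using 1 sub unfolding set_map by blast
  moreover have "distinct es" using assms(1) by (simp add: orients_def)
  ultimately have "mset (map ?f es') = mset es" using set_eq_iff_mset_eq_distinct by blast
  then have "coef es t = coef (map ?f es') t" for t using coef_perm by metis
  then show ?thesis using that coef_flip[of "\<lambda>p. p \<in> set es" es'] by metis
qed

text \<open>
  The exponents are bounded by a function, as the induction needs different bounds at different vertices.
\<close>

definition AT_on :: "('v \<times> 'v) set \<Rightarrow> ('v \<Rightarrow> nat) \<Rightarrow> bool" where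
  "AT_on R b \<longleftrightarrow> (\<exists>es t. orients es R \<and> coef es t \<noteq> 0 \<and> (\<forall>v. t v \<le> b v))"

lemma AT_onD:
  assumes "AT_on R b" "sym R" "orients es R"
  obtains t where "coef es t \<noteq> 0" "\<And>v. t v \<le> b v"
proof -
  obtain es' t where e: "orients es' R" "coef es' t \<noteq> 0" "\<forall>v. t v \<le> b v" using assms(1) by (auto simp: AT_on_def)
  obtain s :: int where "s \<noteq> 0" "\<And>t. coef es t = s * coef es' t" using orients_coef[OF assms(3) e(1) assms(2)] by metis
  then show ?thesis using that[of t] e by auto
qed

lemma AT_on_mono: "AT_on R b \<Longrightarrow> (\<And>v. b v \<le> b' v) \<Longrightarrow> AT_on R b'"
  unfolding AT_on_def by (meson le_trans)

lemma AT_on_empty: "AT_on {} b"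
  unfolding AT_on_def orients_def by (intro exI[of _ "[]"] exI[of _ "\<lambda>_. 0"]) auto

lemma coef_append_disjoint:
  "(\<forall>(u, v)\<in>set eB. u \<in> B \<and> v \<in> B) \<Longrightarrow> (\<forall>(u, v)\<in>set eA. u \<in> A \<and> v \<in> A) \<Longrightarrow> A \<inter> B = {} \<Longrightarrow>
   (\<And>w. w \<notin> A \<Longrightarrow> tA w = 0) \<Longrightarrow> (\<And>w. w \<notin> B \<Longrightarrow> tB w = 0) \<Longrightarrow>
   coef (eB @ eA) (\<lambda>w. tA w + tB w) = coef eB tB * coef eA tA"
proof (induction eB arbitrary: tB)
  case Nil
  show ?case
  proof (cases "tB = (\<lambda>_. 0)")
    case False
    then obtain w where w: "tB w \<noteq> 0" by auto
    then have "w \<notin> A" using w Nil(5)[of w] Nil(3) by auto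
    have "coef eA (\<lambda>w. tA w + tB w) = 0"
    proof (rule ccontr)
      assume "coef eA (\<lambda>w. tA w + tB w) \<noteq> 0"
      from coef_support[OF this, of w] have "\<exists>(u, v)\<in>set eA. w = u \<or> w = v" using w by simp
      then show False using \<open>w \<notin> A\<close> Nil(2) by auto
    qed
    then show ?thesis using False by simp
  qed auto
next
  case (Cons e eB)
  obtain u v where e: "e = (u, v)" by (cases e)
  have uv: "u \<in> B" "v \<in> B" "u \<notin> A" "v \<notin> A" using Cons(2,4) e by auto
  have IH: "coef (eB @ eA) (\<lambda>w. tA w + tB' w) = coef eB tB' * coef eA tA" if "\<And>w. w \<notin> B \<Longrightarrow> tB' w = 0" for tB'
    using Cons that by auto
  have tz: "tA x = 0" if "x = u \<or> x = v" for x using that uv Cons(5) by auto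
  have upd: "(\<lambda>w. tA w + tB w)(x := tA x + tB x - 1) = (\<lambda>w. tA w + (tB(x := tB x - 1)) w)" if "x = u \<or> x = v" for x
    using tz[OF that] by auto
  have "coef (eB @ eA) ((\<lambda>w. tA w + tB w)(x := tA x + tB x - 1)) = coef eB (tB(x := tB x - 1)) * coef eA tA"
    if x: "x = u \<or> x = v" for x
    unfolding upd[OF x] by (rule IH) (use x uv Cons(6) in auto)
  from this[of u] this[of v] show ?case using tz[of u] tz[of v] by (simp add: e algebra_simps)
qed

text \<open>
  Every factor with both ends in \<open>A\<close> contributes to the degree in the variables of \<open>A\<close>.
\<close>

lemma coef_too_small:
  assumes "finite A"
  shows "(\<Sum>w\<in>A. t w) < length (filter (\<lambda>(u, v). u \<in> A \<and> v \<in> A) es) \<Longrightarrow> coef es t = 0"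
proof (induction es t rule: coef.induct)
  case (2 u v es t)
  have upd: "sum (t(x := t x - 1)) A + (if x \<in> A then 1 else 0) = (\<Sum>w\<in>A. t w)" if "t x > 0" for x
    using that assms by (cases "x \<in> A") (auto simp: sum.remove[of A x] intro!: sum.cong)
  have "coef es (t(u := t u - 1)) = 0" if "t u > 0"
    using 2(1)[OF that] upd[OF that] 2(3) by (auto simp del: fun_upd_apply split: if_splits)
  moreover have "coef es (t(v := t v - 1)) = 0" if "t v > 0"
    using 2(2)[OF that] upd[OF that] 2(3) by (auto simp del: fun_upd_apply split: if_splits)
  ultimately show ?case by simp
qed auto

lemma coef_degree:
  assumes "finite A"
  shows "coef es t \<noteq> 0 \<Longrightarrow> (\<forall>(u, v)\<in>set es. u \<in> A \<and> v \<in> A) \<Longrightarrow> (\<Sum>w\<in>A. t w) = length es"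
proof (induction es t rule: coef.induct)
  case (2 u v es t)
  have upd: "sum (t(x := t x - 1)) A + 1 = (\<Sum>w\<in>A. t w)" if "t x > 0" "x \<in> A" for x
    using that assms by (auto simp: sum.remove[of A x] intro!: sum.cong)
  from 2(3) consider "t u > 0" "coef es (t(u := t u - 1)) \<noteq> 0" | "t v > 0" "coef es (t(v := t v - 1)) \<noteq> 0"
    by (cases "t u > 0 \<and> coef es (t(u := t u - 1)) \<noteq> 0") (auto split: if_splits)
  then show ?case
  proof cases
    case 1 then show ?thesis using 2(1)[OF 1] 2(4) upd[of u] 1(1) by (auto simp del: fun_upd_apply)
  next
    case c2: 2 then show ?thesis using 2(2)[OF c2] 2(4) upd[of v] c2(1) by (auto simp del: fun_upd_apply)
  qed
qed (auto split: if_splits)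

text \<open>
  The edges inside \<open>A\<close> alone already use up the degree that \<open>t\<close> has in the variables of \<open>A\<close>. So a choice
  that contributes to the coefficient takes from each mixed factor the variable in \<open>B\<close>.
\<close>

lemma coef_mixed:
  assumes A: "finite A" "A \<inter> B = {}"
    and t: "(\<Sum>w\<in>A. t w) = length (filter (\<lambda>(u, v). u \<in> A \<and> v \<in> A) es)"
  shows "(\<forall>(a, b)\<in>set mx. a \<in> A \<and> b \<in> B) \<Longrightarrow>
    coef (mx @ es) (\<lambda>w. t w + length (filter (\<lambda>p. snd p = w) mx)) = (-1) ^ length mx * coef es t"
proof (induction mx)
  case (Cons e mx)
  obtain a b where e: "e = (a, b)" by (cases e)
  have ab: "a \<in> A" "b \<in> B" "a \<noteq> b" "b \<notin> A" using Cons(2) e A by auto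
  let ?t = "\<lambda>w. t w + length (filter (\<lambda>p. snd p = w) mx)"
  let ?t' = "\<lambda>w. t w + length (filter (\<lambda>p. snd p = w) (e # mx))"
  have noA: "length (filter (\<lambda>p. snd p = w) (e # mx)) = 0" if "w \<in> A" for w
    using that Cons(2) A by (force simp: filter_empty_conv)
  have sumA: "(\<Sum>w\<in>A. ?t' w) = (\<Sum>w\<in>A. t w)"
    by (rule sum.cong) (use noA in auto)
  have z: "coef (mx @ es) (?t'(a := ?t' a - 1)) = 0" if pos: "?t' a > 0"
  proof (rule coef_too_small[OF A(1)])
    have "sum (?t'(a := ?t' a - 1)) A < (\<Sum>w\<in>A. ?t' w)"
      by (rule sum_strict_mono_ex1) (use A ab pos in auto)
    also have "\<dots> = length (filter (\<lambda>(u, v). u \<in> A \<and> v \<in> A) es)" using sumA t by simp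
    also have "\<dots> \<le> length (filter (\<lambda>(u, v). u \<in> A \<and> v \<in> A) (mx @ es))" by simp
    finally show "sum (?t'(a := ?t' a - 1)) A < length (filter (\<lambda>(u, v). u \<in> A \<and> v \<in> A) (mx @ es))" .
  qed
  have upd: "?t'(b := ?t' b - 1) = ?t" by (rule ext) (auto simp: e)
  have pb: "?t' b > 0" by (simp add: e)
  have "coef ((e # mx) @ es) ?t' = - coef (mx @ es) ?t"
    using z pb upd by (simp only: e append_Cons coef.simps) (auto simp: e)
  then show ?case using Cons by auto
qed auto

text \<open>
  The algebraic form of colouring \<open>A\<close> before \<open>B\<close>: a vertex of \<open>B\<close> needs one colour more for each of its
  neighbours in \<open>A\<close>.
\<close>

theorem AT_extend:
  assumes fin: "finite A" "finite B" and AB: "A \<inter> B = {}" and R: "R \<subseteq> (A \<union> B) \<times> (A \<union> B)" "sym R"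
    and atA: "AT_on (R \<inter> A \<times> A) bA" and atB: "AT_on (R \<inter> B \<times> B) bB"
  shows "AT_on R (\<lambda>w. if w \<in> B then bB w + card {a \<in> A. (a, w) \<in> R} else bA w)"
proof -
  obtain eA tA where eA: "orients eA (R \<inter> A \<times> A)" "coef eA tA \<noteq> 0" "\<forall>v. tA v \<le> bA v" using atA by (auto simp: AT_on_def)
  obtain eB tB where eB: "orients eB (R \<inter> B \<times> B)" "coef eB tB \<noteq> 0" "\<forall>v. tB v \<le> bB v" using atB by (auto simp: AT_on_def)
  have "finite (R \<inter> A \<times> B)" using fin by auto
  then obtain mx where mx: "set mx = R \<inter> A \<times> B" "distinct mx" using finite_distinct_list by metis
  have inA: "\<forall>(u, v)\<in>set eA. u \<in> A \<and> v \<in> A" using eA(1) by (auto simp: orients_def)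
  have inB: "\<forall>(u, v)\<in>set eB. u \<in> B \<and> v \<in> B" using eB(1) by (auto simp: orients_def)
  have sA: "tA w = 0" if "w \<notin> A" for w using coef_support[OF eA(2), of w] that inA by auto
  have sB: "tB w = 0" if "w \<notin> B" for w using coef_support[OF eB(2), of w] that inB by auto
  have c1: "coef (eB @ eA) (\<lambda>w. tA w + tB w) \<noteq> 0"
    using coef_append_disjoint[OF inB inA AB sA sB] eA(2) eB(2) by simp
  have "(\<Sum>w\<in>A. tA w + tB w) = (\<Sum>w\<in>A. tA w)" by (rule sum.cong) (use sB AB in auto)
  also have "\<dots> = length eA" by (rule coef_degree[OF fin(1) eA(2) inA])
  also have "\<dots> = length (filter (\<lambda>(u, v). u \<in> A \<and> v \<in> A) (eB @ eA))"
  proof -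
    have "filter (\<lambda>(u, v). u \<in> A \<and> v \<in> A) eA = eA" using inA by (auto intro: filter_True)
    moreover have "filter (\<lambda>(u, v). u \<in> A \<and> v \<in> A) eB = []" using inB AB by (auto simp: filter_empty_conv)
    ultimately show ?thesis by simp
  qed
  finally have deg: "(\<Sum>w\<in>A. tA w + tB w) = length (filter (\<lambda>(u, v). u \<in> A \<and> v \<in> A) (eB @ eA))" .
  let ?t = "\<lambda>w. tA w + tB w + length (filter (\<lambda>p. snd p = w) mx)"
  have c2: "coef (mx @ eB @ eA) ?t \<noteq> 0"
  proof -
    have "\<forall>(a, b)\<in>set mx. a \<in> A \<and> b \<in> B" using mx(1) by auto
    from coef_mixed[OF fin(1) AB deg this] show ?thesis using c1 by simp
  qed
  have or: "orients (mx @ eB @ eA) R"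
  proof -
    have 1: "distinct (mx @ eB @ eA)" using mx eA(1) eB(1) inA inB AB by (auto simp: orients_def)
    have 2: "(u, v) \<in> R \<and> (v, u) \<notin> set (mx @ eB @ eA)" if "(u, v) \<in> set (mx @ eB @ eA)" for u v
      using that mx(1) eA(1) eB(1) inA inB AB unfolding orients_def by fastforce
    have 3: "(u, v) \<in> set (mx @ eB @ eA) \<or> (v, u) \<in> set (mx @ eB @ eA)" if uv: "(u, v) \<in> R" for u v
    proof -
      have vu: "(v, u) \<in> R" using uv R(2) by (meson symD)
      consider "u \<in> A" "v \<in> A" | "u \<in> B" "v \<in> B" | "u \<in> A" "v \<in> B" | "u \<in> B" "v \<in> A" using R(1) uv by blast
      then show ?thesis using uv vu mx(1) eA(1) eB(1) unfolding orients_def by cases auto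
    qed
    show ?thesis unfolding orients_def using 1 2 3 by blast
  qed
  have len: "length (filter (\<lambda>p. snd p = w) mx) \<le> (if w \<in> B then card {a \<in> A. (a, w) \<in> R} else 0)" for w
  proof -
    have "length (filter (\<lambda>p. snd p = w) mx) = card {p \<in> set mx. snd p = w}"
      using mx(2) by (metis distinct_card distinct_filter set_filter)
    also have "{p \<in> set mx. snd p = w} = (if w \<in> B then (\<lambda>a. (a, w)) ` {a \<in> A. (a, w) \<in> R} else {})"
      using mx(1) by auto
    finally show ?thesis using fin(1) by (auto intro: card_image_le)
  qed
  have "?t w \<le> (if w \<in> B then bB w + card {a \<in> A. (a, w) \<in> R} else bA w)" for w
  proof (cases "w \<in> B")
    case True
    then have "tA w = 0" using sA AB by blast
    then show ?thesis using True len[of w] eB(3)[rule_format, of w] by auto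
  next
    case False
    then show ?thesis using len[of w] eA(3)[rule_format, of w] sB[of w] by auto
  qed
  then show ?thesis unfolding AT_on_def using or c2 by (intro exI[of _ "mx @ eB @ eA"] exI[of _ ?t]) blast
qed

lemma coef_map:
  "inj_on \<phi> I \<Longrightarrow> (\<forall>(u, v)\<in>set es. u \<in> I \<and> v \<in> I) \<Longrightarrow> (\<And>w. w \<notin> \<phi> ` I \<Longrightarrow> t w = 0) \<Longrightarrow>
   coef (map (map_prod \<phi> \<phi>) es) t = coef es (\<lambda>i. if i \<in> I then t (\<phi> i) else 0)"
proof (induction es arbitrary: t)
  case Nil
  then have "t = (\<lambda>_. 0) \<longleftrightarrow> (\<lambda>i. if i \<in> I then t (\<phi> i) else 0) = (\<lambda>_. 0)"
    unfolding fun_eq_iff by (metis image_iff)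
  then show ?case by auto
next
  case (Cons e es)
  obtain u v where e: "e = (u, v)" by (cases e)
  have uv: "u \<in> I" "v \<in> I" using Cons(3) e by auto
  have upd: "(\<lambda>i. if i \<in> I then (t(\<phi> x := c)) (\<phi> i) else 0) = (\<lambda>i. if i \<in> I then t (\<phi> i) else 0)(x := c)" if "x \<in> I" for x c
    using that Cons(2) by (auto simp: fun_eq_iff inj_on_eq_iff)
  have "coef (map (map_prod \<phi> \<phi>) es) (t(\<phi> x := c)) = coef es (\<lambda>i. if i \<in> I then (t(\<phi> x := c)) (\<phi> i) else 0)" if "x \<in> I" for x c
    by (rule Cons(1)) (use Cons that in auto)
  then show ?case using uv by (simp add: e upd)
qed

text \<open>
  The product in the graph polynomial takes one arc of each edge, the one that is increasing in \<open>r\<close>.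
\<close>

lemma AT_on_choosable:
  assumes "pair_graph H" "strict_linear_order_on (pverts H) r" "AT_on (parcs H) (\<lambda>_. k)"
  shows "Alon_Tarsi_choosable r (Suc k) H"
proof -
  interpret pair_graph H by fact
  let ?D = "{(u, v). (u, v) \<in> parcs H \<and> (u, v) \<in> r}"
  have fin: "finite ?D" by (rule finite_subset[of _ "parcs H"]) auto
  obtain es where es: "set es = ?D" "distinct es" using finite_distinct_list[OF fin] by metis
  have sym: "sym (parcs H)" using pair_sym_arcs by (auto simp: symmetric_def symp_on_def sym_def)
  have r: "irrefl r" "trans r" "total_on (pverts H) r" using assms(2) by (auto simp: strict_linear_order_on_def)
  have or: "orients es (parcs H)"
    unfolding orients_def
  proof (intro conjI ballI)
    show "distinct es" by fact
    fix p assume "p \<in> set es"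
    then show "case p of (u, v) \<Rightarrow> (u, v) \<in> parcs H \<and> (v, u) \<notin> set es"
      using es(1) r by (auto simp: irrefl_def dest: transD)
  next
    fix p assume p: "p \<in> parcs H"
    obtain u v where uv: "p = (u, v)" by (cases p)
    have "u \<in> pverts H" "v \<in> pverts H" "u \<noteq> v" using p uv pair_no_loops arc_fst_in_verts arc_snd_in_verts by fastforce+
    then have "(u, v) \<in> r \<or> (v, u) \<in> r" using r(3) by (auto simp: total_on_def)
    then show "case p of (u, v) \<Rightarrow> (u, v) \<in> set es \<or> (v, u) \<in> set es" using p uv es(1) sym by (auto dest: symD)
  qed
  obtain t where t: "coef es t \<noteq> 0" "\<And>v. t v \<le> k" using AT_onD[OF assms(3) sym or] by blast
  obtain m where m: "Poly_Mapping.lookup m = t" using coef_nonzero_lookup[OF t(1)] by metis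
  have "graph_poly r H = edge_poly es"
    unfolding graph_poly_def edge_poly_def es(1)[symmetric] using es(2) by (simp add: prod.distinct_set_conv_list)
  then have "Poly_Mapping.lookup (graph_poly r H) m \<noteq> 0" using t(1) m lookup_edge_poly by metis
  then show ?thesis unfolding Alon_Tarsi_choosable_def using m t(2) by (intro exI[of _ m]) auto
qed

section \<open>Reducible configurations\<close>

definition sq :: "('a \<times> 'a) set \<Rightarrow> ('a \<times> 'a) set" where
  "sq E = {(u, v). u \<noteq> v \<and> ((u, v) \<in> E \<or> (\<exists>w. (u, w) \<in> E \<and> (w, v) \<in> E))}"

definition nbrs :: "('a \<times> 'a) set \<Rightarrow> 'a \<Rightarrow> 'a set" where
  "nbrs E v = {w. (v, w) \<in> E}"

locale sparse_subcubic =
  fixes V :: "'a set" and E :: "('a \<times> 'a) set"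
  assumes finV: "finite V" and EV: "E \<subseteq> V \<times> V"
    and symE: "(u, v) \<in> E \<Longrightarrow> (v, u) \<in> E" and irrE: "(u, u) \<notin> E"
    and deg3: "card (nbrs E v) \<le> 3"
    and no_cycle: "distinct cs \<Longrightarrow> 4 \<le> length cs \<Longrightarrow> length cs \<le> 8 \<Longrightarrow> \<not> cedges cs \<subseteq> uedges E"
begin

lemma uedge_iff: "{u, v} \<in> uedges E \<longleftrightarrow> (u, v) \<in> E"
  unfolding uedges_def using symE by (auto simp: doubleton_eq_iff)

lemma fin_nbrs: "finite (nbrs E v)"
  by (rule finite_subset[OF _ finV]) (use EV in \<open>auto simp: nbrs_def\<close>)

end

text \<open>
  The last condition says that deleting \<open>S\<close> destroys no adjacency of the square elsewhere.
\<close>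

definition reducible :: "'a set \<Rightarrow> ('a \<times> 'a) set \<Rightarrow> bool" where
  "reducible V E \<longleftrightarrow> (\<exists>S b. S \<subseteq> V \<and> S \<noteq> {} \<and> AT_on (sq E \<inter> S \<times> S) b \<and>
     (\<forall>w\<in>S. b w + card {a \<in> V - S. (a, w) \<in> sq E} \<le> 5) \<and>
     sq E \<inter> (V - S) \<times> (V - S) = sq (E \<inter> (V - S) \<times> (V - S)))"

fun decrement :: "nat list \<Rightarrow> nat \<Rightarrow> nat list option" where
  "decrement [] i = None"
| "decrement (x # xs) 0 = (case x of 0 \<Rightarrow> None | Suc y \<Rightarrow> Some (y # xs))"
| "decrement (x # xs) (Suc i) = (case decrement xs i of None \<Rightarrow> None | Some ys \<Rightarrow> Some (x # ys))"

lemma decrement_eq: "i < length t \<Longrightarrow> decrement t i = (if t ! i = 0 then None else Some (t[i := t ! i - 1]))"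
  by (induction t i rule: decrement.induct) (auto split: nat.splits)

text \<open>
  Evaluates a coefficient vertex by vertex. The state is the current vertex, given by the edges to later
  vertices that are still to be decided and the exponent \<open>k\<close> it still has to collect, followed by the
  exponents and the lists of later neighbours of the vertices to come. Later neighbours are written
  as offsets, so that the lists shrink along with the vertices. A branch in which \<open>k\<close> exceeds the number of
  undecided edges is given up at once, which keeps the search trees small.
\<close>

function peel :: "nat list \<Rightarrow> nat \<Rightarrow> nat list \<Rightarrow> nat list list \<Rightarrow> int" where
  "peel (d # ds) k t L = (case k of 0 \<Rightarrow> 0 | Suc k' \<Rightarrow> peel ds k' t L)
     - (if length ds < k then 0 else case decrement t d of None \<Rightarrow> 0 | Some t' \<Rightarrow> peel ds k t' L)"
| "peel [] (Suc k) t L = 0"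
| "peel [] 0 t [] = 1"
| "peel [] 0 [] (ds # L) = 0"
| "peel [] 0 (k # t) (ds # L) = peel ds k t L"
  by pat_completeness auto
termination by (relation "measures [\<lambda>(ds, k, t, L). length L, \<lambda>(ds, k, t, L). length ds]") auto

fun later_edges :: "nat list \<Rightarrow> nat list list \<Rightarrow> (nat \<times> nat) list" where
  "later_edges (s # \<sigma>) (ds # L) = map (\<lambda>d. (s, \<sigma> ! d)) ds @ later_edges \<sigma> L"
| "later_edges _ _ = []"

fun offs_ok :: "nat list list \<Rightarrow> bool" where
  "offs_ok (ds # L) = ((\<forall>d\<in>set ds. d < length L) \<and> distinct ds \<and> offs_ok L)"
| "offs_ok [] = True"

definition exponent :: "nat list \<Rightarrow> nat list \<Rightarrow> nat \<Rightarrow> nat" where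
  "exponent \<sigma> t v = (case map_of (zip \<sigma> t) v of None \<Rightarrow> 0 | Some k \<Rightarrow> k)"

lemma exponent_Cons: "exponent (s # \<sigma>) (k # t) = (exponent \<sigma> t)(s := k)"
  by (auto simp: exponent_def fun_eq_iff)

lemma exponent_notin: "v \<notin> set \<sigma> \<Longrightarrow> exponent \<sigma> t v = 0"
  by (auto simp: exponent_def split: option.split dest!: map_of_SomeD set_zip_leftD)

lemma exponent_nth: "distinct \<sigma> \<Longrightarrow> i < length \<sigma> \<Longrightarrow> length t = length \<sigma> \<Longrightarrow> exponent \<sigma> t (\<sigma> ! i) = t ! i"
  unfolding exponent_def by (simp add: map_of_zip_nth)

lemma exponent_upd: "distinct \<sigma> \<Longrightarrow> i < length \<sigma> \<Longrightarrow> length t = length \<sigma> \<Longrightarrow> exponent \<sigma> (t[i := c]) = (exponent \<sigma> t)(\<sigma> ! i := c)"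
proof (rule ext)
  fix v assume a: "distinct \<sigma>" "i < length \<sigma>" "length t = length \<sigma>"
  show "exponent \<sigma> (t[i := c]) v = ((exponent \<sigma> t)(\<sigma> ! i := c)) v"
  proof (cases "v \<in> set \<sigma>")
    case True
    then obtain j where "j < length \<sigma>" "v = \<sigma> ! j" by (auto simp: in_set_conv_nth)
    then show ?thesis using a by (simp add: exponent_nth nth_list_update nth_eq_iff_index_eq)
  next
    case False
    then show ?thesis using a by (auto simp: exponent_notin)
  qed
qed

lemma later_edges_verts: "(u, v) \<in> set (later_edges \<sigma> L) \<Longrightarrow> length L = length \<sigma> \<Longrightarrow> offs_ok L \<Longrightarrow> u \<in> set \<sigma> \<and> v \<in> set \<sigma>"
  by (induction \<sigma> L rule: later_edges.induct) auto

lemma coef_too_big: "coef es t \<noteq> 0 \<Longrightarrow> t w \<le> length (filter (\<lambda>(u, v). u = w \<or> v = w) es)"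
proof (induction es t rule: coef.induct)
  case (2 u v es t)
  from 2(3) consider "t u > 0" "coef es (t(u := t u - 1)) \<noteq> 0" | "t v > 0" "coef es (t(v := t v - 1)) \<noteq> 0"
    by (cases "t u > 0 \<and> coef es (t(u := t u - 1)) \<noteq> 0") (auto split: if_splits)
  then show ?case
  proof cases
    case 1 then show ?thesis using 2(1)[OF 1] by (auto split: if_splits)
  next
    case c2: 2 then show ?thesis using 2(2)[OF c2] by (auto split: if_splits)
  qed
qed (auto split: if_splits)

lemma peel_coef:
  "distinct (s # \<sigma>) \<Longrightarrow> length t = length \<sigma> \<Longrightarrow> length L = length \<sigma> \<Longrightarrow> offs_ok L \<Longrightarrow> \<forall>d\<in>set ds. d < length \<sigma> \<Longrightarrow>
   peel ds k t L = coef (map (\<lambda>d. (s, \<sigma> ! d)) ds @ later_edges \<sigma> L) (exponent (s # \<sigma>) (k # t))"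
proof (induction ds k t L arbitrary: s \<sigma> rule: peel.induct)
  case (1 d ds k t L)
  let ?es = "map (\<lambda>d. (s, \<sigma> ! d)) ds @ later_edges \<sigma> L"
  have d: "d < length \<sigma>" "\<sigma> ! d \<noteq> s" using 1 by auto
  have s0: "exponent (s # \<sigma>) (k # t) s = k" by (simp add: exponent_Cons)
  have d0: "exponent (s # \<sigma>) (k # t) (\<sigma> ! d) = t ! d" using d 1 by (simp add: exponent_Cons exponent_nth)
  have us: "(exponent (s # \<sigma>) (k # t))(s := c) = exponent (s # \<sigma>) (c # t)" for c by (simp add: exponent_Cons)
  have ud: "(exponent (s # \<sigma>) (k # t))(\<sigma> ! d := c) = exponent (s # \<sigma>) (k # t[d := c])" for c
    using d 1 by (simp add: exponent_Cons exponent_upd fun_upd_twist)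
  have A: "(case k of 0 \<Rightarrow> 0 | Suc k' \<Rightarrow> peel ds k' t L) = (if k > 0 then coef ?es (exponent (s # \<sigma>) ((k - 1) # t)) else 0)"
    using 1 by (cases k) auto
  have B: "(if length ds < k then 0 else case decrement t d of None \<Rightarrow> 0 | Some t' \<Rightarrow> peel ds k t' L) =
      (if t ! d > 0 then coef ?es (exponent (s # \<sigma>) (k # t[d := t ! d - 1])) else 0)"
  proof (cases "length ds < k")
    case True
    have "coef ?es (exponent (s # \<sigma>) (k # t[d := t ! d - 1])) = 0"
    proof (rule ccontr)
      assume "coef ?es (exponent (s # \<sigma>) (k # t[d := t ! d - 1])) \<noteq> 0"
      from coef_too_big[OF this, of s] have "k \<le> length (filter (\<lambda>(u, v). u = s \<or> v = s) ?es)" by (simp add: exponent_Cons)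
      moreover have "filter (\<lambda>(u, v). u = s \<or> v = s) (later_edges \<sigma> L) = []"
      proof -
        have "u \<noteq> s \<and> v \<noteq> s" if "(u, v) \<in> set (later_edges \<sigma> L)" for u v
          using later_edges_verts[OF that] 1(3,5,6) by auto
        then show ?thesis by (fastforce simp: filter_empty_conv)
      qed
      ultimately show False using True le_trans[OF _ length_filter_le] by fastforce
    qed
    then show ?thesis using True by simp
  next
    case False
    have dt: "d < length t" using d 1 by simp
    show ?thesis
    proof (cases "t ! d = 0")
      case True then show ?thesis using decrement_eq[OF dt] False by simp
    next
      case nz: False
      then have de: "decrement t d = Some (t[d := t ! d - 1])" using decrement_eq[OF dt] by simp
      have "peel ds k (t[d := t ! d - 1]) L = coef ?es (exponent (s # \<sigma>) (k # t[d := t ! d - 1]))"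
        by (rule 1(2)[OF False de]) (use 1(3-7) in auto)
      then show ?thesis using nz False de by simp
    qed
  qed
  show ?case
    unfolding peel.simps A B using us[of "k - 1"] ud[of "t ! d - 1"] s0 d0 by (simp only: list.map append_Cons coef.simps)
next
  case (2 k t L)
  have "coef (later_edges \<sigma> L) (exponent (s # \<sigma>) (Suc k # t)) = 0"
  proof (rule ccontr)
    assume "coef (later_edges \<sigma> L) (exponent (s # \<sigma>) (Suc k # t)) \<noteq> 0"
    from coef_support[OF this, of s] obtain u v where "(u, v) \<in> set (later_edges \<sigma> L)" "s = u \<or> s = v" by (auto simp: exponent_Cons)
    then show False using later_edges_verts[of u v \<sigma> L] 2 by auto
  qed
  then show ?case by simp
next
  case (3 t)
  then show ?case by (simp add: exponent_Cons) (simp add: exponent_def fun_eq_iff)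
next
  case (4 ds L)
  then show ?case by auto
next
  case (5 k t ds L)
  obtain s' \<sigma>' where s: "\<sigma> = s' # \<sigma>'" using 5 by (cases \<sigma>) auto
  have "exponent (s # \<sigma>) (0 # k # t) = exponent \<sigma> (k # t)"
    unfolding exponent_Cons[of s] using exponent_notin[of s \<sigma>] 5(2) by (auto simp: fun_eq_iff)
  moreover have "peel ds k t L = coef (map (\<lambda>d. (s', \<sigma>' ! d)) ds @ later_edges \<sigma>' L) (exponent (s' # \<sigma>') (k # t))"
    by (rule 5(1)) (use 5(2-6) s in auto)
  ultimately show ?case using s by simp
qed

text \<open>
  Adjacency in the square of the graph with adjacency lists \<open>A\<close>.
\<close>

definition near :: "nat list list \<Rightarrow> nat \<Rightarrow> nat \<Rightarrow> bool" where
  "near A i j \<longleftrightarrow> i \<noteq> j \<and> (j \<in> set (A ! i) \<or> (\<exists>k\<in>set (A ! i). j \<in> set (A ! k)))"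

text \<open>
  Is there a path with at least \<open>lo\<close> vertices that extends the reversed path \<open>p\<close> by at most the given
  number of vertices and ends in \<open>j\<close>?
\<close>

fun haspath :: "nat list list \<Rightarrow> nat \<Rightarrow> nat \<Rightarrow> nat list \<Rightarrow> nat \<Rightarrow> bool" where
  "haspath A 0 lo p j = False"
| "haspath A (Suc f) lo p j = (\<exists>k\<in>set (A ! hd p). k \<notin> set p \<and>
     (if k = j then lo \<le> Suc (length p) else haspath A f lo (k # p) j))"

abbreviation medges :: "nat list list \<Rightarrow> nat set set" where
  "medges A \<equiv> {{a, b} | a b. a < length A \<and> b \<in> set (A ! a)}"

lemma haspath_sound:
  assumes A: "\<forall>i<length A. \<forall>j\<in>set (A ! i). j < length A"
  shows "haspath A f lo p j \<Longrightarrow> p \<noteq> [] \<Longrightarrow> distinct p \<Longrightarrow> set p \<subseteq> {..<length A} \<Longrightarrow> pedges p \<subseteq> medges A \<Longrightarrow>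
   \<exists>q. q \<noteq> [] \<and> hd q = j \<and> last q = last p \<and> distinct q \<and> lo \<le> length q \<and> length q \<le> length p + f \<and>
     pedges q \<subseteq> medges A \<and> set q \<subseteq> {..<length A}"
proof (induction f arbitrary: p)
  case (Suc f)
  then obtain k where k: "k \<in> set (A ! hd p)" "k \<notin> set p" "if k = j then lo \<le> Suc (length p) else haspath A f lo (k # p) j"
    by auto
  obtain h p' where p: "p = h # p'" using Suc by (cases p) auto
  have kh: "k < length A" "h < length A" using A Suc(5) k(1) p by auto
  then have "{h, k} \<in> medges A" using k(1) p by force
  then have pe: "pedges (k # p) \<subseteq> medges A" using Suc(6) p by (simp add: insert_commute)
  show ?case
  proof (cases "k = j")
    case True
    then show ?thesis using k Suc(3-5) pe p kh by (intro exI[of _ "k # p"]) auto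
  next
    case False
    then have "haspath A f lo (k # p) j" using k by simp
    from Suc(1)[OF this _ _ _ pe] obtain q where q: "q \<noteq> []" "hd q = j" "last q = last (k # p)" "distinct q" "lo \<le> length q" 
      "length q \<le> length (k # p) + f" "pedges q \<subseteq> medges A" "set q \<subseteq> {..<length A}"
      using k Suc(3-5) kh by auto
    then show ?thesis using p by (intro exI[of _ q]) auto
  qed
qed auto

lemma pedges_map: "pedges (map f xs) = (`) f ` pedges xs"
  by (induction xs rule: pedges.induct) auto

text \<open>
  A certificate for a configuration with adjacency lists \<open>A\<close>. The vertices in \<open>P\<close>, its ports, may
  have one neighbour outside. The lists \<open>\<sigma>\<close>, \<open>t\<close> and \<open>L\<close> are an order of the vertices, the exponents of a
  monomial in this order, and the offsets of later neighbours in the square.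

  Since the coefficient belongs to one particular graph, the square induced on the configuration must
  not have further edges. They could come from an edge between two ports or from a common
  outside neighbour of two ports, and the path conditions turn either of these into a cycle of length
  4 to 8. The exception in the second condition is the path \<open>i\<close>, \<open>k\<close>, \<open>j\<close> through a vertex \<open>k\<close> of degree 2,
  where an edge between \<open>i\<close> and \<open>j\<close> creates a triangle with a vertex of degree 2.

  In the square, a vertex has at most one neighbour outside the configuration through each adjacent port,
  and a port has at most three more: its own outside neighbour and that vertex's two other neighbours.
  This is the bound on the exponents.
\<close>

definition config_ok :: "bool \<Rightarrow> nat list list \<Rightarrow> nat list \<Rightarrow> nat list \<Rightarrow> nat list \<Rightarrow> nat list list \<Rightarrow> bool" where
  "config_ok deg3_triangles A P \<sigma> t L \<longleftrightarrow>
    (\<forall>i\<in>set [0..<length A]. distinct (A ! i) \<and> (\<forall>j\<in>set (A ! i). j < length A \<and> j \<noteq> i \<and> i \<in> set (A ! j))) \<and>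
    (\<forall>i\<in>set P. i < length A \<and> (\<forall>j\<in>set P. i = j \<or> j \<in> set (A ! i) \<or> haspath A 7 4 [i] j \<or>
        (deg3_triangles \<and> (\<exists>k\<in>set [0..<length A]. k \<notin> set P \<and> length (A ! k) = 2 \<and> i \<in> set (A ! k) \<and> j \<in> set (A ! k))))) \<and>
    (\<forall>i\<in>set P. \<forall>j\<in>set P. i = j \<or> near A i j \<or> haspath A 6 3 [i] j) \<and>
    distinct \<sigma> \<and> length \<sigma> = length A \<and> (\<forall>i\<in>set \<sigma>. i < length A) \<and> length t = length A \<and> length L = length A \<and> offs_ok L \<and>
    (\<forall>(u, v)\<in>set (later_edges \<sigma> L). near A u v) \<and>
    (\<forall>i\<in>set [0..<length A]. \<forall>v\<in>set (A ! i @ concat (map (\<lambda>k. A ! k) (A ! i))). 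
        v = i \<or> (i, v) \<in> set (later_edges \<sigma> L) \<or> (v, i) \<in> set (later_edges \<sigma> L)) \<and>
    (\<forall>(i, k)\<in>set (zip \<sigma> t). k + (if i \<in> set P then 3 else 0) + length (filter (\<lambda>j. j \<in> set P) (A ! i)) \<le> 5) \<and>
    peel [] 0 t L \<noteq> 0"

lemma later_edges_orient:
  "distinct \<sigma> \<Longrightarrow> length L = length \<sigma> \<Longrightarrow> offs_ok L \<Longrightarrow> distinct (later_edges \<sigma> L) \<and> (\<forall>(u, v)\<in>set (later_edges \<sigma> L). (v, u) \<notin> set (later_edges \<sigma> L))"
proof (induction \<sigma> L rule: later_edges.induct)
  case (1 s \<sigma> ds L)
  have v: "u \<in> set \<sigma> \<and> v \<in> set \<sigma>" if "(u, v) \<in> set (later_edges \<sigma> L)" for u v using later_edges_verts[OF that] 1 by auto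
  have s: "s \<notin> set \<sigma>" "distinct \<sigma>" using 1 by auto
  have d: "\<sigma> ! d \<in> set \<sigma>" if "d \<in> set ds" for d using that 1 by auto
  have "inj_on (\<lambda>d. (s, \<sigma> ! d)) (set ds)" using 1 s by (auto simp: inj_on_def nth_eq_iff_index_eq)
  then have "distinct (map (\<lambda>d. (s, \<sigma> ! d)) ds)" using 1 by (simp add: distinct_map)
  moreover have "set (map (\<lambda>d. (s, \<sigma> ! d)) ds) \<inter> set (later_edges \<sigma> L) = {}" using v s by auto
  ultimately have "distinct (later_edges (s # \<sigma>) (ds # L))" using 1 by auto
  moreover have "(v', u) \<notin> set (later_edges (s # \<sigma>) (ds # L))" if "(u, v') \<in> set (later_edges (s # \<sigma>) (ds # L))" for u v'
  proof -
    have IH: "(v', u) \<notin> set (later_edges \<sigma> L)" if "(u, v') \<in> set (later_edges \<sigma> L)" using 1 that by auto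
    let ?H = "set (map (\<lambda>d. (s, \<sigma> ! d)) ds)"
    have H: "a = s \<and> b \<in> set \<sigma>" if "(a, b) \<in> ?H" for a b using that d by auto
    have "(u, v') \<in> ?H \<or> (u, v') \<in> set (later_edges \<sigma> L)" using that by simp
    then have "(v', u) \<notin> ?H \<and> (v', u) \<notin> set (later_edges \<sigma> L)" using H v s(1) IH by blast
    then show ?thesis by simp
  qed
  ultimately show ?case by blast
qed auto

context sparse_subcubic
begin

text \<open>
  The certificate speaks about indices; the list \<open>vs\<close> places the configuration in the graph.
\<close>

theorem config_reducible:
  assumes chk: "config_ok deg3_triangles A P \<sigma> t L"
    and notri: "deg3_triangles \<Longrightarrow> \<forall>a b c. (a, b) \<in> E \<longrightarrow> (b, c) \<in> E \<longrightarrow> (a, c) \<in> E \<longrightarrow> card (nbrs E a) > 2"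
    and vs: "distinct vs" "length vs = length A" "set vs \<subseteq> V" "vs \<noteq> []"
    and emb: "\<And>i j. i < length A \<Longrightarrow> j \<in> set (A ! i) \<Longrightarrow> (vs ! i, vs ! j) \<in> E"
    and dg: "\<And>i. i < length A \<Longrightarrow> card (nbrs E (vs ! i)) \<le> length (A ! i) + (if i \<in> set P then 1 else 0)"
  shows "reducible V E"
proof -
  let ?n = "length A" and ?S = "set vs"
  note K = chk[unfolded config_ok_def]
  have k1: "\<forall>i\<in>set [0..<?n]. distinct (A ! i) \<and> (\<forall>j\<in>set (A ! i). j < ?n \<and> j \<noteq> i \<and> i \<in> set (A ! j))"
    using K by (elim conjE)
  have k2: "\<forall>i\<in>set P. i < ?n \<and> (\<forall>j\<in>set P. i = j \<or> j \<in> set (A ! i) \<or> haspath A 7 4 [i] j \<or>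
        (deg3_triangles \<and> (\<exists>k\<in>set [0..<?n]. k \<notin> set P \<and> length (A ! k) = 2 \<and> i \<in> set (A ! k) \<and> j \<in> set (A ! k))))"
    using K by (elim conjE)
  have k3: "\<forall>i\<in>set P. \<forall>j\<in>set P. i = j \<or> near A i j \<or> haspath A 6 3 [i] j" using K by (elim conjE)
  have k5: "\<forall>(u, v)\<in>set (later_edges \<sigma> L). near A u v" using K by (elim conjE)
  have k6: "\<forall>i\<in>set [0..<?n]. \<forall>v\<in>set (A ! i @ concat (map (\<lambda>k. A ! k) (A ! i))). 
        v = i \<or> (i, v) \<in> set (later_edges \<sigma> L) \<or> (v, i) \<in> set (later_edges \<sigma> L)" using K by (elim conjE)
  have c7: "\<forall>(i, k)\<in>set (zip \<sigma> t). k + (if i \<in> set P then 3 else 0) + length (filter (\<lambda>j. j \<in> set P) (A ! i)) \<le> 5"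
    using K by (elim conjE)
  have c4: "distinct \<sigma>" "length \<sigma> = ?n" "\<forall>i\<in>set \<sigma>. i < ?n" "length t = ?n" "length L = ?n" "offs_ok L"
    using K by - ((elim conjE, assumption)+)
  have c8: "peel [] 0 t L \<noteq> 0" using K by (elim conjE)
  have c1: "distinct (A ! i)" "\<And>j. j \<in> set (A ! i) \<Longrightarrow> j < ?n \<and> j \<noteq> i \<and> i \<in> set (A ! j)" if "i < ?n" for i
  proof -
    have "i \<in> set [0..<?n]" using that by simp
    from bspec[OF k1 this] show "distinct (A ! i)" "\<And>j. j \<in> set (A ! i) \<Longrightarrow> j < ?n \<and> j \<noteq> i \<and> i \<in> set (A ! j)" by blast+
  qed
  have c2: "i = j \<or> j \<in> set (A ! i) \<or> haspath A 7 4 [i] j \<or>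
        (deg3_triangles \<and> (\<exists>k\<in>set [0..<?n]. k \<notin> set P \<and> length (A ! k) = 2 \<and> i \<in> set (A ! k) \<and> j \<in> set (A ! k)))"
    if "i \<in> set P" "j \<in> set P" for i j
    using k2 that by blast
  have c3: "i = j \<or> near A i j \<or> haspath A 6 3 [i] j" if "i \<in> set P" "j \<in> set P" for i j
    using k3 that by blast
  have c5: "(u, v) \<in> set (later_edges \<sigma> L) \<Longrightarrow> near A u v" for u v using k5 by blast
  have c6: "(i, v) \<in> set (later_edges \<sigma> L) \<or> (v, i) \<in> set (later_edges \<sigma> L)" if "near A i v" "i < ?n" for i v
  proof -
    have "v \<in> set (A ! i @ concat (map (\<lambda>k. A ! k) (A ! i)))" "v \<noteq> i" using that(1) by (auto simp: near_def)
    moreover have "i \<in> set [0..<?n]" using that(2) by simp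
    ultimately show ?thesis using k6 by blast
  qed
  have inS: "vs ! i \<in> ?S" if "i < ?n" for i using that vs by auto
  have idx: "\<exists>i<?n. w = vs ! i" if "w \<in> ?S" for w using that vs(2) by (metis in_set_conv_nth)
  have inj: "vs ! i = vs ! j \<longleftrightarrow> i = j" if "i < ?n" "j < ?n" for i j using that vs by (simp add: nth_eq_iff_index_eq)
  have sym: "(u, v) \<in> E \<longleftrightarrow> (v, u) \<in> E" for u v using symE by blast
  \<comment> \<open>the neighbours that the configuration prescribes; a port may have one more\<close>
  define N where "N i = (!) vs ` set (A ! i)" for i
  have NE: "N i \<subseteq> nbrs E (vs ! i)" if "i < ?n" for i using emb[OF that] by (auto simp: N_def nbrs_def)
  have cardN: "card (N i) = length (A ! i)" if "i < ?n" for i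
  proof -
    have "inj_on ((!) vs) (set (A ! i))" using inj c1(2)[OF that] by (auto simp: inj_on_def)
    then show ?thesis using c1(1)[OF that] by (simp add: N_def card_image distinct_card)
  qed
  have nonport: "nbrs E (vs ! i) = N i" if "i < ?n" "i \<notin> set P" for i
    using card_seteq[OF fin_nbrs NE[OF that(1)]] dg[OF that(1)] cardN[OF that(1)] that(2) by auto
  have port: "card (nbrs E (vs ! i) - N i) \<le> (if i \<in> set P then 1 else 0)" if "i < ?n" for i
  proof -
    have "card (nbrs E (vs ! i) - N i) = card (nbrs E (vs ! i)) - card (N i)"
      using NE[OF that] by (intro card_Diff_subset) (auto simp: N_def)
    then show ?thesis using dg[OF that] cardN[OF that] by auto
  qed
  have PE: "pedges (map ((!) vs) q) \<subseteq> uedges E" if q: "pedges q \<subseteq> medges A" for q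
  proof
    fix g assume "g \<in> pedges (map ((!) vs) q)"
    then obtain h where h: "h \<in> pedges q" "g = (!) vs ` h" unfolding pedges_map by auto
    then obtain a b where "h = {a, b}" "a < ?n" "b \<in> set (A ! a)" using q by blast
    then show "g \<in> uedges E" using emb[of a b] h(2) by (auto simp: uedge_iff)
  qed
  have dm: "distinct (map ((!) vs) q)" if "distinct q" "set q \<subseteq> {..<?n}" for q
    using that inj by (auto simp: distinct_map inj_on_def subset_iff)
  have Ab: "\<forall>i<length A. \<forall>j\<in>set (A ! i). j < length A" using c1(2) by blast
  have mpath: "\<exists>q. q \<noteq> [] \<and> hd q = j \<and> last q = i \<and> distinct q \<and> lo \<le> length q \<and> length q \<le> Suc f \<and>
     pedges q \<subseteq> medges A \<and> set q \<subseteq> {..<?n}" if "haspath A f lo [i] j" "i < ?n" for i j f lo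
    using haspath_sound[OF Ab that(1)] that(2) by auto
  have adj: "j \<in> set (A ! i)" if ij: "i < ?n" "j < ?n" "(vs ! i, vs ! j) \<in> E" for i j
  proof (rule ccontr)
    assume no: "j \<notin> set (A ! i)"
    have no': "i \<notin> set (A ! j)" using no c1(2)[OF ij(2)] by auto
    have notN: "vs ! b \<notin> N a" if "b \<notin> set (A ! a)" "a < ?n" "b < ?n" for a b
      using that inj c1(2)[OF that(2)] by (auto simp: N_def)
    have iP: "i \<in> set P" using nonport[OF ij(1)] ij(3) notN[OF no ij(1,2)] by (auto simp: nbrs_def)
    have jP: "j \<in> set P" using nonport[OF ij(2)] ij(3) sym notN[OF no' ij(2,1)] by (auto simp: nbrs_def)
    have "i \<noteq> j" using ij(3) irrE by auto
    with c2[OF iP jP] no consider "haspath A 7 4 [i] j"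
      | k where "deg3_triangles" "k < ?n" "k \<notin> set P" "length (A ! k) = 2" "i \<in> set (A ! k)" "j \<in> set (A ! k)" by auto
    then show False
    proof cases
      case 1
      from mpath[OF 1 ij(1)] obtain q where q: "q \<noteq> []" "hd q = j" "last q = i" "distinct q" "4 \<le> length q" "length q \<le> 8"
        "pedges q \<subseteq> medges A" "set q \<subseteq> {..<?n}" by auto
      have "cedges (map ((!) vs) q) \<subseteq> uedges E" unfolding cedges_def
        using PE[OF q(7)] q(1-3) ij(3) by (simp add: last_map hd_map uedge_iff)
      then show False using no_cycle[OF dm[OF q(4,8)]] q(5,6) by simp
    next
      case 2
      have "(vs ! k, vs ! i) \<in> E" "(vs ! k, vs ! j) \<in> E" using emb 2 by auto
      then have "card (nbrs E (vs ! k)) > 2" using notri[OF 2(1)] ij(3) by blast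
      then show False using dg[OF 2(2)] 2 by simp
    qed
  qed
  define Out where "Out i = nbrs E (vs ! i) - ?S" for i
  have nbsplit: "nbrs E (vs ! i) - N i = Out i" if "i < ?n" for i
  proof -
    have "N i \<subseteq> ?S" using c1(2)[OF that] inS by (auto simp: N_def)
    moreover have "w \<in> N i" if w: "w \<in> nbrs E (vs ! i)" "w \<in> ?S" for w
    proof -
      obtain j where "j < ?n" "w = vs ! j" using idx[OF w(2)] by auto
      then show ?thesis using adj[OF \<open>i < ?n\<close>] w(1) by (auto simp: nbrs_def N_def)
    qed
    ultimately show ?thesis by (auto simp: Out_def)
  qed
  have cOut: "card (Out i) \<le> (if i \<in> set P then 1 else 0)" if "i < ?n" for i using port[OF that] nbsplit[OF that] by simp
  have finOut: "finite (Out i)" for i using fin_nbrs by (simp add: Out_def)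
  have OutP: "i \<in> set P" if "i < ?n" "w \<in> Out i" for i w
  proof (rule ccontr)
    assume "i \<notin> set P"
    then have "card (Out i) = 0" using cOut[OF that(1)] by simp
    then show False using finOut that(2) by auto
  qed
  have common: "i = j \<or> near A i j" if ij: "i < ?n" "j < ?n" "w \<in> Out i" "w \<in> Out j" for i j w
  proof (rule ccontr)
    assume n: "\<not> (i = j \<or> near A i j)"
    then have "haspath A 6 3 [i] j" using c3 OutP ij by blast
    from mpath[OF this ij(1)] obtain q where q: "q \<noteq> []" "hd q = j" "last q = i" "distinct q" "3 \<le> length q" "length q \<le> 7"
        "pedges q \<subseteq> medges A" "set q \<subseteq> {..<?n}" by auto
    obtain h q' where hq: "q = h # q'" using q(1) by (cases q) auto
    have w: "w \<notin> ?S" "(vs ! i, w) \<in> E" "(w, vs ! j) \<in> E" using ij sym by (auto simp: Out_def nbrs_def)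
    have "set (map ((!) vs) q) \<subseteq> ?S" using q(8) inS by auto
    then have d: "distinct (w # map ((!) vs) q)" using dm[OF q(4,8)] w(1) by auto
    have "cedges (w # map ((!) vs) q) \<subseteq> uedges E" unfolding cedges_def
      using PE[OF q(7)] q(1-3) w hq by (auto simp: last_map uedge_iff)
    then show False using no_cycle[OF d] q(5,6) by simp
  qed
  have sqM: "(vs ! i, vs ! j) \<in> sq E \<longleftrightarrow> near A i j" if ij: "i < ?n" "j < ?n" for i j
  proof
    assume s: "(vs ! i, vs ! j) \<in> sq E"
    then have ne: "i \<noteq> j" by (auto simp: sq_def)
    from s consider "(vs ! i, vs ! j) \<in> E" | w where "(vs ! i, w) \<in> E" "(w, vs ! j) \<in> E" by (auto simp: sq_def)
    then show "near A i j"
    proof cases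
      case 1 then show ?thesis using adj[OF ij] ne by (auto simp: near_def)
    next
      case 2
      show ?thesis
      proof (cases "w \<in> ?S")
        case True
        then obtain k where k: "k < ?n" "w = vs ! k" using idx by auto
        then show ?thesis using adj[OF ij(1) k(1)] adj[OF k(1) ij(2)] 2 ne by (auto simp: near_def)
      next
        case False
        then have "w \<in> Out i" "w \<in> Out j" using 2 sym by (auto simp: Out_def nbrs_def)
        then show ?thesis using common[OF ij] ne by auto
      qed
    qed
  next
    assume m: "near A i j"
    then have "vs ! i \<noteq> vs ! j" using inj[OF ij] by (auto simp: near_def)
    moreover from m consider "j \<in> set (A ! i)" | k where "k \<in> set (A ! i)" "j \<in> set (A ! k)" by (auto simp: near_def)
    then have "(vs ! i, vs ! j) \<in> E \<or> (\<exists>w. (vs ! i, w) \<in> E \<and> (w, vs ! j) \<in> E)"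
      using emb[OF ij(1)] c1(2)[OF ij(1)] emb by cases blast+
    ultimately show "(vs ! i, vs ! j) \<in> sq E" by (auto simp: sq_def)
  qed
  have lv: "u < ?n \<and> v < ?n" if "(u, v) \<in> set (later_edges \<sigma> L)" for u v using later_edges_verts[OF that] c4 by auto
  define es where "es = map (map_prod ((!) vs) ((!) vs)) (later_edges \<sigma> L)"
  have memes: "(x, y) \<in> set es \<longleftrightarrow> (\<exists>u v. (u, v) \<in> set (later_edges \<sigma> L) \<and> x = vs ! u \<and> y = vs ! v)" for x y
    unfolding es_def by force
  have lo: "distinct (later_edges \<sigma> L)" "\<And>u v. (u, v) \<in> set (later_edges \<sigma> L) \<Longrightarrow> (v, u) \<notin> set (later_edges \<sigma> L)"
    using later_edges_orient[of \<sigma> L] c4 by auto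
  have or: "orients es (sq E \<inter> ?S \<times> ?S)"
    unfolding orients_def
  proof (intro conjI ballI)
    have "inj_on (map_prod ((!) vs) ((!) vs)) (set (later_edges \<sigma> L))"
      using lv inj by (fastforce simp: inj_on_def)
    then show "distinct es" unfolding es_def using lo(1) by (simp add: distinct_map)
  next
    fix p assume p: "p \<in> set es"
    obtain x y where xy: "p = (x, y)" by (cases p)
    obtain u v where uv: "(u, v) \<in> set (later_edges \<sigma> L)" "x = vs ! u" "y = vs ! v" using p xy memes by auto
    have lt: "u < ?n" "v < ?n" using lv[OF uv(1)] by auto
    have "(y, x) \<notin> set es"
    proof
      assume "(y, x) \<in> set es"
      then obtain v' u' where v': "(v', u') \<in> set (later_edges \<sigma> L)" "y = vs ! v'" "x = vs ! u'" using memes by auto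
      then have "v' = v" "u' = u" using lv[OF v'(1)] lt inj uv by auto
      then show False using v' lo(2) uv by auto
    qed
    moreover have "(x, y) \<in> sq E" using sqM[OF lt] c5[OF uv(1)] uv by simp
    ultimately show "case p of (u, v) \<Rightarrow> (u, v) \<in> sq E \<inter> ?S \<times> ?S \<and> (v, u) \<notin> set es"
      using xy uv lt inS by auto
  next
    fix p assume p: "p \<in> sq E \<inter> ?S \<times> ?S"
    obtain x y where xy: "p = (x, y)" by (cases p)
    obtain i j where ij: "i < ?n" "j < ?n" "x = vs ! i" "y = vs ! j" using p xy idx by blast
    then have "near A i j" using sqM p xy by auto
    then show "case p of (u, v) \<Rightarrow> (u, v) \<in> set es \<or> (v, u) \<in> set es"
    proof -
      have "(i, j) \<in> set (later_edges \<sigma> L) \<or> (j, i) \<in> set (later_edges \<sigma> L)" using c6[OF \<open>near A i j\<close> ij(1)] .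
      then have "(x, y) \<in> set es \<or> (y, x) \<in> set es" using memes ij(3,4) by blast
      then show ?thesis using xy by simp
    qed
  qed
  define T where "T = exponent \<sigma> t"
  define b where "b w = (if w \<in> ?S then T (the_inv_into {..<?n} ((!) vs) w) else 0)" for w
  have injn: "inj_on ((!) vs) {..<?n}" using inj by (auto simp: inj_on_def)
  have bT: "b (vs ! i) = T i" if "i < ?n" for i
    using the_inv_into_f_f[OF injn] that inS by (simp add: b_def)
  have im: "(!) vs ` {..<?n} = ?S" using inS idx by auto
  have "coef es b = coef (later_edges \<sigma> L) (\<lambda>i. if i \<in> {..<?n} then b (vs ! i) else 0)"
    unfolding es_def by (rule coef_map[OF injn]) (use lv im in \<open>auto simp: b_def\<close>)
  also have "(\<lambda>i. if i \<in> {..<?n} then b (vs ! i) else 0) = T"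
  proof
    fix i show "(if i \<in> {..<?n} then b (vs ! i) else 0) = T i"
      using bT c4(3) exponent_notin[of i \<sigma> t] by (auto simp: T_def)
  qed
  also have "coef (later_edges \<sigma> L) T \<noteq> 0"
  proof -
    have nn: "?n \<notin> set \<sigma>" using c4(3) by auto
    have "peel [] 0 t L = coef (later_edges \<sigma> L) (exponent (?n # \<sigma>) (0 # t))"
      using peel_coef[of ?n \<sigma> t L "[]" 0] c4 nn by simp
    moreover have "exponent (?n # \<sigma>) (0 # t) = T" using exponent_notin[OF nn, of t] by (auto simp: exponent_Cons T_def fun_eq_iff)
    ultimately show ?thesis using c8 by simp
  qed
  finally have "coef es b \<noteq> 0" .
  then have AT: "AT_on (sq E \<inter> ?S \<times> ?S) b" unfolding AT_on_def using or by blast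
  have bound: "b w + card {a \<in> V - ?S. (a, w) \<in> sq E} \<le> 5" if wS: "w \<in> ?S" for w
  proof -
    obtain i where i: "i < ?n" "w = vs ! i" using idx[OF wS] by auto
    let ?X = "Out i \<union> (\<Union>o'\<in>Out i. nbrs E o' - {w}) \<union> (\<Union>j\<in>set (A ! i). Out j)"
    have sub: "{a \<in> V - ?S. (a, w) \<in> sq E} \<subseteq> ?X"
    proof
      fix a assume "a \<in> {a \<in> V - ?S. (a, w) \<in> sq E}"
      then have a: "a \<notin> ?S" "a \<noteq> w" "(a, w) \<in> E \<or> (\<exists>z. (a, z) \<in> E \<and> (z, w) \<in> E)" by (auto simp: sq_def)
      from a(3) show "a \<in> ?X"
      proof
        assume "(a, w) \<in> E" then show ?thesis using a i sym by (auto simp: Out_def nbrs_def)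
      next
        assume "\<exists>z. (a, z) \<in> E \<and> (z, w) \<in> E"
        then obtain z where z: "(w, z) \<in> E" "(z, a) \<in> E" using sym by blast
        show ?thesis
        proof (cases "z \<in> ?S")
          case True
          then obtain j where j: "j < ?n" "z = vs ! j" using idx by auto
          then have "j \<in> set (A ! i)" using adj[OF i(1)] z i by auto
          moreover have "a \<in> Out j" using z a j by (auto simp: Out_def nbrs_def)
          ultimately show ?thesis by blast
        next
          case False
          then have "z \<in> Out i" using z i by (auto simp: Out_def nbrs_def)
          moreover have "a \<in> nbrs E z - {w}" using z a by (auto simp: nbrs_def)
          ultimately show ?thesis by blast
        qed
      qed
    qed
    have 1: "card (\<Union>o'\<in>Out i. nbrs E o' - {w}) \<le> 2 * card (Out i)"
    proof -
      have "card (\<Union>o'\<in>Out i. nbrs E o' - {w}) \<le> (\<Sum>o'\<in>Out i. card (nbrs E o' - {w}))" by (rule card_UN_le[OF finOut])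
      also have "\<dots> \<le> (\<Sum>o'\<in>Out i. 2)"
      proof (rule sum_mono)
        fix z assume "z \<in> Out i"
        then have "w \<in> nbrs E z" using i sym by (auto simp: Out_def nbrs_def)
        then have "card (nbrs E z - {w}) = card (nbrs E z) - 1" by (simp add: fin_nbrs)
        then show "card (nbrs E z - {w}) \<le> 2" using deg3[of z] by simp
      qed
      finally show ?thesis by simp
    qed
    have 2: "card (\<Union>j\<in>set (A ! i). Out j) \<le> length (filter (\<lambda>j. j \<in> set P) (A ! i))"
    proof -
      have "card (\<Union>j\<in>set (A ! i). Out j) \<le> (\<Sum>j\<in>set (A ! i). card (Out j))" by (rule card_UN_le) auto
      also have "\<dots> \<le> (\<Sum>j\<in>set (A ! i). if j \<in> set P then 1 else 0)"
        using cOut c1(2)[OF i(1)] by (intro sum_mono) auto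
      also have "\<dots> = card {j \<in> set (A ! i). j \<in> set P}" by (simp add: sum.If_cases Int_def)
      also have "\<dots> = length (filter (\<lambda>j. j \<in> set P) (A ! i))"
        using c1(1)[OF i(1)] by (metis distinct_card distinct_filter set_filter)
      finally show ?thesis .
    qed
    have "card {a \<in> V - ?S. (a, w) \<in> sq E} \<le> card ?X"
      by (rule card_mono[OF _ sub]) (use finOut fin_nbrs in auto)
    also have "\<dots> \<le> card (Out i) + card (\<Union>o'\<in>Out i. nbrs E o' - {w}) + card (\<Union>j\<in>set (A ! i). Out j)"
      by (meson add_mono card_Un_le le_refl le_trans)
    also have "\<dots> \<le> (if i \<in> set P then 3 else 0) + length (filter (\<lambda>j. j \<in> set P) (A ! i))"
      using 1 2 cOut[OF i(1)] by (auto split: if_splits)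
    finally have out: "card {a \<in> V - ?S. (a, w) \<in> sq E} \<le> (if i \<in> set P then 3 else 0) + length (filter (\<lambda>j. j \<in> set P) (A ! i))" .
    have "set \<sigma> = {..<?n}"
      using c4(1-3) by (intro card_subset_eq) (auto simp: distinct_card)
    then obtain m where m: "m < ?n" "\<sigma> ! m = i" using i(1) c4(2) by (metis in_set_conv_nth lessThan_iff)
    have "b w = t ! m" using bT[OF i(1)] i(2) exponent_nth[of \<sigma> m t] c4 m by (simp add: T_def)
    moreover have "(i, t ! m) \<in> set (zip \<sigma> t)" using m c4 by (auto simp: set_zip intro!: exI[of _ m])
    ultimately show ?thesis using c7 out by fastforce
  qed
  have "sq E \<inter> (V - ?S) \<times> (V - ?S) = sq (E \<inter> (V - ?S) \<times> (V - ?S))"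
  proof -
    have "(x, z) \<in> E \<Longrightarrow> (z, y) \<in> E \<Longrightarrow> x \<notin> ?S \<Longrightarrow> y \<notin> ?S \<Longrightarrow> x \<noteq> y \<Longrightarrow> z \<notin> ?S" for x y z
    proof
      assume a: "(x, z) \<in> E" "(z, y) \<in> E" "x \<notin> ?S" "y \<notin> ?S" "x \<noteq> y" "z \<in> ?S"
      then obtain i where i: "i < ?n" "z = vs ! i" using idx by auto
      then have "{x, y} \<subseteq> Out i" using a sym by (auto simp: Out_def nbrs_def)
      then have "card {x, y} \<le> card (Out i)" using finOut by (intro card_mono) auto
      then show False using cOut[OF i(1)] a(5) by (auto split: if_splits)
    qed
    then show ?thesis using EV unfolding sq_def by auto
  qed
  then show ?thesis unfolding reducible_def using AT bound vs(3,4)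
    by (intro exI[of _ ?S] exI[of _ b]) auto
qed

end

section \<open>Items and rings\<close>

context sparse_subcubic
begin

lemma list_config_reducible:
  assumes chk: "config_ok deg3_triangles A P \<sigma> t L"
    and notri: "deg3_triangles \<Longrightarrow> \<forall>a b c. (a, b) \<in> E \<longrightarrow> (b, c) \<in> E \<longrightarrow> (a, c) \<in> E \<longrightarrow> card (nbrs E a) > 2"
    and vs: "distinct vs" "set vs \<subseteq> V" "vs \<noteq> []"
    and emb: "list_all2 (\<lambda>v js. \<forall>j\<in>set js. (v, vs ! j) \<in> E) vs A"
    and dg: "list_all2 (\<lambda>(i, v) js. card (nbrs E v) \<le> length js + (if i \<in> set P then 1 else 0)) (List.enumerate 0 vs) A"
  shows "reducible V E"
proof (rule config_reducible[OF chk notri vs(1) _ vs(2,3)])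
  show "length vs = length A" using emb by (rule list_all2_lengthD)
  show "(vs ! i, vs ! j) \<in> E" if "i < length A" "j \<in> set (A ! i)" for i j
    using list_all2_nthD2[OF emb that(1)] that(2) by blast
  show "card (nbrs E (vs ! i)) \<le> length (A ! i) + (if i \<in> set P then 1 else 0)" if "i < length A" for i
    using list_all2_nthD2[OF dg that] that list_all2_lengthD[OF emb] by (simp add: nth_enumerate_eq)
qed

lemma nbrs_3: 
  assumes "(v, a) \<in> E" "(v, b) \<in> E" "(v, c) \<in> E" "a \<noteq> b" "a \<noteq> c" "b \<noteq> c" "(v, d) \<in> E" 
  shows "d = a \<or> d = b \<or> d = c"
proof (rule ccontr)
  assume "\<not> (d = a \<or> d = b \<or> d = c)"
  then have "{a, b, c, d} \<subseteq> nbrs E v" "card {a, b, c, d} = 4" using assms by (auto simp: nbrs_def)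
  then have "4 \<le> card (nbrs E v)" using card_mono[OF fin_nbrs] by metis
  then show False using deg3[of v] by simp
qed

text \<open>
  The triangle through \<open>v\<close> or, if there is none, just \<open>v\<close>.
\<close>

definition item :: "'a \<Rightarrow> 'a set" where
  "item v = {w. w = v \<or> ((v, w) \<in> E \<and> (\<exists>z. (v, z) \<in> E \<and> (w, z) \<in> E))}"

definition tri :: "'a \<Rightarrow> bool" where
  "tri v \<longleftrightarrow> (\<exists>a b. (v, a) \<in> E \<and> (v, b) \<in> E \<and> (a, b) \<in> E)"

lemma adj_neq: "(a, b) \<in> E \<Longrightarrow> a \<noteq> b" using irrE by auto

text \<open>
  A second triangle at \<open>v\<close> would share an edge with the first, as \<open>v\<close> has degree at most 3, and two
  triangles with a common edge contain a 4-cycle.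
\<close>

lemma item_tri:
  assumes "(v, a) \<in> E" "(v, b) \<in> E" "(a, b) \<in> E" shows "item v = {v, a, b}"
proof
  show "{v, a, b} \<subseteq> item v" using assms symE by (auto simp: item_def)
  show "item v \<subseteq> {v, a, b}"
  proof (rule ccontr)
    assume "\<not> item v \<subseteq> {v, a, b}"
    then obtain w z where w: "w \<notin> {v, a, b}" "(v, w) \<in> E" "(v, z) \<in> E" "(w, z) \<in> E" by (auto simp: item_def)
    have ne: "v \<noteq> a" "v \<noteq> b" "a \<noteq> b" "v \<noteq> w" "v \<noteq> z" "w \<noteq> z" using assms w adj_neq by auto
    have "z = a \<or> z = b \<or> z = w" using nbrs_3[OF assms(1,2) w(2) ne(3) _ _ w(3)] w(1) by auto
    then have z: "z = a \<or> z = b" using ne by auto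
    define y where "y = (if z = a then b else a)"
    have y: "(z, y) \<in> E" "(y, v) \<in> E" "y \<noteq> z" "y \<noteq> v" "y \<noteq> w" using z assms symE ne w(1) by (auto simp: y_def)
    have "cedges [w, z, y, v] \<subseteq> uedges E" using y w symE by (auto simp: cedges_def uedge_iff)
    moreover have "distinct [w, z, y, v]" using y ne by auto
    ultimately show False using no_cycle[of "[w, z, y, v]"] by simp
  qed
qed

lemma item_nontri: "\<not> tri v \<Longrightarrow> item v = {v}"
  unfolding item_def tri_def using symE by blast

lemma item_self: "v \<in> item v" by (simp add: item_def)

lemma item_cases:
  obtains "item v = {v}" "\<not> tri v" | a b where "(v, a) \<in> E" "(v, b) \<in> E" "(a, b) \<in> E" "item v = {v, a, b}" "tri v"
proof (cases "tri v")
  case True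
  then obtain a b where "(v, a) \<in> E" "(v, b) \<in> E" "(a, b) \<in> E" by (auto simp: tri_def)
  then show ?thesis using that item_tri True by metis
next
  case False
  then show ?thesis using that item_nontri by metis
qed

lemma item_eq: "w \<in> item v \<Longrightarrow> item w = item v"
proof (cases v rule: item_cases)
  case (2 a b)
  assume "w \<in> item v"
  then consider "w = v" | "w = a" | "w = b" using 2 by auto
  then show ?thesis
  proof cases
    case w: 2
    have "item a = {a, v, b}" using 2 symE by (intro item_tri) auto
    then show ?thesis using w 2 by auto
  next
    case w: 3
    have "item b = {b, v, a}" using 2 symE by (intro item_tri) auto
    then show ?thesis using w 2 by auto
  qed simp
qed auto

lemma item_sym: "w \<in> item v \<longleftrightarrow> v \<in> item w"
  using item_eq item_self by blast

lemma item_adj: "w \<in> item v \<Longrightarrow> w \<noteq> v \<Longrightarrow> (v, w) \<in> E" by (auto simp: item_def)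

end

text \<open>
  What a cycle runs through: a vertex of degree 2 (\<open>M\<close>), a vertex of degree 3 outside triangles (\<open>X\<close>), or
  an edge \<open>v w\<close> of a triangle with third vertex \<open>t\<close> (\<open>T v w t\<close>).
\<close>

datatype 'a ring_item = M 'a | X 'a | T 'a 'a 'a

datatype kind = KM | KX | KT

fun kind_of :: "'a ring_item \<Rightarrow> kind" where
  "kind_of (M a) = KM" | "kind_of (X a) = KX" | "kind_of (T v w t) = KT"

fun on_ring :: "'a ring_item \<Rightarrow> 'a list" where
  "on_ring (M a) = [a]" | "on_ring (X a) = [a]" | "on_ring (T v w t) = [v, w]"

fun members :: "'a ring_item \<Rightarrow> 'a list" where
  "members (M a) = [a]" | "members (X a) = [a]" | "members (T v w t) = [v, w, t]"

fun entry_vertex :: "'a ring_item \<Rightarrow> 'a" where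
  "entry_vertex (M a) = a" | "entry_vertex (X a) = a" | "entry_vertex (T v w t) = v"

fun exit_vertex :: "'a ring_item \<Rightarrow> 'a" where
  "exit_vertex (M a) = a" | "exit_vertex (X a) = a" | "exit_vertex (T v w t) = w"

fun flip :: "'a ring_item \<Rightarrow> 'a ring_item" where
  "flip (M a) = M a" | "flip (X a) = X a" | "flip (T v w t) = T w v t"

locale irreducible_graph = sparse_subcubic +
  assumes irreducible: "\<not> reducible V E"
begin

lemma deg_ge_2: assumes "v \<in> V" shows "card (nbrs E v) \<ge> 2"
proof (rule ccontr)
  assume "\<not> ?thesis"
  then have "card (nbrs E v) \<le> 1" by simp
  moreover have "config_ok False [[]] [0] [0] [0] [[]]" by code_simp
  ultimately have "reducible V E"
    using list_config_reducible[of False "[[]]" "[0]" "[0]" "[0]" "[[]]" "[v]"] assms by simp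
  then show False using irreducible by simp
qed

lemma in_V: "(u, v) \<in> E \<Longrightarrow> u \<in> V \<and> v \<in> V" using EV by auto

text \<open>
  Two adjacent vertices of degree 2 form a configuration in which both vertices are ports.
\<close>

lemma no_adjacent_2: assumes "(u, v) \<in> E" shows "card (nbrs E u) = 3 \<or> card (nbrs E v) = 3"
proof (rule ccontr)
  assume "\<not> ?thesis"
  then have "card (nbrs E u) \<le> 2" "card (nbrs E v) \<le> 2" using deg3[of u] deg3[of v] by auto
  moreover have "config_ok False [[1], [0]] [0, 1] [0, 1] [1, 0] [[0], []]" by code_simp
  ultimately have "reducible V E"
    using list_config_reducible[of False "[[1],[0]]" "[0,1]" "[0,1]" "[1,0]" "[[0],[]]" "[u,v]"] assms in_V symE adj_neq
    by simp
  then show False using irreducible by simp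
qed

lemma triangle_deg_3: assumes "(a, b) \<in> E" "(b, c) \<in> E" "(a, c) \<in> E" shows "card (nbrs E a) = 3"
proof (rule ccontr)
  assume "card (nbrs E a) \<noteq> 3"
  then have "card (nbrs E a) \<le> 2" using deg3[of a] by simp
  moreover have "config_ok False [[1, 2], [0, 2], [0, 1]] [1, 2] [0, 1, 2] [2, 1, 0] [[0, 1], [0], []]" by code_simp
  ultimately have "reducible V E"
    using list_config_reducible[of False "[[1,2],[0,2],[0,1]]" "[1,2]" "[0,1,2]" "[2,1,0]" "[[0,1],[0],[]]" "[a,b,c]"] 
      assms in_V[OF assms(1)] in_V[OF assms(2)] assms[THEN symE] assms[THEN adj_neq] deg3[of b] deg3[of c]
    by (simp add: eval_nat_numeral)
  then show False using irreducible by simp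
qed

lemma tri_deg_3: "tri v \<Longrightarrow> card (nbrs E v) = 3"
  unfolding tri_def using triangle_deg_3 by blast

fun ok :: "'a ring_item \<Rightarrow> bool" where
  "ok (M a) \<longleftrightarrow> a \<in> V \<and> card (nbrs E a) = 2"
| "ok (X a) \<longleftrightarrow> a \<in> V \<and> card (nbrs E a) = 3 \<and> \<not> tri a"
| "ok (T v w t) \<longleftrightarrow> (v, w) \<in> E \<and> (v, t) \<in> E \<and> (w, t) \<in> E"

abbreviation link :: "'a ring_item \<Rightarrow> 'a ring_item \<Rightarrow> bool" where
  "link I J \<equiv> (exit_vertex I, entry_vertex J) \<in> E"

definition ring :: "'a ring_item list \<Rightarrow> bool" where
  "ring its \<longleftrightarrow> its \<noteq> [] \<and> (\<forall>I\<in>set its. ok I) \<and> successively link its \<and> link (last its) (hd its) \<and>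
     distinct (concat (map members its))"

lemma ring_rotate1: assumes "ring its" shows "ring (rotate1 its)"
proof -
  obtain I js where its: "its = I # js" using assms by (cases its) (auto simp: ring_def)
  show ?thesis
  proof (cases js)
    case Nil then show ?thesis using assms its by simp
  next
    case (Cons J ks)
    have "successively link ((J # ks) @ [I])"
      using assms unfolding its ring_def Cons successively_append_iff by auto
    then show ?thesis using assms unfolding its ring_def Cons by auto
  qed
qed

lemma ring_rotate: "ring its \<Longrightarrow> ring (rotate n its)"
  by (induction n) (auto simp: ring_rotate1)

lemma ok_flip: "ok I \<Longrightarrow> ok (flip I)"
  using symE by (cases I) auto

lemma members_flip: "set (members (flip I)) = set (members I)" "distinct (members (flip I)) = distinct (members I)"
  by (cases I; auto)+

lemma ends_flip: "entry_vertex (flip I) = exit_vertex I" "exit_vertex (flip I) = entry_vertex I" by (cases I; auto)+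

lemma ring_rev: assumes "ring its" shows "ring (rev (map flip its))"
proof -
  have ne: "its \<noteq> []" using assms by (auto simp: ring_def)
  have 1: "successively link (rev (map flip its))"
    using assms symE unfolding ring_def by (auto simp: successively_rev successively_map ends_flip elim!: successively_mono)
  have 2: "link (last (rev (map flip its))) (hd (rev (map flip its)))"
    using assms symE ne unfolding ring_def by (auto simp: last_rev hd_rev last_map hd_map ends_flip)
  have "distinct (concat (map members its)) \<Longrightarrow> distinct (concat (map members (rev (map flip its))))"
    by (induction its) (auto simp: members_flip)
  then show ?thesis using 1 2 assms ok_flip unfolding ring_def by auto
qed

lemma members_item: "ok I \<Longrightarrow> set (members I) = item (entry_vertex I)"
proof (cases I)
  case (M a)
  assume "ok I"
  then have "\<not> tri a" using M tri_deg_3[of a] by auto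
  then show ?thesis using M item_nontri by simp
next
  case (X a)
  assume "ok I"
  then show ?thesis using X item_nontri by simp
next
  case (T v w t)
  assume "ok I"
  then show ?thesis using T item_tri[of v w t] by simp
qed

lemma distinct_members: "ok I \<Longrightarrow> distinct (members I)"
  using adj_neq by (cases I) auto

text \<open>
  Different items of a cycle are disjoint even with the third vertices of their triangles: a triangle
  has only three vertices and so cannot contribute two edges without a common end.
\<close>

lemma ring_members_distinct:
  "\<forall>I\<in>set its. ok I \<Longrightarrow> distinct (concat (map on_ring its)) \<Longrightarrow>
     distinct (concat (map members its)) \<and> distinct (map (item \<circ> entry_vertex) its)"
proof (induction its)
  case (Cons I its)
  have oI: "ok I" using Cons by simp
  have key: "item (entry_vertex I) \<noteq> item (entry_vertex J)" if J: "J \<in> set its" for J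
  proof
    assume eq: "item (entry_vertex I) = item (entry_vertex J)"
    have oJ: "ok J" using J Cons by simp
    have dis: "set (on_ring I) \<inter> set (on_ring J) = {}" using Cons(3) J by auto
    have dI: "distinct (on_ring I)" "distinct (on_ring J)" using Cons(3) J by (auto simp: distinct_concat_iff)
    have m: "set (members I) = set (members J)" using members_item[OF oI] members_item[OF oJ] eq by simp
    then have c: "card (set (members I)) = card (set (members J))" by simp
    have lm: "length (members I) = length (members J)" 
      using c distinct_members[OF oI] distinct_members[OF oJ] by (simp add: distinct_card)
    have sub: "set (on_ring K) \<subseteq> set (members K)" for K :: "'a ring_item" by (cases K) auto
    have "card (set (on_ring I) \<union> set (on_ring J)) \<le> card (set (members I))"
      using sub[of I] sub[of J] m by (intro card_mono) auto
    moreover have "card (set (on_ring I) \<union> set (on_ring J)) = length (on_ring I) + length (on_ring J)"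
      using dis dI by (simp add: card_Un_disjoint distinct_card)
    moreover have "card (set (members I)) = length (members I)" using distinct_members[OF oI] by (simp add: distinct_card)
    ultimately have "length (on_ring I) + length (on_ring J) \<le> length (members I)" by simp
    then show False using lm by (cases I; cases J) auto
  qed
  have "set (members I) \<inter> set (members J) = {}" if "J \<in> set its" for J
    using key[OF that] members_item[OF oI] members_item[of J] that Cons(2) item_eq by (metis disjoint_iff list.set_intros(2))
  then show ?case using Cons key distinct_members[OF oI] by auto
qed auto

text \<open>
  Never two consecutive edges of a triangle.
\<close>

fun thin :: "'a list \<Rightarrow> bool" where
  "thin (a # b # c # xs) = (a \<noteq> c \<and> (a, c) \<notin> E \<and> thin (b # c # xs))"
| "thin _ = True"

text \<open>
  Reads the items off a path \<open>ps\<close> that is preceded by \<open>p\<close> and followed by \<open>s\<close>, neither in the item at its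
  end. A triangle vertex \<open>h\<close> reached from outside its triangle must be left within the triangle, since only
  one of its three edges leads out; and thinness forces the next step out of the triangle again.
\<close>

lemma parse:
  "pedges (p # ps @ [s]) \<subseteq> uedges E \<Longrightarrow> thin (p # ps @ [s]) \<Longrightarrow> hd (ps @ [s]) \<notin> item p \<Longrightarrow> s \<notin> item (last (p # ps)) \<Longrightarrow>
   \<exists>its. concat (map on_ring its) = ps \<and> (\<forall>I\<in>set its. ok I) \<and> successively link its"
proof (induction "length ps" arbitrary: p ps rule: less_induct)
  case less
  show ?case
  proof (cases ps)
    case Nil
    then show ?thesis by (intro exI[of _ "[]"]) auto
  next
    case (Cons h rest)
    obtain n rest' where n: "rest @ [s] = n # rest'" by (cases rest) auto
    have ph: "(p, h) \<in> E" "(h, n) \<in> E" using less(2) Cons n by (auto simp: uedge_iff)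
    have pn: "p \<noteq> n" "(p, n) \<notin> E" using less(3) Cons n by auto
    have hV: "h \<in> V" using ph in_V by blast
    have hp: "h \<notin> item p" "p \<notin> item h" using less(4) Cons item_sym by auto
    have step: "\<exists>its. concat (map on_ring its) = ps \<and> (\<forall>I\<in>set its. ok I) \<and> successively link its"
      if I: "ok I" "on_ring I @ qs = ps" "exit_vertex I = last (on_ring I)" "on_ring I \<noteq> []"
        and nx: "hd (qs @ [s]) \<notin> item (exit_vertex I)" for I qs
    proof -
      let ?e = "exit_vertex I"
      obtain pre where pre: "p # ps @ [s] = pre @ ?e # qs @ [s]"
        using I(2,3,4) by (metis append.assoc append_Cons append_butlast_last_id append_Nil)
      have "pedges (p # ps @ [s]) = pedges (pre @ [?e]) \<union> pedges (?e # qs @ [s])" 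
        unfolding pre by (rule pedges_append)
      then have sub: "pedges (?e # qs @ [s]) \<subseteq> uedges E" using less(2) by blast
      have th: "thin (a @ b) \<Longrightarrow> thin b" for a b by (induction a rule: thin.induct) (auto, (cases b rule: thin.cases; auto)+)
      have thn: "thin (?e # qs @ [s])" using less(3) th unfolding pre by blast
      have "(p # ps) @ [s] = (pre @ ?e # qs) @ [s]" using pre by simp
      then have "p # ps = pre @ ?e # qs" by (simp only: append_same_eq)
      then have "last (?e # qs) = last (p # ps)" by simp
      then have le: "s \<notin> item (last (?e # qs))" using less(5) by simp
      have "length qs < length ps" using I(4) unfolding I(2)[symmetric] by simp
      from less(1)[OF this sub thn nx le] obtain its where its: "concat (map on_ring its) = qs" "\<forall>I\<in>set its. ok I" "successively link its"
        by blast
      have "link I (hd its)" if ne: "its \<noteq> []"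
      proof -
        obtain J js where J: "its = J # js" using ne by (cases its) auto
        have "hd (on_ring J) = entry_vertex J" "on_ring J \<noteq> []" by (cases J; auto)+
        then have "\<exists>zs. qs = entry_vertex J # zs" using its(1) J by (cases "on_ring J") auto
        then show ?thesis using sub J by (auto simp: uedge_iff)
      qed
      then show ?thesis using its I by (intro exI[of _ "I # its"]) (cases its; auto)
    qed
    have nsing: "n \<notin> item h" if "item h = {h}" using that ph(2) adj_neq by auto
    have hd_n: "hd (rest @ [s]) = n" using n by simp
    show ?thesis
    proof (cases h rule: item_cases)
      case 1
      have "card (nbrs E h) = 2 \<or> card (nbrs E h) = 3" using deg_ge_2[OF hV] deg3[of h] by auto
      then show ?thesis
      proof
        assume "card (nbrs E h) = 2"
        then show ?thesis using step[of "M h" rest] hV Cons nsing[OF 1(1)] hd_n by simp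
      next
        assume "card (nbrs E h) = 3"
        then show ?thesis using step[of "X h" rest] hV 1(2) Cons nsing[OF 1(1)] hd_n by simp
      qed
    next
      case (2 a b)
      have "n \<in> item h"
      proof (rule ccontr)
        assume no: "n \<notin> item h"
        have "a \<noteq> b" using 2 adj_neq by auto
        then have "p = a \<or> p = b \<or> p = n" using nbrs_3[OF 2(1,2) ph(2), of p] no 2(4) ph symE by auto
        then show False using hp pn 2(4) by auto
      qed
      then have nab: "n = a \<or> n = b" using 2(4) ph adj_neq by auto
      define t where "t = (if n = a then b else a)"
      have T: "(h, n) \<in> E" "(h, t) \<in> E" "(n, t) \<in> E" "item h = {h, n, t}" using nab 2 symE by (auto simp: t_def)
      have "rest \<noteq> []"
      proof
        assume "rest = []"
        then have "n = s" using n by simp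
        then show False using less(5) Cons \<open>rest = []\<close> \<open>n \<in> item h\<close> by simp
      qed
      then obtain qs where qs: "rest = n # qs" using n by (cases rest) auto
      obtain m qs' where m: "qs @ [s] = m # qs'" by (cases qs) auto
      have hm: "h \<noteq> m" "(h, m) \<notin> E" using less(3) Cons qs m by auto
      have nm: "(n, m) \<in> E" using less(2) Cons qs m by (auto simp: uedge_iff)
      have "m \<notin> item n" using hm nm T item_eq[of n h] adj_neq by auto
      then show ?thesis using step[of "T h n t" qs] T Cons qs m by simp
    qed
  qed
qed

end

section \<open>Thirteen reducible words\<close>

text \<open>
  Certificates for words over \<open>m\<close>, \<open>x\<close> and \<open>T\<close>, which stand for the three kinds of items. The vertices are
  numbered along the word, a triangle \<open>T v w t\<close> as \<open>v\<close>, \<open>w\<close>, \<open>t\<close>. The first six words are chains, whose end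
  vertices are ports; the others are closed to rings. In either case the third vertices of
  triangles and the vertices of kind \<open>x\<close> are ports. The monomials and the orders were found by a
  randomised search for small search trees.
\<close>

lemma check_mTm:
  "config_ok True
     [[1], [0, 2, 3], [1, 3, 4], [1, 2], [2]]
     [0, 3, 4] [2, 0, 1, 3, 4] [0, 2, 3, 2, 2]
     [[0, 1, 2, 3], [0, 1], [0, 1], [0], []]"
  by code_simp

lemma check_TTm:
  "config_ok True
     [[1, 2], [0, 2, 3], [0, 1], [1, 4, 5], [3, 5, 6], [3, 4], [4]]
     [0, 2, 5, 6] [2, 0, 1, 3, 4, 5, 6] [0, 1, 3, 3, 3, 2, 2]
     [[0, 1, 2], [0, 1], [0, 1, 2], [0, 1, 2], [0, 1], [0], []]"
  by code_simp

lemma check_mTxm: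
  "config_ok True
     [[1], [0, 2, 3], [1, 3, 4], [1, 2], [2, 5], [4]]
     [0, 3, 4, 5] [5, 4, 3, 2, 1, 0] [1, 1, 1, 3, 3, 2]
     [[0, 2], [0, 1, 2], [0, 1, 2], [0, 1], [0], []]"
  by code_simp

lemma check_Tmxm:
  "config_ok True
     [[1, 2], [0, 2, 3], [0, 1], [1, 4], [3, 5], [4]]
     [0, 2, 4, 5] [2, 0, 1, 3, 4, 5] [0, 1, 3, 4, 1, 1]
     [[0, 1, 2], [0, 1], [0, 1], [0, 1], [0], []]"
  by code_simp

lemma check_mTxTm:
  "config_ok True
     [[1], [0, 2, 3], [1, 3, 4], [1, 2], [2, 5], [4, 6, 7], [5, 7, 8], [5, 6], [6]]
     [0, 3, 4, 7, 8] [8, 7, 6, 5, 4, 3, 2, 1, 0] [2, 2, 3, 1, 2, 1, 3, 3, 2]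
     [[0, 1, 2], [0, 1, 2], [0, 1], [0, 2], [0, 1, 2], [0, 1, 2], [0, 1], [0], []]"
  by code_simp

lemma check_mxmxmxm:
  "config_ok True
     [[1], [0, 2], [1, 3], [2, 4], [3, 5], [4, 6], [5]]
     [0, 1, 3, 5, 6] [0, 1, 2, 3, 4, 5, 6] [1, 1, 3, 2, 2, 1, 1]
     [[0, 1], [0, 1], [0, 1], [0, 1], [0, 1], [0], []]"
  by code_simp

lemma check_Txmxmxmx:
  "config_ok True
     [[1, 2, 9], [0, 2, 3], [0, 1], [1, 4], [3, 5], [4, 6], [5, 7], [6, 8], [7, 9], [0, 8]]
     [2, 3, 5, 7, 9] [2, 6, 8, 7, 5, 4, 3, 1, 0, 9] [0, 3, 3, 2, 2, 2, 2, 3, 3, 2]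
     [[5, 6, 7, 8], [0, 1, 2, 3], [0, 5, 6], [0, 5], [0, 1], [0, 1], [0, 1], [0, 1], [0], []]"
  by code_simp

lemma check_TTxmxmx:
  "config_ok True
     [[1, 2, 10], [0, 2, 3], [0, 1], [1, 4, 5], [3, 5, 6], [3, 4], [4, 7], [6, 8], [7, 9], [8, 10], [0, 9]]
     [2, 5, 6, 8, 10] [6, 5, 4, 3, 2, 1, 0, 10, 9, 8, 7] [0, 1, 3, 4, 1, 4, 3, 2, 3, 2, 3]
     [[0, 1, 2, 8, 9], [0, 1, 3], [0, 2, 7], [0, 1, 2], [0, 1, 2], [0, 1], [0, 1], [0, 1], [0, 1], [0], []]"
  by code_simp

lemma check_TTTxmx:
  "config_ok True
     [[1, 2, 11], [0, 2, 3], [0, 1], [1, 4, 5], [3, 5, 6], [3, 4], [4, 7, 8], [6, 8, 9], [6, 7], [7, 10], [9, 11], [0, 10]]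
     [2, 5, 8, 9, 11] [6, 5, 4, 7, 8, 3, 1, 2, 0, 10, 11, 9] [0, 2, 4, 3, 2, 3, 4, 2, 3, 3, 2, 2]
     [[0, 1, 2, 3, 4, 10], [0, 3, 4], [0, 1, 2, 3], [0, 5, 7], [6], [0, 1, 2], [0, 1, 3], [0, 2], [0, 1], [0, 1], [0], []]"
  by code_simp

lemma check_TxTxTm:
  "config_ok True
     [[1, 2, 11], [0, 2, 3], [0, 1], [1, 4], [3, 5, 6], [4, 6, 7], [4, 5], [5, 8], [7, 9, 10], [8, 10, 11], [8, 9], [0, 9]]
     [2, 3, 6, 7, 10] [6, 10, 9, 11, 0, 8, 1, 2, 3, 4, 5, 7] [0, 1, 4, 4, 4, 3, 3, 1, 2, 3, 3, 2]
     [[7, 8, 9, 10], [0, 1, 3, 9], [0, 1, 2, 8], [0, 1, 2, 3], [1, 2, 3], [4, 5], [0, 1, 2], [0], [0, 1], [0, 1], [0], []]"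
  by code_simp

lemma check_TTxTmx:
  "config_ok True
     [[1, 2, 11], [0, 2, 3], [0, 1], [1, 4, 5], [3, 5, 6], [3, 4], [4, 7], [6, 8, 9], [7, 9, 10], [7, 8], [8, 11], [0, 10]]
     [2, 5, 6, 9, 11] [9, 2, 8, 10, 7, 11, 0, 1, 3, 4, 6, 5] [0, 0, 4, 4, 3, 2, 3, 4, 4, 3, 2, 1]
     [[1, 2, 3, 9], [3, 4, 5, 6], [0, 1, 2, 7], [0, 1, 2], [4, 5], [0, 1], [0, 1], [0, 1, 3], [0, 1, 2], [0, 1], [0], []]"
  by code_simp

lemma check_TTTTx:
  "config_ok True
     [[1, 2, 12], [0, 2, 3], [0, 1], [1, 4, 5], [3, 5, 6], [3, 4], [4, 7, 8], [6, 8, 9], [6, 7], [7, 10, 11], [9, 11, 12], [9, 10], [0, 10]]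
     [2, 5, 8, 11, 12] [8, 9, 10, 11, 12, 0, 1, 2, 3, 4, 5, 6, 7] [1, 4, 1, 2, 2, 3, 4, 0, 4, 4, 1, 4, 4]
     [[0, 8, 10, 11], [0, 1, 2, 9, 10], [0, 1, 2, 9], [0, 8], [0, 1, 2], [0, 1, 2], [0, 1, 2, 3], [0], [0, 1, 2], [0, 1, 2], [0], [0], []]"
  by code_simp

lemma check_TTTTT:
  "config_ok True
     [[1, 2, 13], [0, 2, 3], [0, 1], [1, 4, 5], [3, 5, 6], [3, 4], [4, 7, 8], [6, 8, 9], [6, 7], [7, 10, 11], [9, 11, 12], [9, 10], [10, 13, 14], [0, 12, 14], [12, 13]]
     [2, 5, 8, 11, 14] [14, 2, 8, 10, 11, 12, 13, 0, 1, 3, 4, 5, 6, 7, 9] [0, 0, 0, 4, 1, 4, 4, 3, 4, 3, 4, 1, 4, 4, 4]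
     [[2, 4, 5, 6], [4, 5, 6, 7], [7, 9, 10, 11], [0, 1, 2, 9, 10], [0, 8, 9], [0, 1, 8], [0, 1], [0, 1], [0, 1, 2], [0, 1, 2], [0, 1, 2], [0], [0, 1], [0], []]"
  by code_simp

fun starts_with :: "kind list \<Rightarrow> kind list \<Rightarrow> bool" where
  "starts_with [] w = True"
| "starts_with (k # ks) [] = False"
| "starts_with (k # ks) (h # w) = (k = h \<and> starts_with ks w)"

lemma map_kind_iffs:
  "map kind_of its = KM # ks \<longleftrightarrow> (\<exists>a js. its = M a # js \<and> map kind_of js = ks)"
  "map kind_of its = KX # ks \<longleftrightarrow> (\<exists>a js. its = X a # js \<and> map kind_of js = ks)"
  "map kind_of its = KT # ks \<longleftrightarrow> (\<exists>v w t js. its = T v w t # js \<and> map kind_of js = ks)"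
  by (cases its; cases "hd its"; auto)+

lemma pre_map_kind_iffs:
  "starts_with (KM # ks) (map kind_of its) \<longleftrightarrow> (\<exists>a js. its = M a # js \<and> starts_with ks (map kind_of js))"
  "starts_with (KX # ks) (map kind_of its) \<longleftrightarrow> (\<exists>a js. its = X a # js \<and> starts_with ks (map kind_of js))"
  "starts_with (KT # ks) (map kind_of its) \<longleftrightarrow> (\<exists>v w t js. its = T v w t # js \<and> starts_with ks (map kind_of js))"
  by (cases its; cases "hd its"; auto)+

lemmas pre_iffs = map_kind_iffs pre_map_kind_iffs

definition chain_words :: "kind list list" where
  "chain_words = [[KM, KT, KM], [KT, KT, KM], [KM, KT, KX, KM], [KT, KM, KX, KM], [KM, KT, KX, KT, KM], [KM, KX, KM, KX, KM, KX, KM]]"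

definition ring_words :: "kind list list" where
  "ring_words = [[KT, KX, KM, KX, KM, KX, KM, KX], [KT, KT, KX, KM, KX, KM, KX], [KT, KT, KT, KX, KM, KX],
     [KT, KX, KT, KX, KT, KM], [KT, KT, KX, KT, KM, KX], [KT, KT, KT, KT, KX], [KT, KT, KT, KT, KT]]"

definition matches :: "kind list \<Rightarrow> bool" where
  "matches w \<longleftrightarrow> (\<exists>p\<in>set chain_words. starts_with p w) \<or> w \<in> set ring_words"

fun rot_matches :: "nat \<Rightarrow> kind list \<Rightarrow> bool" where
  "rot_matches 0 w = False"
| "rot_matches (Suc n) w = (matches w \<or> rot_matches n (rotate1 w))"

lemma rot_matches_sound: "rot_matches n w \<Longrightarrow> \<exists>m. matches (rotate m w)"
proof (induction n arbitrary: w)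
  case (Suc n)
  show ?case
  proof (cases "matches w")
    case True then show ?thesis by (intro exI[of _ 0]) simp
  next
    case False
    then obtain m where "matches (rotate m (rotate1 w))" using Suc by auto
    then show ?thesis by (intro exI[of _ "Suc m"]) (simp add: rotate1_rotate_swap)
  qed
qed auto

text \<open>
  All words in which each of \<open>n\<close> letters \<open>KX\<close> or \<open>KT\<close> is followed by at most one \<open>KM\<close>. Vertices of degree
  2 are not adjacent, so every ring is such a word up to rotation.
\<close>

fun blocks :: "nat \<Rightarrow> kind list list" where
  "blocks 0 = [[]]"
| "blocks (Suc n) = concat (map (\<lambda>w. [KX # w, KX # KM # w, KT # w, KT # KM # w]) (blocks n))"

text \<open>
  The length of a cycle with these items.
\<close>

definition weight :: "kind list \<Rightarrow> nat" where
  "weight w = sum_list (map (\<lambda>k. case k of KT \<Rightarrow> 2 | _ \<Rightarrow> 1) w)"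

abbreviation no_MM :: "kind \<Rightarrow> kind \<Rightarrow> bool" where
  "no_MM j k \<equiv> \<not> (j = KM \<and> k = KM)"

lemma in_blocks:
  "successively no_MM w \<Longrightarrow> w = [] \<or> hd w \<noteq> KM \<Longrightarrow> w \<in> set (blocks (length (filter (\<lambda>k. k \<noteq> KM) w)))"
proof (induction "length w" arbitrary: w rule: less_induct)
  case less
  show ?case
  proof (cases w)
    case (Cons k w1)
    have k: "k = KX \<or> k = KT" using less(3) Cons by (cases k) auto
    show ?thesis
    proof (cases "w1 \<noteq> [] \<and> hd w1 = KM")
      case True
      then obtain w2 where w1: "w1 = KM # w2" by (cases w1) auto
      have "w2 = [] \<or> hd w2 \<noteq> KM" using less(2) Cons w1 by (cases w2) auto
      moreover have "successively no_MM w2" using less(2) Cons w1 by (cases w2) auto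
      ultimately have "w2 \<in> set (blocks (length (filter (\<lambda>k. k \<noteq> KM) w2)))" using less(1)[of w2] Cons w1 by auto
      then show ?thesis using k Cons w1 by auto
    next
      case False
      moreover have "successively no_MM w1" using less(2) Cons by (cases w1) auto
      ultimately have "w1 \<in> set (blocks (length (filter (\<lambda>k. k \<noteq> KM) w1)))" using less(1)[of w1] Cons by auto
      then show ?thesis using k Cons by auto
    qed
  qed auto
qed

text \<open>
  The combinatorial core: at most five items and length at least 9 force one of the thirteen words.
\<close>

lemma short_words_match:
  "\<forall>n\<in>set [0..<6]. \<forall>w\<in>set (blocks n). 9 \<le> weight w \<longrightarrow> rot_matches (length w) w \<or> rot_matches (length w) (rev w)"
  by code_simp

lemma ring_word_matches:
  assumes w: "successively no_MM w" "w \<noteq> []" "no_MM (last w) (hd w)" 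
    and n: "length (filter (\<lambda>k. k \<noteq> KM) w) \<le> 5" and wt: "9 \<le> weight w"
  shows "\<exists>n. matches (rotate n w) \<or> matches (rotate n (rev w))"
proof -
  have *: "\<exists>n. matches (rotate n w) \<or> matches (rotate n (rev w))" 
    if a: "successively no_MM w" "hd w \<noteq> KM" "length (filter (\<lambda>k. k \<noteq> KM) w) \<le> 5" "9 \<le> weight w" for w
  proof -
    have "length (filter (\<lambda>k. k \<noteq> KM) w) \<in> set [0..<6]" using a(3) by auto
    then have "rot_matches (length w) w \<or> rot_matches (length w) (rev w)"
      using short_words_match in_blocks[OF a(1)] a(2,4) by blast
    then show ?thesis using rot_matches_sound by blast
  qed
  show ?thesis
  proof (cases "hd w = KM")
    case False then show ?thesis using * w n wt by blast
  next
    case True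
    then obtain w' where w': "w = KM # w'" using w(2) by (cases w) auto
    have ne: "w' \<noteq> []" using wt w' by (auto simp: weight_def)
    have lw: "last w' \<noteq> KM" using w(3) w' ne by auto
    have s1: "successively no_MM w'" "hd w' \<noteq> KM" using w(1) w' ne by (cases w'; auto)+
    have "successively no_MM (w' @ [KM])" using s1(1) lw ne by (auto simp: successively_append_iff)
    moreover have "hd (w' @ [KM]) \<noteq> KM" using s1 ne by auto
    moreover have "length (filter (\<lambda>k. k \<noteq> KM) (w' @ [KM])) \<le> 5" using n w' by auto
    moreover have "9 \<le> weight (w' @ [KM])" using wt w' by (auto simp: weight_def)
    ultimately obtain n where "matches (rotate n (w' @ [KM])) \<or> matches (rotate n (rev (w' @ [KM])))" using * by blast
    moreover have "w' @ [KM] = rotate 1 w" using w' by simp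
    moreover have "rev (w' @ [KM]) = rotate (length w') (rev w)" 
    proof -
      have "rev w = rev w' @ [KM]" using w' by simp
      then show ?thesis by (metis length_rev rev.simps rev_append rotate_append append_Cons append_Nil rev_rev_ident)
    qed
    ultimately show ?thesis by (metis rotate_rotate)
  qed
qed

context irreducible_graph
begin

lemma big_triangles: "\<forall>a b c. (a, b) \<in> E \<longrightarrow> (b, c) \<in> E \<longrightarrow> (a, c) \<in> E \<longrightarrow> card (nbrs E a) > 2"
  using triangle_deg_3 by fastforce

lemma deg3': "card (nbrs E v) \<le> Suc (Suc (Suc 0))"
  using deg3[of v] by simp

text \<open>
  Each of the thirteen words, read from the start of a ring, marks a reducible configuration: the ring
  supplies the adjacencies, degrees and distinctness that the certificate of the word asks for.
\<close>

lemma reducible_mTm: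
  assumes "ring its" "starts_with [KM, KT, KM] (map kind_of its)" shows "reducible V E"
proof -
  obtain v0 v1 w1 t1 v2 js where its: "its = M v0 # T v1 w1 t1 # M v2 # js"
    using assms(2) by (auto simp: pre_iffs)
  show ?thesis
    by (rule list_config_reducible[OF check_mTm big_triangles, of "[v0, v1, w1, t1, v2]"])
      (use assms(1) deg3 in \<open>auto simp: its ring_def deg3' intro: symE dest: in_V\<close>)
qed

lemma reducible_TTm:
  assumes "ring its" "starts_with [KT, KT, KM] (map kind_of its)" shows "reducible V E"
proof -
  obtain v0 w0 t0 v1 w1 t1 v2 js where its: "its = T v0 w0 t0 # T v1 w1 t1 # M v2 # js"
    using assms(2) by (auto simp: pre_iffs)
  show ?thesis
    by (rule list_config_reducible[OF check_TTm big_triangles, of "[v0, w0, t0, v1, w1, t1, v2]"])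
      (use assms(1) deg3 in \<open>auto simp: its ring_def deg3' intro: symE dest: in_V\<close>)
qed

lemma reducible_mTxm:
  assumes "ring its" "starts_with [KM, KT, KX, KM] (map kind_of its)" shows "reducible V E"
proof -
  obtain v0 v1 w1 t1 v2 v3 js where its: "its = M v0 # T v1 w1 t1 # X v2 # M v3 # js"
    using assms(2) by (auto simp: pre_iffs)
  show ?thesis
    by (rule list_config_reducible[OF check_mTxm big_triangles, of "[v0, v1, w1, t1, v2, v3]"])
      (use assms(1) deg3 in \<open>auto simp: its ring_def deg3' intro: symE dest: in_V\<close>)
qed

lemma reducible_Tmxm:
  assumes "ring its" "starts_with [KT, KM, KX, KM] (map kind_of its)" shows "reducible V E"
proof -
  obtain v0 w0 t0 v1 v2 v3 js where its: "its = T v0 w0 t0 # M v1 # X v2 # M v3 # js"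
    using assms(2) by (auto simp: pre_iffs)
  show ?thesis
    by (rule list_config_reducible[OF check_Tmxm big_triangles, of "[v0, w0, t0, v1, v2, v3]"])
      (use assms(1) deg3 in \<open>auto simp: its ring_def deg3' intro: symE dest: in_V\<close>)
qed

lemma reducible_mTxTm:
  assumes "ring its" "starts_with [KM, KT, KX, KT, KM] (map kind_of its)" shows "reducible V E"
proof -
  obtain v0 v1 w1 t1 v2 v3 w3 t3 v4 js where its: "its = M v0 # T v1 w1 t1 # X v2 # T v3 w3 t3 # M v4 # js"
    using assms(2) by (auto simp: pre_iffs)
  show ?thesis
    by (rule list_config_reducible[OF check_mTxTm big_triangles, of "[v0, v1, w1, t1, v2, v3, w3, t3, v4]"])
      (use assms(1) deg3 in \<open>auto simp: its ring_def deg3' intro: symE dest: in_V\<close>)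
qed

lemma reducible_mxmxmxm:
  assumes "ring its" "starts_with [KM, KX, KM, KX, KM, KX, KM] (map kind_of its)" shows "reducible V E"
proof -
  obtain v0 v1 v2 v3 v4 v5 v6 js where its: "its = M v0 # X v1 # M v2 # X v3 # M v4 # X v5 # M v6 # js"
    using assms(2) by (auto simp: pre_iffs)
  show ?thesis
    by (rule list_config_reducible[OF check_mxmxmxm big_triangles, of "[v0, v1, v2, v3, v4, v5, v6]"])
      (use assms(1) deg3 in \<open>auto simp: its ring_def deg3' intro: symE dest: in_V\<close>)
qed

lemma reducible_Txmxmxmx:
  assumes "ring its" "map kind_of its = [KT, KX, KM, KX, KM, KX, KM, KX]" shows "reducible V E"
proof -
  obtain v0 w0 t0 v1 v2 v3 v4 v5 v6 v7 where its: "its = [T v0 w0 t0, X v1, M v2, X v3, M v4, X v5, M v6, X v7]"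
    using assms(2) by (auto simp: pre_iffs)
  show ?thesis
    by (rule list_config_reducible[OF check_Txmxmxmx big_triangles, of "[v0, w0, t0, v1, v2, v3, v4, v5, v6, v7]"])
      (use assms(1) deg3 in \<open>auto simp: its ring_def deg3' intro: symE dest: in_V\<close>)
qed

lemma reducible_TTxmxmx:
  assumes "ring its" "map kind_of its = [KT, KT, KX, KM, KX, KM, KX]" shows "reducible V E"
proof -
  obtain v0 w0 t0 v1 w1 t1 v2 v3 v4 v5 v6 where its: "its = [T v0 w0 t0, T v1 w1 t1, X v2, M v3, X v4, M v5, X v6]"
    using assms(2) by (auto simp: pre_iffs)
  show ?thesis
    by (rule list_config_reducible[OF check_TTxmxmx big_triangles, of "[v0, w0, t0, v1, w1, t1, v2, v3, v4, v5, v6]"])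
      (use assms(1) deg3 in \<open>auto simp: its ring_def deg3' intro: symE dest: in_V\<close>)
qed

lemma reducible_TTTxmx:
  assumes "ring its" "map kind_of its = [KT, KT, KT, KX, KM, KX]" shows "reducible V E"
proof -
  obtain v0 w0 t0 v1 w1 t1 v2 w2 t2 v3 v4 v5 where its: "its = [T v0 w0 t0, T v1 w1 t1, T v2 w2 t2, X v3, M v4, X v5]"
    using assms(2) by (auto simp: pre_iffs)
  show ?thesis
    by (rule list_config_reducible[OF check_TTTxmx big_triangles, of "[v0, w0, t0, v1, w1, t1, v2, w2, t2, v3, v4, v5]"])
      (use assms(1) deg3 in \<open>auto simp: its ring_def deg3' intro: symE dest: in_V\<close>)
qed

lemma reducible_TxTxTm:
  assumes "ring its" "map kind_of its = [KT, KX, KT, KX, KT, KM]" shows "reducible V E"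
proof -
  obtain v0 w0 t0 v1 v2 w2 t2 v3 v4 w4 t4 v5 where its: "its = [T v0 w0 t0, X v1, T v2 w2 t2, X v3, T v4 w4 t4, M v5]"
    using assms(2) by (auto simp: pre_iffs)
  show ?thesis
    by (rule list_config_reducible[OF check_TxTxTm big_triangles, of "[v0, w0, t0, v1, v2, w2, t2, v3, v4, w4, t4, v5]"])
      (use assms(1) deg3 in \<open>auto simp: its ring_def deg3' intro: symE dest: in_V\<close>)
qed

lemma reducible_TTxTmx:
  assumes "ring its" "map kind_of its = [KT, KT, KX, KT, KM, KX]" shows "reducible V E"
proof -
  obtain v0 w0 t0 v1 w1 t1 v2 v3 w3 t3 v4 v5 where its: "its = [T v0 w0 t0, T v1 w1 t1, X v2, T v3 w3 t3, M v4, X v5]"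
    using assms(2) by (auto simp: pre_iffs)
  show ?thesis
    by (rule list_config_reducible[OF check_TTxTmx big_triangles, of "[v0, w0, t0, v1, w1, t1, v2, v3, w3, t3, v4, v5]"])
      (use assms(1) deg3 in \<open>auto simp: its ring_def deg3' intro: symE dest: in_V\<close>)
qed

lemma reducible_TTTTx:
  assumes "ring its" "map kind_of its = [KT, KT, KT, KT, KX]" shows "reducible V E"
proof -
  obtain v0 w0 t0 v1 w1 t1 v2 w2 t2 v3 w3 t3 v4 where its: "its = [T v0 w0 t0, T v1 w1 t1, T v2 w2 t2, T v3 w3 t3, X v4]"
    using assms(2) by (auto simp: pre_iffs)
  show ?thesis
    by (rule list_config_reducible[OF check_TTTTx big_triangles, of "[v0, w0, t0, v1, w1, t1, v2, w2, t2, v3, w3, t3, v4]"])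
      (use assms(1) deg3 in \<open>auto simp: its ring_def deg3' intro: symE dest: in_V\<close>)
qed

lemma reducible_TTTTT:
  assumes "ring its" "map kind_of its = [KT, KT, KT, KT, KT]" shows "reducible V E"
proof -
  obtain v0 w0 t0 v1 w1 t1 v2 w2 t2 v3 w3 t3 v4 w4 t4 where its: "its = [T v0 w0 t0, T v1 w1 t1, T v2 w2 t2, T v3 w3 t3, T v4 w4 t4]"
    using assms(2) by (auto simp: pre_iffs)
  show ?thesis
    by (rule list_config_reducible[OF check_TTTTT big_triangles, of "[v0, w0, t0, v1, w1, t1, v2, w2, t2, v3, w3, t3, v4, w4, t4]"])
      (use assms(1) deg3 in \<open>auto simp: its ring_def deg3' intro: symE dest: in_V\<close>)
qed


lemma ring_word_irreducible: assumes "ring its" shows "\<not> matches (map kind_of its)"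
proof
  assume "matches (map kind_of its)"
  then have "reducible V E"
    unfolding matches_def chain_words_def ring_words_def
    using reducible_mTm[OF assms] reducible_TTm[OF assms] reducible_mTxm[OF assms] reducible_Tmxm[OF assms]
      reducible_mTxTm[OF assms] reducible_mxmxmxm[OF assms] reducible_Txmxmxmx[OF assms] reducible_TTxmxmx[OF assms]
      reducible_TTTxmx[OF assms] reducible_TxTxTm[OF assms] reducible_TTxTmx[OF assms] reducible_TTTTx[OF assms]
      reducible_TTTTT[OF assms]
    by auto
  then show False using irreducible by simp
qed

lemma cedges_rotate_n: "cedges (rotate n cs) = cedges cs"
proof (induction n)
  case (Suc n)
  have "cedges (rotate1 xs) = cedges xs" for xs :: "'b list"
    using cedges_rotate[of "[hd xs]" "tl xs"] by (cases xs) auto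
  then show ?case using Suc by simp
qed simp

text \<open>
  The cycle is first rotated so that its starting point does not cut an item in two. That is possible
  because no three consecutive vertices lie in one triangle.
\<close>

lemma ring_of_cycle:
  assumes cs: "distinct cs" "length cs \<ge> 4" "cedges cs \<subseteq> uedges E"
    and short: "\<And>n. (last (rotate n cs), rotate n cs ! 1) \<notin> E"
  obtains its where "ring its" "length (concat (map on_ring its)) = length cs" "set (concat (map on_ring its)) = set cs"
proof -
  have "\<exists>n. hd (rotate n cs) \<notin> item (last (rotate n cs))"
  proof (rule ccontr)
    assume "\<not> ?thesis"
    then have all: "\<And>n. hd (rotate n cs) \<in> item (last (rotate n cs))" by blast
    obtain a b c ds where abc: "cs = a # b # c # ds" using cs(2) by (auto simp: numeral_eq_Suc Suc_le_length_iff)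
    have 1: "a \<in> item (last cs)" using all[of 0] abc by simp
    have 2: "b \<in> item a" using all[of 1] abc by simp
    have "b \<in> item (last cs)" using 1 2 item_eq by auto
    moreover have "b \<noteq> last cs" using cs(1) abc by auto
    ultimately have "(last cs, b) \<in> E" using item_adj by auto
    then show False using short[of 0] abc by simp
  qed
  then obtain k where k: "hd (rotate k cs) \<notin> item (last (rotate k cs))" by blast
  define r where "r = rotate k cs"
  let ?l = "length r"
  have r: "distinct r" "?l \<ge> 4" "cedges r \<subseteq> uedges E" using cs by (auto simp: r_def cedges_rotate_n)
  have ne: "r \<noteq> []" using r(2) by auto
  have shr: "(last (rotate n r), rotate n r ! 1) \<notin> E" for n using short[of "n + k"] by (simp add: r_def rotate_rotate)
  have E2: "pedges (last r # r @ [hd r]) \<subseteq> uedges E"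
  proof -
    have "pedges (r @ [hd r]) = pedges r \<union> insert {last r, hd r} (pedges [hd r])" using pedges_append2[OF ne, of "hd r" "[]"] by simp
    moreover have "pedges (last r # r @ [hd r]) = insert {last r, hd r} (pedges (r @ [hd r]))" using ne by (cases r) auto
    ultimately show ?thesis using r(3) by (auto simp: cedges_def)
  qed
  have thin_nth: "(\<And>i. i + 2 < length q \<Longrightarrow> q ! i \<noteq> q ! (i + 2) \<and> (q ! i, q ! (i + 2)) \<notin> E) \<Longrightarrow> thin q" for q
  proof (induction q rule: thin.induct)
    case (1 a b c xs)
    have "thin (b # c # xs)"
    proof (rule 1(1))
      fix i assume "i + 2 < length (b # c # xs)"
      then show "(b # c # xs) ! i \<noteq> (b # c # xs) ! (i + 2) \<and> ((b # c # xs) ! i, (b # c # xs) ! (i + 2)) \<notin> E"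
        using 1(2)[of "Suc i"] by simp
    qed
    then show ?case using 1(2)[of 0] by simp
  qed auto
  have "thin (last r # r @ [hd r])"
  proof (rule thin_nth)
    fix i assume "i + 2 < length (last r # r @ [hd r])"
    then have i: "i < ?l" by simp
    let ?q = "last r # r @ [hd r]"
    have a: "?q ! i = r ! ((i + ?l - 1) mod ?l)"
    proof (cases i)
      case 0 then show ?thesis using ne r(2) by (simp add: last_conv_nth)
    next
      case (Suc j) then show ?thesis using i by (simp add: nth_append mod_if)
    qed
    have b: "?q ! (i + 2) = r ! ((i + 1) mod ?l)"
    proof (cases "i + 1 = ?l")
      case True then show ?thesis using ne by (simp add: nth_append hd_conv_nth)
    next
      case False then show ?thesis using i by (simp add: nth_append)
    qed
    have la: "last (rotate i r) = r ! ((i + ?l - 1) mod ?l)"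
      using ne r(2) i by (simp add: last_conv_nth nth_rotate)
    have nx: "rotate i r ! 1 = r ! ((i + 1) mod ?l)" using r(2) by (simp add: nth_rotate)
    have "(i + ?l - 1) mod ?l \<noteq> (i + 1) mod ?l"
    proof (cases "i = 0")
      case True then show ?thesis using r(2) by simp
    next
      case False
      then have "(i + ?l - 1) mod ?l = i - 1" using i by (simp add: mod_if)
      moreover have "(i + 1) mod ?l = (if i + 1 = ?l then 0 else i + 1)" using i by simp
      moreover have "i - 1 \<noteq> i + 1" "i + 1 = ?l \<Longrightarrow> i - 1 \<noteq> 0" using r(2) by linarith+
      ultimately show ?thesis by simp
    qed
    moreover have "0 < ?l" using r(2) by linarith
    then have "(i + ?l - 1) mod ?l < ?l" "(i + 1) mod ?l < ?l" by (rule mod_less_divisor)+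
    ultimately have "?q ! i \<noteq> ?q ! (i + 2)" using r(1) a b nth_eq_iff_index_eq by metis
    then show "?q ! i \<noteq> ?q ! (i + 2) \<and> (?q ! i, ?q ! (i + 2)) \<notin> E" using shr[of i] a b la nx by simp
  qed
  from parse[OF E2 this] k ne obtain its where its: "concat (map on_ring its) = r" "\<forall>I\<in>set its. ok I" "successively link its"
    unfolding r_def[symmetric] by auto
  have nei: "its \<noteq> []" using its(1) ne by auto
  have "link (last its) (hd its)"
  proof -
    have h: "hd (concat (map on_ring its)) = entry_vertex (hd its)"
      using nei by (cases its; cases "hd its") auto
    have l: "last (concat (map on_ring its)) = exit_vertex (last its)"
      using nei by (cases its rule: rev_cases; cases "last its") auto
    have "(last r, hd r) \<in> E" using r(3) by (auto simp: cedges_def uedge_iff)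
    then show ?thesis using h l its(1) by simp
  qed
  moreover have "distinct (concat (map members its))" using ring_members_distinct[OF its(2)] its(1) r(1) by simp
  ultimately have "ring its" using its(2,3) nei by (simp add: ring_def)
  then show ?thesis using that[of its] its(1) by (simp add: r_def)
qed

text \<open>
  Among the cycles that meet at most five items take a shortest one. It is thin, since a second edge in a
  triangle could be replaced by a shortcut: the shorter cycle meets no new items and still has at least 8
  vertices, hence at least 9.
\<close>

theorem cycles_meet_six_items:
  assumes "distinct cs" "length cs \<ge> 4" "cedges cs \<subseteq> uedges E"
  shows "card (item ` {v \<in> set cs. card (nbrs E v) = 3}) \<ge> 6"
proof (rule ccontr)
  define P where "P cs \<longleftrightarrow> distinct cs \<and> length cs \<ge> 4 \<and> cedges cs \<subseteq> uedges E \<and> 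
    card (item ` {v \<in> set cs. card (nbrs E v) = 3}) \<le> 5" for cs
  assume "\<not> ?thesis"
  then have "P cs" using assms by (simp add: P_def)
  then obtain cs where cs: "P cs" and least: "\<And>ds. P ds \<Longrightarrow> length cs \<le> length ds"
    using ex_has_least_nat[of P cs length] by blast
  have c: "distinct cs" "length cs \<ge> 4" "cedges cs \<subseteq> uedges E" "card (item ` {v \<in> set cs. card (nbrs E v) = 3}) \<le> 5"
    using cs by (auto simp: P_def)
  have c9: "length cs \<ge> 9" using no_cycle[OF c(1,2)] c(3) by linarith
  have short: "(last (rotate n cs), rotate n cs ! 1) \<notin> E" for n
  proof
    assume e: "(last (rotate n cs), rotate n cs ! 1) \<in> E"
    obtain b d e' ys where r: "rotate n cs = b # d # e' # ys" 
      using c9 by (cases "rotate n cs" rule: thin.cases) (auto dest!: arg_cong[of _ _ length])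
    let ?ds = "d # e' # ys"
    have set_r: "set (b # ?ds) = set cs" unfolding r[symmetric] by simp
    have len: "length cs = Suc (length ?ds)" using arg_cong[OF r, of length] by simp
    have "distinct (b # ?ds)" unfolding r[symmetric] using c(1) by simp
    then have d: "distinct ?ds" by simp
    have "cedges (b # ?ds) \<subseteq> uedges E" unfolding r[symmetric] cedges_rotate_n using c(3) .
    then have "pedges ?ds \<subseteq> uedges E" by (auto simp: cedges_def)
    moreover have "(last ?ds, hd ?ds) \<in> E" using e r by simp
    ultimately have ce: "cedges ?ds \<subseteq> uedges E" by (auto simp: cedges_def uedge_iff)
    have "card (item ` {v \<in> set ?ds. card (nbrs E v) = 3}) \<le> card (item ` {v \<in> set cs. card (nbrs E v) = 3})"
      using set_r by (intro card_mono image_mono) auto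
    then have "P ?ds" using d ce c9 len c(4) by (simp add: P_def)
    then show False using least len by fastforce
  qed
  obtain its where its: "ring its" "length (concat (map on_ring its)) = length cs" "set (concat (map on_ring its)) = set cs"
    using ring_of_cycle[OF c(1-3) short] by metis
  have ok: "\<forall>I\<in>set its. ok I" and suc: "successively link its" and cl: "link (last its) (hd its)" and ne: "its \<noteq> []"
    using its(1) by (auto simp: ring_def)
  let ?w = "map kind_of its"
  have m2: "card (nbrs E (exit_vertex I)) = 2" "card (nbrs E (entry_vertex I)) = 2" if "ok I" "kind_of I = KM" for I
    using that by (cases I; auto)+
  have MM: "no_MM (kind_of I) (kind_of J)" if "ok I" "ok J" "link I J" for I J
    using m2 that no_adjacent_2[OF that(3)] by force
  have s: "successively no_MM ?w"
    using suc ok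
  proof (induction its rule: induct_list012)
    case (3 I J its)
    then show ?case using MM[of I J] by auto
  qed auto
  have l: "no_MM (last ?w) (hd ?w)" using MM[OF _ _ cl] ok ne by (simp add: last_map hd_map)
  have wt: "weight ?w = length (concat (map on_ring its))"
  proof (induction its)
    case (Cons I its)
    then show ?case by (cases I) (auto simp: weight_def)
  qed (simp add: weight_def)
  have n: "length (filter (\<lambda>k. k \<noteq> KM) ?w) \<le> 5"
  proof -
    let ?f = "filter (\<lambda>I. kind_of I \<noteq> KM) its"
    have "distinct (concat (map on_ring its))" using its(2,3) c(1) by (metis card_distinct distinct_card)
    then have "distinct (map (item \<circ> entry_vertex) its)" using ring_members_distinct[OF ok] by blast
    then have "distinct (map (item \<circ> entry_vertex) ?f)" by (rule distinct_map_filter)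
    then have "length ?f = card (set (map (item \<circ> entry_vertex) ?f))" using distinct_card by fastforce
    also have "\<dots> \<le> card (item ` {v \<in> set cs. card (nbrs E v) = 3})"
    proof (rule card_mono)
      show "set (map (item \<circ> entry_vertex) ?f) \<subseteq> item ` {v \<in> set cs. card (nbrs E v) = 3}"
      proof
        fix x assume "x \<in> set (map (item \<circ> entry_vertex) ?f)"
        then obtain I where I: "I \<in> set its" "kind_of I \<noteq> KM" "x = item (entry_vertex I)" by auto
        have "entry_vertex I \<in> set (on_ring I)" by (cases I) auto
        then have "entry_vertex I \<in> set cs" using I(1) its(3) by auto
        moreover have "card (nbrs E (entry_vertex I)) = 3"
        proof (cases I)
          case (T v w t)
          then have "tri v" using bspec[OF ok I(1)] by (auto simp: tri_def)
          then show ?thesis using tri_deg_3 T by simp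
        qed (use bspec[OF ok I(1)] I(2) in auto)
        ultimately show "x \<in> item ` {v \<in> set cs. card (nbrs E v) = 3}" using I(3) by auto
      qed
    qed simp
    finally show ?thesis using c(4) by (simp add: filter_map o_def)
  qed
  obtain k where k: "matches (rotate k ?w) \<or> matches (rotate k (rev ?w))"
    using ring_word_matches[OF s _ l n] wt its(2) c9 ne by auto
  have fl: "kind_of (flip I) = kind_of I" for I :: "'a ring_item" by (cases I) auto
  have "rotate k ?w = map kind_of (rotate k its)" by (simp add: rotate_map)
  moreover have "rotate k (rev ?w) = map kind_of (rotate k (rev (map flip its)))" by (simp add: rotate_map rev_map fl)
  ultimately show False using k ring_word_irreducible ring_rotate[OF its(1)] ring_rotate[OF ring_rev[OF its(1)]] by metis
qed

end

section \<open>Counting faces\<close>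

lemma on_pedge: "v \<in> set xs \<Longrightarrow> length xs \<ge> 2 \<Longrightarrow> \<exists>g\<in>pedges xs. v \<in> g"
proof (induction xs rule: pedges.induct)
  case (1 a b xs)
  show ?case
  proof (cases "xs = [] \<or> v = a")
    case False
    then have "length (b # xs) \<ge> 2" by (cases xs) auto
    then have "\<exists>g\<in>pedges (b # xs). v \<in> g" using 1 False by auto
    then show ?thesis by auto
  qed (use 1 in auto)
qed auto

text \<open>
  The first vertex of a longest path has a second edge, and its other end lies on the path.
\<close>

lemma even_set_has_cycle:
  assumes B: "finite B" "B \<noteq> {}" "\<And>g. g \<in> B \<Longrightarrow> \<exists>a b. a \<noteq> b \<and> g = {a, b}"
    and ev: "\<And>v. even (card {g \<in> B. v \<in> g})"
  obtains cs where "distinct cs" "length cs \<ge> 3" "cedges cs \<subseteq> B"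
proof -
  define P where "P xs \<longleftrightarrow> distinct xs \<and> pedges xs \<subseteq> B \<and> set xs \<subseteq> \<Union>B" for xs
  have fin: "finite (\<Union>B)" using B(1,3) by force
  obtain g0 where g0: "g0 \<in> B" using B(2) by blast
  obtain a b where "a \<noteq> b" "g0 = {a, b}" using B(3)[OF g0] by blast
  with g0 have ab: "g0 \<in> B" "a \<noteq> b" "g0 = {a, b}" by auto
  have P2: "P [a, b]" using ab by (auto simp: P_def)
  have bound: "\<forall>xs. P xs \<longrightarrow> length xs \<le> card (\<Union>B)"
  proof (intro allI impI)
    fix xs assume "P xs"
    then have "card (set xs) \<le> card (\<Union>B)" "distinct xs" using fin by (auto simp: P_def intro: card_mono)
    then show "length xs \<le> card (\<Union>B)" by (simp add: distinct_card)
  qed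
  have "\<exists>xs. P xs \<and> (\<forall>ys. P ys \<longrightarrow> length ys \<le> length xs)"
    by (rule ex_has_greatest_nat[of P "[a, b]" length "Suc (card (\<Union>B))"])
      (use P2 bound in \<open>auto simp: less_Suc_eq_le\<close>)
  then obtain xs where xs: "P xs" and greatest: "\<And>ys. P ys \<Longrightarrow> length ys \<le> length xs" by blast
  have "length xs \<ge> 2" using greatest[OF P2] by simp
  then obtain h k rest where hk: "xs = h # k # rest" by (cases xs rule: pedges.cases) auto
  have hkB: "{h, k} \<in> B" "h \<noteq> k" using xs hk by (auto simp: P_def)
  have "card {g \<in> B. h \<in> g} \<noteq> 1" using ev[of h] by presburger
  have "\<exists>g. g \<in> B \<and> h \<in> g \<and> g \<noteq> {h, k}"
  proof (rule ccontr)
    assume "\<not> ?thesis"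
    then have "{g \<in> B. h \<in> g} = {{h, k}}" using hkB by blast
    then show False using \<open>card {g \<in> B. h \<in> g} \<noteq> 1\<close> by simp
  qed
  then obtain g where g: "g \<in> B" "h \<in> g" "g \<noteq> {h, k}" by blast
  then obtain w where w: "g = {h, w}" "w \<noteq> h" using B(3)[OF g(1)] by (auto simp: doubleton_eq_iff)
  have wk: "w \<noteq> k" using g w by auto
  have "w \<in> set xs"
  proof (rule ccontr)
    assume "w \<notin> set xs"
    then have "P (w # xs)" using xs g w hk by (auto simp: P_def insert_commute)
    then show False using greatest by fastforce
  qed
  then have "w \<in> set rest" using hk wk w by auto
  then obtain us vs where s: "rest = us @ w # vs" by (meson split_list)
  have "pedges xs = pedges ((h # k # us) @ [w]) \<union> pedges (w # vs)" unfolding hk s using pedges_append[of "h # k # us" w vs] by simp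
  then have "cedges ((h # k # us) @ [w]) \<subseteq> B" using xs g w by (auto simp: P_def cedges_def insert_commute)
  moreover have "distinct ((h # k # us) @ [w])" using xs hk s by (auto simp: P_def)
  ultimately show ?thesis using that[of "(h # k # us) @ [w]"] by simp
qed

context irreducible_graph
begin

lemma finE: "finite E" using EV finV finite_subset by fastforce

lemma finite_uedges: "finite (uedges E)"
proof -
  have "uedges E = (\<lambda>(u, v). {u, v}) ` E" by (auto simp: uedges_def)
  then show ?thesis using finE by simp
qed

lemma uedges_cases: assumes "g \<in> uedges E" obtains u v where "(u, v) \<in> E" "g = {u, v}" "u \<noteq> v"
  using assms adj_neq by (auto simp: uedges_def)

lemma handshake: "(\<Sum>v\<in>V. card (nbrs E v)) = 2 * card (uedges E)"
proof -
  have "(\<Sum>v\<in>V. card (nbrs E v)) = card (Sigma V (nbrs E))" using finV fin_nbrs by simp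
  also have "Sigma V (nbrs E) = E" using EV by (auto simp: nbrs_def)
  also have "card E = (\<Sum>g\<in>uedges E. card {p \<in> E. {fst p, snd p} = g})"
  proof -
    have "uedges E = (\<lambda>p. {fst p, snd p}) ` E" by (force simp: uedges_def)
    then show ?thesis using sum.image_gen[OF finE, of "\<lambda>_. 1::nat" "\<lambda>p. {fst p, snd p}"] by simp
  qed
  also have "\<dots> = (\<Sum>g\<in>uedges E. 2)"
  proof (rule sum.cong[OF refl])
    fix g assume "g \<in> uedges E"
    then obtain u v where uv: "(u, v) \<in> E" "g = {u, v}" "u \<noteq> v" by (rule uedges_cases)
    have "{p \<in> E. {fst p, snd p} = g} = {(u, v), (v, u)}" using uv symE by (auto simp: doubleton_eq_iff)
    then show "card {p \<in> E. {fst p, snd p} = g} = 2" using uv by simp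
  qed
  finally show ?thesis by simp
qed

lemma triangle_item_degree:
  assumes "tri v" "w \<in> item v" shows "card (nbrs E w - item v) \<le> 1" "card (item v) = 3" "card (nbrs E w) = 3"
proof -
  have iw: "item w = item v" using assms(2) by (rule item_eq)
  have tw: "tri w"
  proof (rule ccontr)
    assume "\<not> tri w"
    then have "item v = {w}" using item_nontri iw by auto
    then have "v = w" using item_self[of v] by auto
    then show False using assms(1) \<open>\<not> tri w\<close> by simp
  qed
  then obtain a b where ab: "(w, a) \<in> E" "(w, b) \<in> E" "(a, b) \<in> E" by (auto simp: tri_def)
  have i: "item v = {w, a, b}" using item_tri[OF ab] iw by simp
  have ne: "a \<noteq> b" "w \<noteq> a" "w \<noteq> b" using ab adj_neq by auto
  show "card (item v) = 3" using i ne by simp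
  show "card (nbrs E w) = 3" using tri_deg_3[OF tw] .
  have "card (nbrs E w - {a, b}) = card (nbrs E w) - card {a, b}" using ab by (intro card_Diff_subset) (auto simp: nbrs_def)
  moreover have "card (nbrs E w - item v) \<le> card (nbrs E w - {a, b})" using i fin_nbrs by (intro card_mono) auto
  ultimately show "card (nbrs E w - item v) \<le> 1" using \<open>card (nbrs E w) = 3\<close> ne by simp
qed

text \<open>
  The count behind ``a cubic plane graph has a face with at most five vertices''. One edge of each
  triangle is deleted first, as the triangles themselves are not to be counted as faces. Every
  boundary in the remaining graph contains a cycle that is not a triangle and thus touches at least six
  items. Every item is touched by at most three boundaries, since at most three edges leave it, each
  in at most two boundaries, and a boundary that touches it uses at least two of these edges. With \<open>s\<close> single
  vertices and \<open>t\<close> triangles among the items, Euler's inequality gives at least \<open>(s + t) / 2 + 2\<close>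
  boundaries, which is more than the \<open>3 (s + t) / 6\<close> that these incidences allow.
\<close>

theorem no_face_boundaries:
  assumes faces: "\<And>K. K \<subseteq> uedges E \<Longrightarrow> \<exists>(\<Phi> :: 'f set) B. finite \<Phi> \<and> card K + 2 \<le> card \<Phi> + card V \<and>
      (\<forall>\<phi>\<in>\<Phi>. B \<phi> \<subseteq> K \<and> (\<forall>v. even (card {g \<in> B \<phi>. v \<in> g})) \<and> (card \<Phi> \<ge> 2 \<longrightarrow> B \<phi> \<noteq> {})) \<and>
      (\<forall>g\<in>K. card {\<phi> \<in> \<Phi>. g \<in> B \<phi>} \<le> 2)"
  shows False
proof -
  define V3 where "V3 = {v \<in> V. card (nbrs E v) = 3}"
  define II where "II = item ` V3"
  define TT where "TT = {I \<in> II. card I = 3}"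
  define SS where "SS = {I \<in> II. card I \<noteq> 3}"
  have fin: "finite V3" "finite II" "finite TT" "finite SS" using finV by (auto simp: V3_def II_def TT_def SS_def)
  have classify: "(\<not> tri v \<and> I = {v}) \<or> (tri v \<and> card I = 3)" if "I = item v" for v I
    using that item_nontri triangle_item_degree[OF _ item_self] by (cases "tri v") auto
  have IV3: "I \<subseteq> V3" if I: "I \<in> II" for I
  proof
    fix w assume w: "w \<in> I"
    obtain v where v: "v \<in> V3" "I = item v" using I by (auto simp: II_def)
    show "w \<in> V3"
    proof (cases "tri v")
      case True
      then have "card (nbrs E w) = 3" using triangle_item_degree(3) w v by auto
      moreover have "w \<in> V" using w v item_adj[of w v] in_V by (auto simp: V3_def)
      ultimately show ?thesis by (simp add: V3_def)
    next
      case False then show ?thesis using item_nontri v w by auto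
    qed
  qed
  have finI: "finite I" if "I \<in> II" for I using IV3[OF that] fin(1) finite_subset by blast
  have disj: "I \<inter> J = {}" if "I \<in> II" "J \<in> II" "I \<noteq> J" for I J
    using that item_eq unfolding II_def by blast
  have UII: "\<Union>II = V3" using IV3 item_self by (auto simp: II_def)
  have cS: "card I = 1" if I: "I \<in> SS" for I
  proof -
    obtain v where "I = item v" using I by (auto simp: SS_def II_def)
    from classify[OF this] show ?thesis using I by (auto simp: SS_def)
  qed
  have cardV3: "card V3 = card SS + 3 * card TT"
  proof -
    have "card V3 = (\<Sum>I\<in>II. card I)" unfolding UII[symmetric]
      by (rule card_Union_disjoint) (use disj finI in \<open>auto simp: pairwise_def disjnt_def\<close>)
    also have "II = SS \<union> TT" by (auto simp: SS_def TT_def)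
    also have "(\<Sum>I\<in>SS \<union> TT. card I) = (\<Sum>I\<in>SS. card I) + (\<Sum>I\<in>TT. card I)"
      using fin by (intro sum.union_disjoint) (auto simp: SS_def TT_def)
    also have "\<dots> = card SS + 3 * card TT" using cS by (simp add: TT_def)
    finally show ?thesis .
  qed
  have cII: "card II = card SS + card TT"
  proof -
    have "II = SS \<union> TT" by (auto simp: SS_def TT_def)
    moreover have "SS \<inter> TT = {}" by (auto simp: SS_def TT_def)
    ultimately show ?thesis using card_Un_disjoint[OF fin(4,3)] by simp
  qed
  define n2 where "n2 = card (V - V3)"
  have cV: "card V = n2 + card V3" unfolding n2_def using finV by (simp add: V3_def card_Diff_subset card_mono)
  have edges2: "2 * card (uedges E) = 2 * n2 + 3 * card V3"
  proof -
    have "(\<Sum>v\<in>V. card (nbrs E v)) = (\<Sum>v\<in>V - V3. card (nbrs E v)) + (\<Sum>v\<in>V3. card (nbrs E v))"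
      using finV by (intro sum.subset_diff) (auto simp: V3_def)
    also have "(\<Sum>v\<in>V3. card (nbrs E v)) = 3 * card V3" by (simp add: V3_def)
    also have "(\<Sum>v\<in>V - V3. card (nbrs E v)) = (\<Sum>v\<in>V - V3. 2)"
    proof (rule sum.cong[OF refl])
      fix v assume "v \<in> V - V3"
      then show "card (nbrs E v) = 2" using deg_ge_2[of v] deg3[of v] by (auto simp: V3_def)
    qed
    finally show ?thesis using handshake by (simp add: n2_def)
  qed
  \<comment> \<open>the edge of the triangle that is going to be deleted\<close>
  have "\<exists>g. g \<in> uedges E \<and> g \<subseteq> I" if I: "I \<in> TT" for I
  proof -
    obtain v where v: "I = item v" using I by (auto simp: TT_def II_def)
    then have "tri v" using classify[OF v] I by (auto simp: TT_def)
    then obtain a b where "(v, a) \<in> E" "(v, b) \<in> E" "(a, b) \<in> E" by (auto simp: tri_def)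
    then show ?thesis using item_tri v by (intro exI[of _ "{v, a}"]) (auto simp: uedge_iff)
  qed
  then obtain x where x: "\<And>I. I \<in> TT \<Longrightarrow> x I \<in> uedges E \<and> x I \<subseteq> I" by metis
  define K where "K = uedges E - x ` TT"
  have KU: "K \<subseteq> uedges E" by (auto simp: K_def)
  have injx: "inj_on x TT"
  proof (rule inj_onI)
    fix I J assume IJ: "I \<in> TT" "J \<in> TT" "x I = x J"
    obtain u v where "x I = {u, v}" using x[OF IJ(1)] uedges_cases by metis
    then have "u \<in> I \<inter> J" using x[OF IJ(1)] x[OF IJ(2)] IJ(3) by auto
    then show "I = J" using disj[of I J] IJ by (auto simp: TT_def)
  qed
  have cK: "card K + card TT = card (uedges E)"
  proof -
    have "x ` TT \<subseteq> uedges E" using x by auto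
    then have "card K = card (uedges E) - card (x ` TT)" "card (x ` TT) \<le> card (uedges E)"
      unfolding K_def using finite_uedges by (auto intro: card_Diff_subset finite_subset card_mono)
    then show ?thesis using card_image[OF injx] by simp
  qed
  obtain \<Phi> :: "'f set" and B where PhiB: "finite \<Phi> \<and> card K + 2 \<le> card \<Phi> + card V \<and>
      (\<forall>\<phi>\<in>\<Phi>. B \<phi> \<subseteq> K \<and> (\<forall>v. even (card {g \<in> B \<phi>. v \<in> g})) \<and> (card \<Phi> \<ge> 2 \<longrightarrow> B \<phi> \<noteq> {})) \<and>
      (\<forall>g\<in>K. card {\<phi> \<in> \<Phi>. g \<in> B \<phi>} \<le> 2)" using faces[OF KU] by blast
  then have f\<Phi>: "finite \<Phi>" and euler: "card K + 2 \<le> card \<Phi> + card V" and BK: "\<And>\<phi>. \<phi> \<in> \<Phi> \<Longrightarrow> B \<phi> \<subseteq> K"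
    and ev: "\<And>\<phi> v. \<phi> \<in> \<Phi> \<Longrightarrow> even (card {g \<in> B \<phi>. v \<in> g})" and ne: "\<And>\<phi>. \<phi> \<in> \<Phi> \<Longrightarrow> card \<Phi> \<ge> 2 \<Longrightarrow> B \<phi> \<noteq> {}"
    and two: "\<And>g. g \<in> K \<Longrightarrow> card {\<phi> \<in> \<Phi>. g \<in> B \<phi>} \<le> 2" by blast+
  have many: "2 * card \<Phi> \<ge> card SS + card TT + 4" using euler cK cV edges2 cardV3 by linarith
  have fK: "finite K" using KU finite_uedges finite_subset by blast
  have fB: "finite (B \<phi>)" if "\<phi> \<in> \<Phi>" for \<phi> using BK[OF that] fK finite_subset by blast
  have Bedge: "\<exists>a b. a \<noteq> b \<and> g = {a, b} \<and> (a, b) \<in> E" if g: "\<phi> \<in> \<Phi>" "g \<in> B \<phi>" for \<phi> g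
  proof -
    have "g \<in> uedges E" using BK[OF g(1)] KU g(2) by blast
    then show ?thesis by (rule uedges_cases) blast
  qed
  define touch where "touch \<phi> I \<longleftrightarrow> (\<exists>g\<in>B \<phi>. g \<inter> I \<noteq> {})" for \<phi> I
  \<comment> \<open>no triangle survives the deletion, so a cycle in a boundary has at least 4 vertices\<close>
  have six: "card {I \<in> II. touch \<phi> I} \<ge> 6" if \<phi>: "\<phi> \<in> \<Phi>" for \<phi>
  proof -
    have "B \<phi> \<noteq> {}" using ne[OF \<phi>] many by simp
    moreover have "\<exists>a b. a \<noteq> b \<and> g = {a, b}" if "g \<in> B \<phi>" for g
      using Bedge[OF \<phi> that] by blast
    ultimately obtain cs where cs: "distinct cs" "length cs \<ge> 3" "cedges cs \<subseteq> B \<phi>"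
      using even_set_has_cycle[OF fB[OF \<phi>] _ _ ev[OF \<phi>]] by metis
    have csE: "cedges cs \<subseteq> uedges E" using cs(3) BK[OF \<phi>] KU by blast
    have "length cs \<noteq> 3"
    proof
      assume "length cs = 3"
      then obtain a b c where abc: "cs = [a, b, c]" by (auto simp: numeral_eq_Suc length_Suc_conv)
      have e: "{a, b} \<in> K" "{b, c} \<in> K" "{a, c} \<in> K" using cs(3) BK[OF \<phi>] abc by (auto simp: cedges_def insert_commute)
      then have E3: "(a, b) \<in> E" "(a, c) \<in> E" "(b, c) \<in> E" using KU uedge_iff by auto
      have I: "item a = {a, b, c}" "tri a" using item_tri[OF E3] E3 by (auto simp: tri_def)
      have aV: "a \<in> V3" using tri_deg_3[OF I(2)] in_V[OF E3(1)] by (simp add: V3_def)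
      have IT: "item a \<in> TT" using aV cs(1) abc I by (auto simp: TT_def II_def)
      obtain u v where uv: "x (item a) = {u, v}" "u \<noteq> v" using x[OF IT] uedges_cases by metis
      have sub: "{u, v} \<subseteq> {a, b, c}" using x[OF IT] I uv by simp
      have "x (item a) \<in> {{a, b}, {b, c}, {a, c}}"
      proof -
        have "u = a \<or> u = b \<or> u = c" "v = a \<or> v = b \<or> v = c" using sub by auto
        then show ?thesis using uv by (elim disjE) (auto simp: insert_commute)
      qed
      then have "x (item a) \<in> K" using e by auto
      then show False using IT by (auto simp: K_def)
    qed
    then have c6: "card (item ` {v \<in> set cs. card (nbrs E v) = 3}) \<ge> 6"
      using cycles_meet_six_items[OF cs(1) _ csE] cs(2) by simp
    have "item ` {v \<in> set cs. card (nbrs E v) = 3} \<subseteq> {I \<in> II. touch \<phi> I}"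
    proof
      fix I assume "I \<in> item ` {v \<in> set cs. card (nbrs E v) = 3}"
      then obtain v where v: "v \<in> set cs" "card (nbrs E v) = 3" "I = item v" by auto
      have "\<exists>g\<in>cedges cs. v \<in> g"
      proof -
        have "\<exists>g\<in>pedges cs. v \<in> g" using on_pedge[OF v(1)] cs(2) by simp
        then show ?thesis by (auto simp: cedges_def)
      qed
      then obtain g where g: "g \<in> cedges cs" "v \<in> g" by blast
      then have "touch \<phi> I" using cs(3) v(3) item_self unfolding touch_def by blast
      moreover have "v \<in> V"
      proof -
        obtain a b where "(a, b) \<in> E" "g = {a, b}" using Bedge[OF \<phi>, of g] g(1) cs(3) by blast
        then show ?thesis using g(2) in_V by blast
      qed
      ultimately show "I \<in> {I \<in> II. touch \<phi> I}" using v by (auto simp: II_def V3_def)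
    qed
    then have "card (item ` {v \<in> set cs. card (nbrs E v) = 3}) \<le> card {I \<in> II. touch \<phi> I}" using fin by (intro card_mono) auto
    then show ?thesis using c6 by simp
  qed
  \<comment> \<open>at most three edges leave an item, and a boundary that touches it uses at least two of them\<close>
  have three: "card {\<phi> \<in> \<Phi>. touch \<phi> I} \<le> 3" if I: "I \<in> II" for I
  proof -
    obtain v where v: "v \<in> V3" "I = item v" using I by (auto simp: II_def)
    define \<delta> where "\<delta> = {g \<in> K. card (g \<inter> I) = 1}"
    have f\<delta>: "finite \<delta>" using fK by (simp add: \<delta>_def)
    have "\<delta> \<subseteq> (\<Union>w\<in>I. (\<lambda>u. {w, u}) ` (nbrs E w - I))"
    proof
      fix g assume g: "g \<in> \<delta>"
      then have "g \<in> uedges E" using KU by (auto simp: \<delta>_def)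
      then obtain a b where ab: "(a, b) \<in> E" "g = {a, b}" "a \<noteq> b" by (rule uedges_cases)
      have c1: "card ({a, b} \<inter> I) = 1" using g ab by (simp add: \<delta>_def)
      have "(a \<in> I) \<noteq> (b \<in> I)" using c1 ab(3) by (cases "a \<in> I"; cases "b \<in> I") auto
      then show "g \<in> (\<Union>w\<in>I. (\<lambda>u. {w, u}) ` (nbrs E w - I))" using ab(1,2) symE unfolding nbrs_def by blast
    qed
    then have "card \<delta> \<le> card (\<Union>w\<in>I. (\<lambda>u. {w, u}) ` (nbrs E w - I))" using finI[OF I] fin_nbrs by (intro card_mono) auto
    also have "\<dots> \<le> (\<Sum>w\<in>I. card ((\<lambda>u. {w, u}) ` (nbrs E w - I)))" by (rule card_UN_le[OF finI[OF I]])
    also have "\<dots> \<le> (\<Sum>w\<in>I. card (nbrs E w - I))" using fin_nbrs by (intro sum_mono card_image_le) auto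
    also have "\<dots> \<le> 3"
    proof (cases "tri v")
      case True
      then have "(\<Sum>w\<in>I. card (nbrs E w - I)) \<le> (\<Sum>w\<in>I. 1)" using triangle_item_degree(1) v(2) by (intro sum_mono) auto
      then show ?thesis using triangle_item_degree(2)[OF True item_self] v(2) by simp
    next
      case False
      then have "I = {v}" using item_nontri v by simp
      then show ?thesis using deg3[of v] card_mono[OF fin_nbrs, of "nbrs E v - {v}" v] by auto
    qed
    finally have c\<delta>: "card \<delta> \<le> 3" .
    have cross: "card {g \<in> \<delta>. g \<in> B \<phi>} \<ge> 2" if \<phi>: "\<phi> \<in> \<Phi>" "touch \<phi> I" for \<phi>
    proof -
      have ca: "card (g \<inter> I) \<in> {0, 1, 2}" if g: "g \<in> B \<phi>" for g
      proof -
        obtain a b where "g = {a, b}" using Bedge[OF \<phi>(1) g] by blast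
        then have "card (g \<inter> I) \<le> card {a, b}" by (intro card_mono) auto
        also have "\<dots> \<le> 2" by (simp add: card_insert_if)
        finally show ?thesis by auto
      qed
      have "(\<Sum>w\<in>I. card {g \<in> B \<phi>. w \<in> g}) = (\<Sum>g\<in>B \<phi>. card (g \<inter> I))"
      proof -
        have "(\<Sum>w\<in>I. card {g \<in> B \<phi>. w \<in> g}) = (\<Sum>w\<in>I. \<Sum>g\<in>B \<phi>. of_bool (w \<in> g))"
          using fB[OF \<phi>(1)] by (simp add: Int_def)
        also have "\<dots> = (\<Sum>g\<in>B \<phi>. \<Sum>w\<in>I. of_bool (w \<in> g))" by (rule sum.swap)
        also have "\<dots> = (\<Sum>g\<in>B \<phi>. card (g \<inter> I))" using finI[OF I] by (simp add: Int_def conj_commute)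
        finally show ?thesis .
      qed
      moreover have "even (\<Sum>w\<in>I. card {g \<in> B \<phi>. w \<in> g})" using ev[OF \<phi>(1)] by (intro dvd_sum) auto
      ultimately have "even (\<Sum>g\<in>B \<phi>. card (g \<inter> I))" by simp
      then have "even (card {g \<in> B \<phi>. odd (card (g \<inter> I))})" unfolding even_sum_iff[OF fB[OF \<phi>(1)]] by simp
      moreover have eq: "{g \<in> B \<phi>. odd (card (g \<inter> I))} = {g \<in> \<delta>. g \<in> B \<phi>}"
        using ca BK[OF \<phi>(1)] unfolding \<delta>_def by fastforce
      ultimately have even: "even (card {g \<in> \<delta>. g \<in> B \<phi>})" by simp
      have "{g \<in> \<delta>. g \<in> B \<phi>} \<noteq> {}"
      proof
        assume none: "{g \<in> \<delta>. g \<in> B \<phi>} = {}"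
        have inner: "g \<subseteq> I" if g: "g \<in> B \<phi>" "g \<inter> I \<noteq> {}" for g
        proof -
          obtain a b where ab: "g = {a, b}" "a \<noteq> b" using Bedge[OF \<phi>(1) g(1)] by blast
          have "card (g \<inter> I) \<noteq> 1" using none g BK[OF \<phi>(1)] by (auto simp: \<delta>_def)
          then show ?thesis using g(2) ab by (cases "a \<in> I"; cases "b \<in> I") auto
        qed
        obtain g where g: "g \<in> B \<phi>" "g \<inter> I \<noteq> {}" using \<phi>(2) by (auto simp: touch_def)
        obtain a b where "g = {a, b}" "a \<noteq> b" using Bedge[OF \<phi>(1) g(1)] by blast
        with g BK[OF \<phi>(1)] have ab: "g = {a, b}" "a \<noteq> b" "{a, b} \<in> K" by auto
        have abI: "a \<in> I" "b \<in> I" using inner[OF g] ab by auto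
        have "tri v"
        proof (rule ccontr)
          assume "\<not> tri v"
          then have "I = {v}" using item_nontri v by simp
          then show False using abI ab by auto
        qed
        then have IT: "I \<in> TT" using I v triangle_item_degree(2)[OF _ item_self] by (auto simp: TT_def)
        obtain y z where yz: "x I = {y, z}" "y \<noteq> z" using x[OF IT] uedges_cases by metis
        have yzI: "y \<in> I" "z \<in> I" using x[OF IT] yz by auto
        have c3: "card I = 3" using IT by (simp add: TT_def)
        have "card (I - {y, z}) = 1" using c3 yzI yz(2) finI[OF I] by (simp add: card_Diff_subset)
        then obtain u where u: "I - {y, z} = {u}" by (auto simp: card_1_singleton_iff)
        have Iu: "I = {y, z, u}" "u \<noteq> y" "u \<noteq> z" using u yzI by auto
        have yzK: "{y, z} \<notin> K" using IT yz(1) unfolding K_def by (metis DiffD2 image_eqI)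
        \<comment> \<open>an end of the missing edge has at most one boundary edge, hence none\<close>
        have noend: "{p, u} \<notin> B \<phi>" if p: "p = y \<or> p = z" for p
        proof
          assume pu: "{p, u} \<in> B \<phi>"
          have "{g \<in> B \<phi>. p \<in> g} = {{p, u}}"
          proof (intro equalityI subsetI)
            fix h assume h: "h \<in> {g \<in> B \<phi>. p \<in> g}"
            then have hI: "h \<subseteq> I" using inner[of h] p yzI by auto
            obtain c d where cd: "h = {c, d}" "c \<noteq> d" using Bedge[OF \<phi>(1), of h] h by blast
            have "h \<in> K" using h BK[OF \<phi>(1)] by auto
            then have hyz: "h \<noteq> {y, z}" using yzK by auto
            show "h \<in> {{p, u}}" using h hI cd Iu p hyz by (auto simp: doubleton_eq_iff)
          qed (use pu in auto)
          then have "card {g \<in> B \<phi>. p \<in> g} = 1" by simp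
          then show False using ev[OF \<phi>(1), of p] by simp
        qed
        have "{a, b} \<noteq> {y, z}" using ab(3) yzK by auto
        moreover have "{a, b} \<noteq> {y, u}" "{a, b} \<noteq> {z, u}" using noend g(1) ab(1) by auto
        ultimately show False using abI ab(2) Iu by (auto simp: doubleton_eq_iff)
      qed
      then have "card {g \<in> \<delta>. g \<in> B \<phi>} \<noteq> 0" using f\<delta> by auto
      then show ?thesis using even by presburger
    qed
    let ?T = "{\<phi> \<in> \<Phi>. touch \<phi> I}"
    have "2 * card ?T = (\<Sum>\<phi>\<in>?T. 2)" by simp
    also have "\<dots> \<le> (\<Sum>\<phi>\<in>?T. card {g \<in> \<delta>. g \<in> B \<phi>})" using cross by (intro sum_mono) auto
    also have "\<dots> \<le> (\<Sum>\<phi>\<in>\<Phi>. card {g \<in> \<delta>. g \<in> B \<phi>})" using f\<Phi> by (intro sum_mono2) auto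
    also have "\<dots> = (\<Sum>\<phi>\<in>\<Phi>. \<Sum>g\<in>\<delta>. of_bool (g \<in> B \<phi>))" using f\<delta> by (simp add: Int_def)
    also have "\<dots> = (\<Sum>g\<in>\<delta>. \<Sum>\<phi>\<in>\<Phi>. of_bool (g \<in> B \<phi>))" by (rule sum.swap)
    also have "\<dots> = (\<Sum>g\<in>\<delta>. card {\<phi> \<in> \<Phi>. g \<in> B \<phi>})" using f\<Phi> by (simp add: Int_def)
    also have "\<dots> \<le> (\<Sum>g\<in>\<delta>. 2)" using two by (intro sum_mono) (auto simp: \<delta>_def)
    also have "\<dots> \<le> 6" using c\<delta> by simp
    finally show ?thesis by simp
  qed
  have "6 * card \<Phi> \<le> (\<Sum>\<phi>\<in>\<Phi>. card {I \<in> II. touch \<phi> I})" using six sum_mono[of \<Phi> "\<lambda>_. 6" "\<lambda>\<phi>. card {I \<in> II. touch \<phi> I}"] by simp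
  also have "\<dots> = (\<Sum>\<phi>\<in>\<Phi>. \<Sum>I\<in>II. of_bool (touch \<phi> I))" using fin by (simp add: Int_def)
  also have "\<dots> = (\<Sum>I\<in>II. \<Sum>\<phi>\<in>\<Phi>. of_bool (touch \<phi> I))" by (rule sum.swap)
  also have "\<dots> = (\<Sum>I\<in>II. card {\<phi> \<in> \<Phi>. touch \<phi> I})" using f\<Phi> by (simp add: Int_def)
  also have "\<dots> \<le> (\<Sum>I\<in>II. 3)" using three by (intro sum_mono) auto
  also have "\<dots> = 3 * (card SS + card TT)" using cII by simp
  finally have "6 * card \<Phi> \<le> 3 * (card SS + card TT)" .
  moreover have "3 * (card SS + card TT + 4) \<le> 3 * (2 * card \<Phi>)" by (rule mult_le_mono2[OF many])
  ultimately have "3 * (card SS + card TT) + 12 \<le> 3 * (card SS + card TT)" by simp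
  then show False by simp
qed

end

section \<open>The square of a planar subcubic graph\<close>

theorem drawn_graph_reducible:
  assumes "sparse_subcubic V E" "drawing E pos \<gamma>" "V \<noteq> {}"
  shows "reducible V E"
proof (rule ccontr)
  assume "\<not> reducible V E"
  then interpret irreducible_graph V E
    using assms(1) by (simp add: irreducible_graph_def irreducible_graph_axioms_def)
  interpret D: drawing E pos \<gamma> by fact
  have "\<exists>(\<Phi> :: complex set set) B. finite \<Phi> \<and> card K + 2 \<le> card \<Phi> + card V \<and>
      (\<forall>\<phi>\<in>\<Phi>. B \<phi> \<subseteq> K \<and> (\<forall>v. even (card {g \<in> B \<phi>. v \<in> g})) \<and> (card \<Phi> \<ge> 2 \<longrightarrow> B \<phi> \<noteq> {})) \<and>
      (\<forall>g\<in>K. card {\<phi> \<in> \<Phi>. g \<in> B \<phi>} \<le> 2)" if "K \<subseteq> uedges E" for K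
  proof -
    have "K \<subseteq> uedges E" using that .
    from D.face_boundaries[OF finV assms(3) EV this] obtain \<Phi> :: "complex set set" and B where
      "finite \<Phi>" "card K + 2 \<le> card \<Phi> + card V" "\<And>\<phi>. \<phi> \<in> \<Phi> \<Longrightarrow> B \<phi> \<subseteq> K"
      "\<And>\<phi> v. \<phi> \<in> \<Phi> \<Longrightarrow> even (card {g \<in> B \<phi>. v \<in> g})"
      "\<And>\<phi>. \<phi> \<in> \<Phi> \<Longrightarrow> card \<Phi> \<ge> 2 \<Longrightarrow> B \<phi> \<noteq> {}"
      "\<And>g. g \<in> K \<Longrightarrow> card {\<phi> \<in> \<Phi>. g \<in> B \<phi>} \<le> 2" by blast
    then show ?thesis by (intro exI[of _ \<Phi>] exI[of _ B]) simp
  qed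
  from no_face_boundaries[OF this] show False .
qed

lemma sym_sq: assumes "\<And>u v. (u, v) \<in> E \<Longrightarrow> (v, u) \<in> E" shows "sym (sq E)"
proof (rule symI)
  fix u v assume "(u, v) \<in> sq E"
  then have "u \<noteq> v" "(u, v) \<in> E \<or> (\<exists>w. (u, w) \<in> E \<and> (w, v) \<in> E)" by (auto simp: sq_def)
  then have "v \<noteq> u" "(v, u) \<in> E \<or> (\<exists>w. (v, w) \<in> E \<and> (w, u) \<in> E)" using assms by blast+
  then show "(v, u) \<in> sq E" by (simp add: sq_def)
qed

lemma sparse_subcubic_subgraph:
  assumes "sparse_subcubic V E" and V': "V' \<subseteq> V" shows "sparse_subcubic V' (E \<inter> V' \<times> V')"
proof -
  interpret sparse_subcubic V E by fact
  show ?thesis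
  proof
    show "finite V'" using V' finV finite_subset by blast
    show "card (nbrs (E \<inter> V' \<times> V') v) \<le> 3" for v
    proof -
      have "card (nbrs (E \<inter> V' \<times> V') v) \<le> card (nbrs E v)" by (rule card_mono[OF fin_nbrs]) (auto simp: nbrs_def)
      then show ?thesis using deg3[of v] by simp
    qed
    show "\<not> cedges cs \<subseteq> uedges (E \<inter> V' \<times> V')" if "distinct cs" "4 \<le> length cs" "length cs \<le> 8" for cs
    proof -
      have "uedges (E \<inter> V' \<times> V') \<subseteq> uedges E" by (auto simp: uedges_def)
      then show ?thesis using no_cycle[OF that] by blast
    qed
  qed (use symE irrE in auto)
qed

lemma drawing_subgraph:
  assumes "drawing E pos \<gamma>" shows "drawing (E \<inter> V' \<times> V') pos \<gamma>"
proof -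
  interpret drawing E pos \<gamma> by fact
  show ?thesis
  proof
    show "finite (E \<inter> V' \<times> V')" using finE by simp
    fix u v assume "(u, v) \<in> E \<inter> V' \<times> V'"
    then have uv: "(u, v) \<in> E" "u \<in> V'" "v \<in> V'" by auto
    show "(v, u) \<in> E \<inter> V' \<times> V'" using symE[OF uv(1)] uv by simp
    show "Path_Connected.arc (\<gamma> (u, v))" by (rule arc_\<gamma>[OF uv(1)])
    show "pathstart (\<gamma> (u, v)) = pos u" by (rule start_\<gamma>[OF uv(1)])
    show "pathfinish (\<gamma> (u, v)) = pos v" by (rule finish_\<gamma>[OF uv(1)])
    show "\<gamma> (v, u) = reversepath (\<gamma> (u, v))" by (rule rev_\<gamma>[OF uv(1)])
    fix x y assume "(x, y) \<in> E \<inter> V' \<times> V'" "{u, v} \<noteq> {x, y}"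
    then show "path_image (\<gamma> (u, v)) \<inter> path_image (\<gamma> (x, y)) \<subseteq> pos ` ({u, v} \<inter> {x, y})"
      using meet_\<gamma>[OF uv(1)] by blast
  qed
qed

theorem AT_square:
  assumes "sparse_subcubic V E" "drawing E pos \<gamma>"
  shows "AT_on (sq E) (\<lambda>_. 5)"
  using assms
proof (induction "card V" arbitrary: V E rule: less_induct)
  case less
  interpret sparse_subcubic V E by fact
  show ?case
  proof (cases "V = {}")
    case True
    then have "sq E = {}" using EV by (auto simp: sq_def)
    then show ?thesis using AT_on_empty by simp
  next
    case False
    from drawn_graph_reducible[OF less(2,3) False] obtain S b where S: "S \<subseteq> V" "S \<noteq> {}" "AT_on (sq E \<inter> S \<times> S) b"
      and b: "\<And>w. w \<in> S \<Longrightarrow> b w + card {a \<in> V - S. (a, w) \<in> sq E} \<le> 5"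
      and rest: "sq E \<inter> (V - S) \<times> (V - S) = sq (E \<inter> (V - S) \<times> (V - S))" by (auto simp: reducible_def)
    have "card (V - S) < card V" using S finV by (intro psubset_card_mono) auto
    from less(1)[OF this sparse_subcubic_subgraph[OF less(2)] drawing_subgraph[OF less(3)]]
    have IH: "AT_on (sq E \<inter> (V - S) \<times> (V - S)) (\<lambda>_. 5)" unfolding rest by blast
    have "finite (V - S)" "finite S" using finV S finite_subset by auto
    moreover have "sq E \<subseteq> ((V - S) \<union> S) \<times> ((V - S) \<union> S)" using EV by (auto simp: sq_def)
    moreover have "sym (sq E)" using symE by (rule sym_sq)
    ultimately have "AT_on (sq E) (\<lambda>w. if w \<in> S then b w + card {a \<in> V - S. (a, w) \<in> sq E} else 5)"
      using AT_extend[OF _ _ _ _ _ IH S(3)] by auto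
    then show ?thesis by (rule AT_on_mono) (use b in auto)
  qed
qed

text \<open>
  Cycles of a digraph are defined by arc walks; this is the arc walk through a given list of vertices.
\<close>

lemma pawalk_of_list:
  "xs \<noteq> [] \<Longrightarrow> pcas (hd xs) (zip xs (tl xs)) (last xs) \<and> pawalk_verts (hd xs) (zip xs (tl xs)) = xs"
proof (induction xs rule: pedges.induct)
  case (1 x y xs)
  then show ?case by simp
qed auto

lemma list_cycle_is_cycle:
  assumes G: "pair_graph G" and cs: "distinct cs" "cs \<noteq> []" "cedges cs \<subseteq> uedges (parcs G)"
  shows "has_cycle_of_length G (length cs)"
proof -
  interpret pair_graph G by fact
  have sym: "(u, v) \<in> parcs G \<Longrightarrow> (v, u) \<in> parcs G" for u v
    using pair_sym_arcs by (auto simp: symmetric_def symp_on_def sym_def)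
  have ue: "{u, v} \<in> uedges (parcs G) \<Longrightarrow> (u, v) \<in> parcs G" for u v
    using sym by (auto simp: uedges_def doubleton_eq_iff)
  let ?xs = "cs @ [hd cs]"
  let ?p = "zip ?xs (tl ?xs)"
  have "pedges ?xs \<subseteq> uedges (parcs G)" using pedges_append2[OF cs(2), of "hd cs" "[]"] cs(3) by (auto simp: cedges_def)
  moreover have "set (zip xs (tl xs)) \<subseteq> parcs G" if "pedges xs \<subseteq> uedges (parcs G)" for xs
    using that by (induction xs rule: pedges.induct) (auto dest: ue)
  ultimately have arcs: "set ?p \<subseteq> parcs G" by blast
  have w: "pcas (hd cs) ?p (hd cs)" "pawalk_verts (hd cs) ?p = ?xs" using pawalk_of_list[of ?xs] cs(2) by auto
  have len: "length ?p = length cs" using cs(2) by (cases cs) auto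
  then have ne: "?p \<noteq> []" using cs(2) by auto
  have "hd cs \<in> pverts G"
  proof -
    obtain e es where p: "?p = e # es" using ne by (cases ?p) auto
    then have "fst e = hd cs" using w(1) by simp
    moreover have "e \<in> parcs G" using arcs p by auto
    ultimately show ?thesis using arc_fst_in_verts[of e] by simp
  qed
  then have "awalk (hd cs) ?p (hd cs)" using arcs w(1) by (simp add: awalk_def)
  moreover have "distinct (tl (awalk_verts (hd cs) ?p))" using w(2) cs(1,2) by (cases cs) auto
  ultimately have "cycle ?p" unfolding cycle_def using ne by blast
  then show ?thesis unfolding has_cycle_of_length_def using len by blast
qed

lemma graph_dist_le_2:
  assumes G: "pair_graph G" and uv: "u \<noteq> v" "u \<in> pverts G"
  shows "graph_dist G u v \<le> 2 \<longleftrightarrow> (u, v) \<in> parcs G \<or> (\<exists>w. (u, w) \<in> parcs G \<and> (w, v) \<in> parcs G)"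
proof -
  interpret pair_graph G by fact
  have cost: "awalk_cost (\<lambda>_. 1) p = real (length p)" for p :: "('a \<times> 'a) list" by (induction p) auto
  have mu: "graph_dist G u v = (INF p\<in>{p. awalk u p v}. ereal (real (length p)))"
    unfolding graph_dist_def \<mu>_def cost ..
  show ?thesis
  proof
    assume "graph_dist G u v \<le> 2"
    then have "(INF p\<in>{p. awalk u p v}. ereal (real (length p))) < 3" unfolding mu by (rule le_less_trans) simp
    then obtain p where p: "awalk u p v" "ereal (real (length p)) < 3" unfolding INF_less_iff by auto
    then have "real (length p) < 3" by simp
    then have "length p < 3" by simp
    moreover have c: "set p \<subseteq> parcs G" "pcas u p v" using p(1) by (auto simp: awalk_def)
    ultimately show "(u, v) \<in> parcs G \<or> (\<exists>w. (u, w) \<in> parcs G \<and> (w, v) \<in> parcs G)"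
      using uv(1) by (cases p; cases "tl p"; cases "tl (tl p)") auto
  next
    assume "(u, v) \<in> parcs G \<or> (\<exists>w. (u, w) \<in> parcs G \<and> (w, v) \<in> parcs G)"
    then have "\<exists>p. awalk u p v \<and> length p \<le> 2"
    proof
      assume "(u, v) \<in> parcs G" then show ?thesis using uv by (intro exI[of _ "[(u, v)]"]) (auto simp: awalk_def)
    next
      assume "\<exists>w. (u, w) \<in> parcs G \<and> (w, v) \<in> parcs G"
      then obtain w where "(u, w) \<in> parcs G" "(w, v) \<in> parcs G" by blast
      then show ?thesis using uv by (intro exI[of _ "[(u, w), (w, v)]"]) (auto simp: awalk_def)
    qed
    then obtain p where p: "awalk u p v" "length p \<le> 2" by blast
    have "graph_dist G u v \<le> ereal (real (length p))" unfolding mu using p(1) by (intro INF_lower) auto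
    also have "\<dots> \<le> 2" using p(2) by simp
    finally show "graph_dist G u v \<le> 2" .
  qed
qed

lemma parcs_square: assumes "pair_graph G" shows "parcs (square G) = sq (parcs G)"
proof -
  interpret pair_graph G by fact
  show ?thesis
  proof (intro equalityI subsetI)
    fix p assume p: "p \<in> parcs (square G)"
    then show "p \<in> sq (parcs G)" using graph_dist_le_2[OF assms] by (auto simp: square_def sq_def)
  next
    fix p assume "p \<in> sq (parcs G)"
    then obtain u v where uv: "p = (u, v)" "u \<noteq> v" "(u, v) \<in> parcs G \<or> (\<exists>w. (u, w) \<in> parcs G \<and> (w, v) \<in> parcs G)"
      by (auto simp: sq_def)
    then have "u \<in> pverts G" "v \<in> pverts G" using in_arcsD1 in_arcsD2 by blast+
    then show "p \<in> parcs (square G)" using uv graph_dist_le_2[OF assms uv(2)] by (auto simp: square_def)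
  qed
qed

lemma pair_graph_square: assumes "pair_graph G" shows "pair_graph (square G)"
proof -
  interpret pair_graph G by fact
  have sym: "(u, v) \<in> parcs G \<Longrightarrow> (v, u) \<in> parcs G" for u v
    using pair_sym_arcs by (auto simp: symmetric_def symp_on_def sym_def)
  have pv: "pverts (square G) = pverts G" by (simp add: square_def)
  have sub: "parcs (square G) \<subseteq> pverts G \<times> pverts G" by (auto simp: square_def)
  show ?thesis
  proof
    show "finite (pverts (square G))" unfolding pv by (rule pair_finite_verts)
    show "finite (parcs (square G))" using sub pair_finite_verts by (auto intro: finite_subset)
    show "symmetric (with_proj (square G))"
      unfolding symmetric_def with_proj_simps parcs_square[OF assms] using sym by (rule sym_sq)
  qed (use sub pv in \<open>auto simp: square_def\<close>)
qed

theorem theorem3: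
  fixes G :: "'a pair_pre_digraph" and r :: "'a rel"
  assumes "pair_graph G"
    and "planar G"
    and "subcubic G"
    and "\<And>k. 4 \<le> k \<Longrightarrow> k \<le> 8 \<Longrightarrow> \<not> has_cycle_of_length G k"
    and "strict_linear_order_on (pverts G) r"
  shows "AT r (square G) \<le> 6"
proof -
  interpret pair_graph G by fact
  have sym: "(u, v) \<in> parcs G \<Longrightarrow> (v, u) \<in> parcs G" for u v
    using pair_sym_arcs by (auto simp: symmetric_def symp_on_def sym_def)
  obtain pos \<gamma> where pd: "plane_drawing G pos \<gamma>" using assms(2) by (auto simp: planar_def)
  have edge: "Path_Connected.arc (\<gamma> (u, v)) \<and> pathstart (\<gamma> (u, v)) = pos u \<and> pathfinish (\<gamma> (u, v)) = pos v \<and>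
      \<gamma> (v, u) = reversepath (\<gamma> (u, v))" if "(u, v) \<in> parcs G" for u v
    using pd that unfolding plane_drawing_def by blast
  have meet: "path_image (\<gamma> (u, v)) \<inter> path_image (\<gamma> (x, y)) \<subseteq> pos ` ({u, v} \<inter> {x, y})"
    if "(u, v) \<in> parcs G" "(x, y) \<in> parcs G" "{u, v} \<noteq> {x, y}" for u v x y
    using pd that unfolding plane_drawing_def by blast
  have dr: "drawing (parcs G) pos \<gamma>"
  proof
    show "finite (parcs G)" by (rule pair_finite_arcs)
  qed (use edge meet sym in blast)+
  have sp: "sparse_subcubic (pverts G) (parcs G)"
  proof
    show "finite (pverts G)" by (rule pair_finite_verts)
    show "parcs G \<subseteq> pverts G \<times> pverts G" using in_arcsD1 in_arcsD2 by auto
    show "(u, v) \<in> parcs G \<Longrightarrow> (v, u) \<in> parcs G" for u v by (rule sym)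
    show "(u, u) \<notin> parcs G" for u using pair_no_loops by force
    show "card (nbrs (parcs G) v) \<le> 3" for v
    proof (cases "v \<in> pverts G")
      case True
      have "out_arcs (with_proj G) v = Pair v ` nbrs (parcs G) v" by (auto simp: out_arcs_def nbrs_def)
      then have "out_degree (with_proj G) v = card (nbrs (parcs G) v)"
        by (simp add: out_degree_def card_image inj_on_def)
      then show ?thesis using assms(3) True by (auto simp: subcubic_def)
    next
      case False
      then have "nbrs (parcs G) v = {}" using in_arcsD1 by (auto simp: nbrs_def)
      then show ?thesis by simp
    qed
    show "\<not> cedges cs \<subseteq> uedges (parcs G)" if cs: "distinct cs" "4 \<le> length cs" "length cs \<le> 8" for cs
    proof
      assume "cedges cs \<subseteq> uedges (parcs G)"
      moreover have "cs \<noteq> []" using cs(2) by auto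
      ultimately have "has_cycle_of_length G (length cs)" using list_cycle_is_cycle[OF assms(1) cs(1)] by blast
      then show False using assms(4)[OF cs(2,3)] by simp
    qed
  qed
  have "AT_on (parcs (square G)) (\<lambda>_. 5)" using AT_square[OF sp dr] parcs_square[OF assms(1)] by simp
  moreover have "strict_linear_order_on (pverts (square G)) r" using assms(5) by (simp add: square_def)
  ultimately have "Alon_Tarsi_choosable r (Suc 5) (square G)"
    using AT_on_choosable[OF pair_graph_square[OF assms(1)]] by blast
  then show ?thesis unfolding AT_def by (intro Least_le) simp
qed

end
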